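(* For any pair of positive integers $(m,n)$ with $n\ge 2$, there exists a constant $C_{m,n}$, depending only on $m$ and $n$, such that for every $C>C_{m,n}$ there exists an unbounded Reinhardt domain $\Omega_C\subseteq\mathbb{C}^n$ with the following properties: (1) The Bergman space $A^2(\Omega_C)$ is spanned by $\{z^\alpha:\alpha\in\mathbb{N}^n,\ |\alpha|\le m\}$. In particular, the Bergman space separates points. (2) The Bergman kernel of $\Omega_C$ is given (on the diagonal) by $K_C(z,z)=C(1+\|z\|^2)^m$. Consequently, the Bergman metric of $\Omega_C$ coincides with the restriction to $\Omega_C\subseteq\mathbb{C}^n\subseteq\mathbb{P}^n$ of $m$ times the Fubini--Study metric.
   Context: $\mathbb{N}$ is the set of nonnegative integers; for $\alpha\in\mathbb{N}^n$, $z^\alpha=z_1^{\alpha_1}\cdots z_n^{\alpha_n}$ and $|\alpha|=\alpha_1+\cdots+\alpha_n$. A domain is a nonempty connected open set. A domain $\Omega\subseteq\mathbb{C}^n$ is Reinhardt if it is invariant under $(z_1,\dots,z_n)\mapsto(e^{i\theta_1}z_1,\dots,e^{i\theta_n}z_n)$ for all real $\theta_j$. For a domain $\Omega\subseteq\mathbb{C}^n$, the Bergman space $A^2(\Omega)$ is the Hilbert space of holomorphic functions on $\Omega$ that are square integrable with respect to Lebesgue measure $V_{2n}$, with inner product $\int_\Omega f\overline{g}\,dV_{2n}$. The Bergman kernel is $K_\Omega(z,w)=\sum_k\phi_k(z)\overline{\phi_k(w)}$ for any orthonormal basis $\{\phi_k\}$ of $A^2(\Omega)$. The Bergman space separates points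 if for any two distinct points $\xi_1,\xi_2\in\Omega$ there is $f\in A^2(\Omega)$ with $f(\xi_1)=0$ and $f(\xi_2)\ne0$. The Bergman metric is the Kähler metric with Kähler form $i\partial\bar\partial\log K_\Omega(z,z)$ (when this is positive definite). $\mathbb{C}^n\subseteq\mathbb{P}^n$ is the standard affine chart, on which the Fubini--Study metric has Kähler form $i\partial\bar\partial\log(1+\|z\|^2)$. *)

theory Defs
  imports "HOL-Analysis.Analysis" "HOL-Library.Function_Algebras"
begin

text \<open>
  Complex \<open>n\<close>-space is the type \<open>complex ^ 'n\<close> with \<open>n = CARD('n)\<close>. Its \<open>norm\<close> is the Hermitian
  norm, and \<open>lborel\<close> on it is Lebesgue measure in the \<open>2n\<close> real coordinates.
\<close>

section \<open>Domains and holomorphic functions\<close>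

definition domain :: "(complex ^ 'n) set \<Rightarrow> bool" where
  "domain \<Omega> \<longleftrightarrow> \<Omega> \<noteq> {} \<and> open \<Omega> \<and> connected \<Omega>"

definition reinhardt_domain :: "(complex ^ 'n) set \<Rightarrow> bool" where
  "reinhardt_domain \<Omega> \<longleftrightarrow> domain \<Omega> \<and>
     (\<forall>\<theta> :: 'n \<Rightarrow> real. \<forall>z\<in>\<Omega>. (\<chi> j. exp (\<i> * complex_of_real (\<theta> j)) * z $ j) \<in> \<Omega>)"

text \<open>Intended for open \<open>\<Omega>\<close>: the real Frechet derivative exists and is complex linear.\<close>

definition holomorphic_cn :: "(complex ^ 'n) set \<Rightarrow> (complex ^ 'n \<Rightarrow> complex) \<Rightarrow> bool" where
  "holomorphic_cn \<Omega> f \<longleftrightarrow>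
     (\<forall>z\<in>\<Omega>. \<exists>D. (f has_derivative D) (at z) \<and> Vector_Spaces.linear (*s) (*) D)"

section \<open>The Bergman space\<close>

text \<open>
  Functions on \<open>\<Omega>\<close> are represented by total functions that vanish off \<open>\<Omega>\<close>, so that equality
  of functions is equality on \<open>\<Omega>\<close>.
\<close>

definition bergman_space :: "(complex ^ 'n) set \<Rightarrow> (complex ^ 'n \<Rightarrow> complex) set" where
  "bergman_space \<Omega> = {f. (\<forall>z. z \<notin> \<Omega> \<longrightarrow> f z = 0) \<and> holomorphic_cn \<Omega> f \<and>
     set_integrable lborel \<Omega> (\<lambda>z. (cmod (f z))\<^sup>2)}"

definition bergman_inner ::
  "(complex ^ 'n) set \<Rightarrow> (complex ^ 'n \<Rightarrow> complex) \<Rightarrow> (complex ^ 'n \<Rightarrow> complex) \<Rightarrow> complex" where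
  "bergman_inner \<Omega> f g = (LINT z:\<Omega>|lborel. f z * cnj (g z))"

definition bergman_norm :: "(complex ^ 'n) set \<Rightarrow> (complex ^ 'n \<Rightarrow> complex) \<Rightarrow> real" where
  "bergman_norm \<Omega> f = sqrt (Re (bergman_inner \<Omega> f f))"

definition fun_scale :: "complex \<Rightarrow> ('a \<Rightarrow> complex) \<Rightarrow> 'a \<Rightarrow> complex" where
  "fun_scale c f = (\<lambda>z. c * f z)"

text \<open>The library's \<open>span\<close> without qualifier is the real span; here the complex one is needed.\<close>

interpretation cfun: vector_space "fun_scale :: complex \<Rightarrow> ('a \<Rightarrow> complex) \<Rightarrow> 'a \<Rightarrow> complex"
  by unfold_locales (auto simp: fun_scale_def fun_eq_iff algebra_simps)

abbreviation cspan :: "('a \<Rightarrow> complex) set \<Rightarrow> ('a \<Rightarrow> complex) set" where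
  "cspan \<equiv> module.span fun_scale"

definition multi_degree :: "('n::finite \<Rightarrow> nat) \<Rightarrow> nat" where
  "multi_degree \<alpha> = (\<Sum>j\<in>UNIV. \<alpha> j)"

definition monomial_on :: "(complex ^ 'n) set \<Rightarrow> ('n \<Rightarrow> nat) \<Rightarrow> complex ^ 'n \<Rightarrow> complex" where
  "monomial_on \<Omega> \<alpha> = (\<lambda>z. if z \<in> \<Omega> then (\<Prod>j\<in>UNIV. (z $ j) ^ \<alpha> j) else 0)"

definition bergman_separates_points :: "(complex ^ 'n) set \<Rightarrow> bool" where
  "bergman_separates_points \<Omega> \<longleftrightarrow>
     (\<forall>\<xi>1\<in>\<Omega>. \<forall>\<xi>2\<in>\<Omega>. \<xi>1 \<noteq> \<xi>2 \<longrightarrow> (\<exists>f\<in>bergman_space \<Omega>. f \<xi>1 = 0 \<and> f \<xi>2 \<noteq> 0))"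

section \<open>The Bergman kernel\<close>

definition bergman_onb :: "(complex ^ 'n) set \<Rightarrow> (complex ^ 'n \<Rightarrow> complex) set \<Rightarrow> bool" where
  "bergman_onb \<Omega> B \<longleftrightarrow> B \<subseteq> bergman_space \<Omega> \<and>
     (\<forall>\<phi>\<in>B. \<forall>\<psi>\<in>B. bergman_inner \<Omega> \<phi> \<psi> = (if \<phi> = \<psi> then 1 else 0)) \<and>
     (\<forall>f\<in>bergman_space \<Omega>. \<forall>\<epsilon>>0. \<exists>g\<in>cspan B. bergman_norm \<Omega> (\<lambda>z. f z - g z) < \<epsilon>)"

text \<open>
  The kernel is a relation rather than a chosen function, so that existence of an orthonormal
  basis, convergence, and independence of the basis are all part of the assertion. The values of
  \<open>K\<close> are only constrained on \<open>\<Omega> \<times> \<Omega>\<close>.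
\<close>

definition is_bergman_kernel ::
  "(complex ^ 'n) set \<Rightarrow> (complex ^ 'n \<Rightarrow> complex ^ 'n \<Rightarrow> complex) \<Rightarrow> bool" where
  "is_bergman_kernel \<Omega> K \<longleftrightarrow> (\<exists>B. bergman_onb \<Omega> B) \<and>
     (\<forall>B. bergman_onb \<Omega> B \<longrightarrow>
        (\<forall>z\<in>\<Omega>. \<forall>w\<in>\<Omega>. ((\<lambda>\<phi>. \<phi> z * cnj (\<phi> w)) has_sum K z w) B))"

section \<open>Kaehler forms and metrics\<close>

text \<open>
  The Wirtinger operators: \<open>axis j 1\<close> and \<open>axis j \<i>\<close> are the directions of the real coordinates
  \<open>x\<^sub>j\<close> and \<open>y\<^sub>j\<close> with \<open>z\<^sub>j = x\<^sub>j + \<i> y\<^sub>j\<close>.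
\<close>

definition dz :: "'n \<Rightarrow> (complex ^ 'n \<Rightarrow> complex) \<Rightarrow> complex ^ 'n \<Rightarrow> complex" where
  "dz j f z = (frechet_derivative f (at z) (axis j 1)
               - \<i> * frechet_derivative f (at z) (axis j \<i>)) / 2"

definition dzbar :: "'n \<Rightarrow> (complex ^ 'n \<Rightarrow> complex) \<Rightarrow> complex ^ 'n \<Rightarrow> complex" where
  "dzbar j f z = (frechet_derivative f (at z) (axis j 1)
                  + \<i> * frechet_derivative f (at z) (axis j \<i>)) / 2"

text \<open>
  The 2-form \<open>i \<partial>\<partial>\<close>-bar \<open>u\<close> at \<open>z\<close>, evaluated on tangent vectors \<open>X\<close>, \<open>Y\<close>; the last factor is the
  value of \<open>dz\<^sub>j\<close> wedge \<open>dz\<^sub>k\<close>-bar on \<open>(X, Y)\<close>, where the wedge of two 1-forms is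
  \<open>a \<otimes> b - b \<otimes> a\<close>. For smooth real \<open>u\<close> its values are real.
\<close>

definition i_ddbar ::
  "(complex ^ 'n \<Rightarrow> real) \<Rightarrow> complex ^ 'n \<Rightarrow> complex ^ 'n \<Rightarrow> complex ^ 'n \<Rightarrow> complex" where
  "i_ddbar u z X Y = \<i> * (\<Sum>j\<in>UNIV. \<Sum>k\<in>UNIV.
     dz j (dzbar k (\<lambda>w. complex_of_real (u w))) z * (X $ j * cnj (Y $ k) - Y $ j * cnj (X $ k)))"

text \<open>The metric with Kaehler form \<open>\<omega>\<close> is \<open>g(X, Y) = \<omega>(X, J Y)\<close>, \<open>J\<close> being multiplication by \<open>\<i>\<close>.\<close>

definition kaehler_metric ::
  "(complex ^ 'n \<Rightarrow> complex ^ 'n \<Rightarrow> complex ^ 'n \<Rightarrow> complex) \<Rightarrow>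
   complex ^ 'n \<Rightarrow> complex ^ 'n \<Rightarrow> complex ^ 'n \<Rightarrow> real" where
  "kaehler_metric \<omega> z X Y = Re (\<omega> z X (\<i> *s Y))"

definition positive_definite_on ::
  "(complex ^ 'n) set \<Rightarrow> (complex ^ 'n \<Rightarrow> complex ^ 'n \<Rightarrow> complex ^ 'n \<Rightarrow> real) \<Rightarrow> bool" where
  "positive_definite_on \<Omega> g \<longleftrightarrow> (\<forall>z\<in>\<Omega>. \<forall>X. X \<noteq> 0 \<longrightarrow> g z X X > 0)"

text \<open>\<open>K\<close> is a Bergman kernel; its diagonal values are nonnegative reals.\<close>

definition bergman_form ::
  "(complex ^ 'n \<Rightarrow> complex ^ 'n \<Rightarrow> complex) \<Rightarrow>
   complex ^ 'n \<Rightarrow> complex ^ 'n \<Rightarrow> complex ^ 'n \<Rightarrow> complex" where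
  "bergman_form K = i_ddbar (\<lambda>z. ln (Re (K z z)))"

text \<open>On the standard affine chart of projective space.\<close>

definition fubini_study_form ::
  "complex ^ 'n \<Rightarrow> complex ^ 'n \<Rightarrow> complex ^ 'n \<Rightarrow> complex" where
  "fubini_study_form = i_ddbar (\<lambda>z. ln (1 + (norm z)\<^sup>2))"

end

theory Submission
  imports Defs "HOL-Computational_Algebra.Polynomial" "HOL-Complex_Analysis.Cauchy_Integral_Formula"
begin

text \<open>
  Write \<open>t\<^sub>j = \<bar>z\<^sub>j\<bar>\<^sup>2\<close>; then Lebesgue measure is \<open>\<pi>\<^sup>n dt\<close> on the orthant and a Reinhardt domain is
  described by a set of points \<open>t\<close>. Its monomials \<open>z\<^sup>\<alpha>\<close> are orthogonal, with squared norm the moment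
  \<open>\<pi>\<^sup>n \<integral> t\<^sup>\<alpha> dt\<close> over that set. The multinomial theorem expands \<open>C (1 + \<parallel>z\<parallel>\<^sup>2)\<^sup>m\<close> into
  \<open>C m! \<bar>z\<^sup>\<alpha>\<bar>\<^sup>2 / (\<alpha>! (m - \<bar>\<alpha>\<bar>)!)\<close>, summed over \<open>\<bar>\<alpha>\<bar> \<le> m\<close>. So the theorem asks for a Reinhardt domain whose
  moments are \<open>\<alpha>! (m - \<bar>\<alpha>\<bar>)! / (C m!)\<close> for \<open>\<bar>\<alpha>\<bar> \<le> m\<close> and infinite for \<open>\<bar>\<alpha>\<bar> > m\<close>, and whose Bergman
  space contains nothing but combinations of monomials (\<open>bergman_space_eq_span_monomials\<close>). The finite
  basis then gives the kernel (\<open>is_bergman_kernel_finite_basis\<close>), and the metric is a computation with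
  \<open>ln (1 + \<parallel>z\<parallel>\<^sup>2)\<close>.

  For independent exponential variables \<open>E\<^sub>0, \<dots>, E\<^sub>n\<close> the expectation of
  \<open>E\<^sub>0\<^sup>m (E/E\<^sub>0)\<^sup>\<alpha>\<close> is \<open>\<alpha>! (m - \<bar>\<alpha>\<bar>)!\<close>. Gauss-Laguerre quadrature replaces each variable by a finitely
  supported one with the same moments up to order \<open>m\<close>, so the required moments come from a positive
  combination of finitely many points, and after a correction of finitely many small boxes
  (\<open>box_densities\<close>). When \<open>C\<close> is large the resulting densities are below 1; this is where \<open>C\<^sub>m\<^sub>,\<^sub>n\<close>
  comes from. A density \<open>\<theta>\<close> on a box is realised by an honest open subset: halving an interval in
  the manner of Thue and Morse, so that both halves have the same moments up to order \<open>m\<close>, and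
  following the binary digits of \<open>\<theta>\<close>, produces an open subset of the interval whose moments up to
  order \<open>m\<close> are exactly \<open>\<theta>\<close> times those of the interval (\<open>exact_density_subset\<close>).

  The pieces so obtained are joined by thin shelves and a thin
  wall, and a tail of thin rods and slabs follows the diagonal to infinity. On the diagonal all
  monomials of the same degree have the same size, so one choice of the volume of the tail at distance
  \<open>r\<close> makes the moments of order \<open>> m\<close> infinite and keeps the others finite. Since
  \<open>n \<ge> 2\<close>, all of this skeleton has a thin direction; its finite moments tend to \<open>0\<close> with the
  thickness, and a small perturbation of the densities on the boxes compensates them exactly.

  Averaging over the rotations of one coordinate against a character maps
  square integrable holomorphic functions to such functions. Doing this in every coordinate isolates a
  function that transforms like \<open>z\<^sup>\<alpha>\<close>, \<open>\<alpha>\<close> an integer vector, hence is a multiple of \<open>z\<^sup>\<alpha>\<close> where no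
  coordinate vanishes, provided that this part of the domain is connected; regularity at the origin
  excludes negative exponents. A function is determined by these averages, and only finitely many of
  them can be nonzero because only finitely many monomials are square integrable.
\<close>

section \<open>Laguerre polynomials and quadrature for the exponential distribution\<close>

definition lagrange_basis :: "real set \<Rightarrow> real \<Rightarrow> real poly" where
  "lagrange_basis X x = (\<Prod>y\<in>X - {x}. smult (1 / (x - y)) [:-y, 1:])"

lemma poly_lagrange_basis:
  assumes "finite X" "x \<in> X" "y \<in> X"
  shows "poly (lagrange_basis X x) y = (if x = y then 1 else 0)"
proof (cases "x = y")
  case True
  then show ?thesis
    by (auto simp: lagrange_basis_def poly_prod intro!: prod.neutral simp: divide_simps)
next
  case False
  with assms show ?thesis
    by (auto simp: lagrange_basis_def poly_prod intro!: prod_zero)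
qed

lemma degree_lagrange_basis:
  assumes "finite X" "x \<in> X"
  shows "degree (lagrange_basis X x) < card X"
proof -
  have "degree (lagrange_basis X x) \<le> (\<Sum>y\<in>X - {x}. degree (smult (1 / (x - y)) [:-y, 1:]))"
    unfolding lagrange_basis_def by (rule degree_prod_sum_le[unfolded comp_def]) (use assms in auto)
  also have "\<dots> \<le> (\<Sum>y\<in>X - {x}. 1)"
    by (intro sum_mono) auto
  also have "\<dots> < card X"
    using card_Diff1_less[OF assms] by simp
  finally show ?thesis .
qed

lemma poly_eq_0_if_many_roots:
  fixes p :: "real poly"
  assumes "finite X" "degree p < card X" "\<And>x. x \<in> X \<Longrightarrow> poly p x = 0"
  shows "p = 0"
proof (rule ccontr)
  assume "p \<noteq> 0"
  then have "card X \<le> card {x. poly p x = 0}"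
    using assms by (intro card_mono poly_roots_finite) auto
  also have "\<dots> \<le> degree p" using \<open>p \<noteq> 0\<close> by (rule card_poly_roots_bound)
  finally show False using assms by simp
qed

lemma lagrange_interpolation:
  assumes "finite X" "degree p < card X"
  shows "p = (\<Sum>x\<in>X. smult (poly p x) (lagrange_basis X x))"
proof -
  have "degree (\<Sum>x\<in>X. smult (poly p x) (lagrange_basis X x)) < card X"
    using assms degree_lagrange_basis
    by (intro degree_sum_less) (auto intro: le_less_trans[OF degree_smult_le])
  then have "p - (\<Sum>x\<in>X. smult (poly p x) (lagrange_basis X x)) = 0"
    using assms
    by (intro poly_eq_0_if_many_roots[of X])
       (auto simp: degree_diff_less poly_sum poly_lagrange_basis if_distrib cong: if_cong)
  then show ?thesis by simp
qed

text \<open>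
  Interpolation of \<open>X^k\<close> at the points of \<open>X\<close> is exact, and comparing coefficients gives a system of
  weights dual to the powers. These weights correct moments without disturbing each other.
\<close>

lemma power_dual_weights:
  assumes "finite X" "i < card X" "k < card X"
  shows "(\<Sum>x\<in>X. coeff (lagrange_basis X x) i * x ^ k) = (if i = k then 1 else 0)"
proof -
  have "monom 1 k = (\<Sum>x\<in>X. smult (x ^ k) (lagrange_basis X x))"
    using lagrange_interpolation[of X "monom 1 k"] assms by (simp add: poly_monom degree_monom_eq)
  then have "coeff (monom 1 k) i = (\<Sum>x\<in>X. x ^ k * coeff (lagrange_basis X x) i)"
    by (simp add: coeff_sum)
  then show ?thesis by (simp add: mult.commute eq_commute)
qed

text \<open>
  This is \<open>\<integral> p(t) exp(-t) dt\<close> over the positive half-line (see \<open>has_integral_exp_moment\<close>). The algebraic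
  form makes linearity and integration by parts purely formal; the integral serves only for positivity.
\<close>

definition exp_moment :: "real poly \<Rightarrow> real" where
  "exp_moment p = (\<Sum>i\<le>degree p. coeff p i * fact i)"

lemma exp_moment_upto:
  assumes "degree p \<le> N"
  shows "exp_moment p = (\<Sum>i\<le>N. coeff p i * fact i)"
  unfolding exp_moment_def
  by (rule sum.mono_neutral_left) (use assms in \<open>auto simp: coeff_eq_0\<close>)

lemma exp_moment_add: "exp_moment (p + q) = exp_moment p + exp_moment q"
proof -
  define N where "N = max (degree p) (degree q)"
  have "degree (p + q) \<le> N" "degree p \<le> N" "degree q \<le> N"
    by (auto simp: N_def degree_add_le_max)
  then show ?thesis
    by (simp add: exp_moment_upto[of _ N] algebra_simps sum.distrib)
qed

lemma exp_moment_smult: "exp_moment (smult c p) = c * exp_moment p"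
  by (simp add: exp_moment_upto[of "smult c p" "degree p"] degree_smult_le exp_moment_def
      sum_distrib_left mult.assoc)

lemma exp_moment_diff: "exp_moment (p - q) = exp_moment p - exp_moment q"
  using exp_moment_add[of p "smult (-1) q"] by (simp only: exp_moment_smult) simp

lemma exp_moment_0 [simp]: "exp_moment 0 = 0"
  by (simp add: exp_moment_def)

lemma exp_moment_sum: "exp_moment (\<Sum>x\<in>A. f x) = (\<Sum>x\<in>A. exp_moment (f x))"
  by (induction A rule: infinite_finite_induct) (auto simp: exp_moment_add)

lemma exp_moment_monom: "exp_moment (monom 1 k) = fact k"
  by (simp add: exp_moment_upto[of _ k] degree_monom_eq if_distrib[of "\<lambda>c. c * _"] cong: if_cong)

text \<open>
  Integration by parts against \<open>exp(-t)\<close>.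
\<close>

lemma exp_moment_pderiv: "exp_moment (pderiv p) = exp_moment p - coeff p 0"
proof -
  have "exp_moment (pderiv p) = (\<Sum>i\<le>degree p. coeff p (Suc i) * fact (Suc i))"
    by (subst exp_moment_upto[of _ "degree p"])
       (auto simp: degree_pderiv coeff_pderiv algebra_simps)
  moreover have "exp_moment p = (\<Sum>i\<le>Suc (degree p). coeff p i * fact i)"
    by (rule exp_moment_upto) simp
  ultimately show ?thesis
    by (simp only: sum.atMost_Suc_shift) simp
qed

lemma has_integral_exp_moment:
  "((\<lambda>t. poly p t * exp (- t)) has_integral exp_moment p) {0..}"
proof -
  have mono: "((\<lambda>t::real. t ^ i * exp (- t)) has_integral fact i) {0..}" for i
  proof -
    have "Gamma (real i + 1) = fact i"
      using Gamma_fact[of i, where 'a = real] by (simp add: add.commute)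
    then have h: "((\<lambda>t. t powr real i / exp t) has_integral fact i) {0..}"
      using Gamma_integral_real[of "real i + 1"] by simp
    have eq: "t ^ i * exp (- t) = t powr real i / exp t" if "t \<in> {0..} - {0}" for t
      using that by (simp add: powr_realpow exp_minus field_simps)
    show ?thesis
      by (rule has_integral_spike[OF negligible_sing[of "0::real"] _ h]) (rule eq)
  qed
  have "((\<lambda>t. \<Sum>i\<le>degree p. coeff p i * (t ^ i * exp (- t))) has_integral exp_moment p) {0..}"
    unfolding exp_moment_def by (intro has_integral_sum has_integral_mult_right mono) auto
  then show ?thesis
    by (simp add: poly_altdef sum_distrib_right mult.assoc)
qed

lemma exp_moment_pos:
  assumes "p \<noteq> 0" "\<And>x. x > 0 \<Longrightarrow> poly p x \<ge> 0"
  shows "exp_moment p > 0"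
proof -
  let ?f = "\<lambda>t. poly p t * exp (- t)"
  have p0: "poly p x \<ge> 0" if "x \<ge> 0" for x
  proof (cases "x = 0")
    case True
    have "((\<lambda>x. poly p x) \<longlongrightarrow> poly p 0) (at_right 0)"
      by (intro tendsto_intros)
    moreover have "\<forall>\<^sub>F x in at_right 0. 0 \<le> poly p x"
      using assms(2) by (auto simp: eventually_at_right_field intro: exI[of _ 1])
    ultimately show ?thesis
      unfolding True by (rule tendsto_lowerbound) simp
  qed (use assms that in auto)
  have ge: "exp_moment p \<ge> 0"
    by (rule has_integral_nonneg[OF has_integral_exp_moment]) (auto simp: p0)
  have "exp_moment p \<noteq> 0"
  proof
    assume 0: "exp_moment p = 0"
    have cont: "continuous_on {0..1} ?f" by (intro continuous_intros)
    have "integral {0..1} ?f \<le> exp_moment p"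
      by (rule has_integral_subset_le[OF _ integrable_integral has_integral_exp_moment])
         (simp_all add: integrable_continuous_interval cont p0)
    moreover have "integral {0..1} ?f \<ge> 0"
      by (rule integral_nonneg) (auto intro!: integrable_continuous_interval cont mult_nonneg_nonneg p0)
    ultimately have "integral {0..1} ?f = 0" using 0 by linarith
    then have "(?f has_integral 0) {0..1}"
      using cont by (metis integrable_continuous_interval integrable_integral)
    then have hi: "(?f has_integral 0) (cbox 0 1)" by simp
    have "?f x = 0" if "x \<in> cbox 0 1" for x
      by (rule has_integral_0_cbox_imp_0[OF _ _ hi _ that]) (use cont p0 in \<open>auto simp: box_eq_empty\<close>)
    then have "{0..1} \<subseteq> {x. poly p x = 0}" by auto
    then show False
      using finite_subset[OF _ poly_roots_finite[OF assms(1)]] infinite_Icc[of 0 "1::real"] by auto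
  qed
  with ge show ?thesis by simp
qed

text \<open>
  The derivative of \<open>p(t) exp(-t)\<close> is \<open>laguerre_op p (t) exp(-t)\<close>, so the next definition is the Rodrigues
  formula for the Laguerre polynomials, up to a constant factor.
\<close>

definition laguerre_op :: "real poly \<Rightarrow> real poly" where
  "laguerre_op p = pderiv p - p"

definition laguerre_poly :: "nat \<Rightarrow> real poly" where
  "laguerre_poly N = (laguerre_op ^^ N) (monom 1 N)"

lemma degree_laguerre_op [simp]: "degree (laguerre_op p) = degree p"
proof (cases "degree p = 0")
  case True
  then obtain c where "p = [:c:]" by (metis degree_eq_zeroE)
  then show ?thesis by (simp add: laguerre_op_def pderiv_pCons)
next
  case False
  have "degree (- p + pderiv p) = degree (- p)"
    by (rule degree_add_eq_left) (use False in \<open>auto simp: degree_pderiv\<close>)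
  then show ?thesis by (simp add: laguerre_op_def)
qed

lemma degree_laguerre_poly: "degree (laguerre_poly N) = N"
proof -
  have "degree ((laguerre_op ^^ k) p) = degree p" for k p
    by (induction k) auto
  then show ?thesis by (simp add: laguerre_poly_def degree_monom_eq)
qed

lemma exp_moment_mult_laguerre_op:
  "exp_moment (q * laguerre_op p) = - coeff q 0 * coeff p 0 - exp_moment (pderiv q * p)"
proof -
  have "q * laguerre_op p = (pderiv (q * p) - q * p) - pderiv q * p"
    by (simp add: laguerre_op_def pderiv_mult algebra_simps)
  then show ?thesis
    by (simp only: exp_moment_diff exp_moment_pderiv) (simp add: coeff_mult_0)
qed

lemma power_dvd_laguerre_op:
  assumes "[:0, 1:] ^ Suc k dvd p"
  shows "[:0, 1:] ^ k dvd laguerre_op p"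
proof -
  obtain r where r: "p = [:0, 1:] ^ Suc k * r" using assms by (elim dvdE)
  have "pderiv p = [:0, 1:] ^ k * (smult (of_nat (Suc k)) r + [:0, 1:] * pderiv r)"
    unfolding r pderiv_mult pderiv_power_Suc by (simp add: pderiv_pCons algebra_simps smult_add_right one_pCons [symmetric] del: mult_pCons_left mult_pCons_right) 
  moreover have "[:0, 1:] ^ k dvd p" unfolding r power_Suc2 mult.assoc by (rule dvd_triv_left)
  ultimately show ?thesis by (auto simp: laguerre_op_def intro: dvd_diff)
qed

text \<open>
  Integrate by parts \<open>N\<close> times. The boundary terms vanish because the \<open>i\<close>-th iterate is still divisible by
  \<open>X^(N - i)\<close>, and the \<open>N\<close>-th derivative of \<open>q\<close> is zero.
\<close>

lemma laguerre_poly_orthogonal: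
  assumes "degree q < N"
  shows "exp_moment (laguerre_poly N * q) = 0"
proof -
  define p where "p i = (laguerre_op ^^ i) (monom 1 N)" for i
  have dvd: "[:0, 1:] ^ (N - i) dvd p i" if "i \<le> N" for i
    using that
  proof (induction i)
    case 0
    have "monom 1 N = [:0, 1 :: real:] ^ N"
      using monom_altdef[of "1 :: real" N] by simp
    then show ?case by (simp add: p_def)
  next
    case (Suc i)
    then show ?case
      using power_dvd_laguerre_op[of "N - Suc i" "p i"] by (simp add: p_def Suc_diff_Suc)
  qed
  have "exp_moment (q * p i) = (- 1) ^ i * exp_moment ((pderiv ^^ i) q * monom 1 N)" if "i \<le> N" for i
    using that
  proof (induction i arbitrary: q)
    case (Suc i)
    have "[:0, 1:] dvd p i"
      using dvd[of i] Suc.prems dvd_trans[of "[:0,1:]" "[:0,1:] ^ (N - i)"] by simp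
    then have "coeff (p i) 0 = 0"
      by (auto simp: coeff_mult_0)
    then have "exp_moment (q * p (Suc i)) = - exp_moment (pderiv q * p i)"
      by (simp add: p_def exp_moment_mult_laguerre_op)
    also have "\<dots> = (- 1) ^ Suc i * exp_moment ((pderiv ^^ Suc i) q * monom 1 N)"
      using Suc by (simp add: funpow_swap1)
    finally show ?case .
  qed (simp add: p_def)
  from this[of N] have "exp_moment (q * laguerre_poly N) =
      (- 1) ^ N * exp_moment ((pderiv ^^ N) q * monom 1 N)"
    by (simp add: p_def laguerre_poly_def)
  moreover have "(pderiv ^^ k) q = 0" if "degree q < k" for k and q :: "real poly"
    using that
  proof (induction k arbitrary: q)
    case (Suc k)
    show ?case
    proof (cases "degree q = 0")
      case True
      then have "pderiv q = 0" by (simp add: pderiv_eq_0_iff)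
      moreover have "(pderiv ^^ k) (0 :: real poly) = 0" by (induction k) auto
      ultimately show ?thesis by (simp add: funpow_swap1)
    qed (use Suc in \<open>auto simp: funpow_swap1 degree_pderiv\<close>)
  qed auto
  ultimately show ?thesis using assms by (simp add: mult.commute)
qed

text \<open>
  Dividing by the square of a linear factor changes neither the sign nor the parity of the orders; when
  no positive root is left the intermediate value theorem applies.
\<close>

lemma even_order_imp_sign_const:
  fixes p :: "real poly"
  assumes "p \<noteq> 0" "\<And>x. x > 0 \<Longrightarrow> even (order x p)"
  shows "(\<forall>x>0. poly p x \<ge> 0) \<or> (\<forall>x>0. poly p x \<le> 0)"
  using assms
proof (induction "degree p" arbitrary: p rule: less_induct)
  case less
  show ?case
  proof (cases "\<exists>a>0. poly p a = 0")
    case True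
    then obtain a where a: "a > 0" "poly p a = 0" by auto
    with less.prems have "order a p \<ge> 2"
      by (metis One_nat_def Suc_1 Suc_leI dvd_1_left even_Suc even_zero le_less less_one linorder_not_less order_root)
    then have "[:-a, 1:] ^ 2 dvd p"
      using less.prems(1) order_divides by blast
    then obtain q where q: "p = [:-a, 1:] ^ 2 * q" by (elim dvdE)
    have [simp]: "q \<noteq> 0" using less.prems q by auto
    have "degree q < degree p"
      by (simp add: q degree_mult_eq degree_power_eq)
    moreover have "even (order x q)" if "x > 0" for x
    proof -
      have "order x p = order x ([:-a, 1:] ^ 2) + order x q"
        unfolding q by (rule order_mult) simp
      moreover have "even (order x ([:-a, 1:] ^ 2))"
        unfolding power2_eq_square by (subst order_mult) (auto simp del: mult_pCons_left mult_pCons_right)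
      ultimately show ?thesis using less.prems(2)[OF that] by simp
    qed
    ultimately have "(\<forall>x>0. poly q x \<ge> 0) \<or> (\<forall>x>0. poly q x \<le> 0)"
      using less.hyps by simp
    then show ?thesis
      by (auto simp: q mult_nonneg_nonpos)
  next
    case False
    show ?thesis
    proof (rule ccontr)
      assume "\<not> ?thesis"
      then obtain x y where xy: "x > 0" "y > 0" "poly p x < 0" "poly p y > 0"
        by (auto simp: not_le)
      then have "x \<noteq> y" by auto
      then consider "x < y" | "y < x" by linarith
      then show False
      proof cases
        case 1
        from poly_IVT_pos[OF 1 xy(3,4)] False xy show False by force
      next
        case 2
        from poly_IVT_neg[OF 2 xy(4,3)] False xy show False by force
      qed
    qed
  qed
qed

text \<open>
  The classical argument for orthogonal polynomials: multiplying by the linear factors at the positive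
  roots of odd order gives a polynomial of constant sign, whose integral is not zero. By orthogonality
  there must be at least \<open>N\<close> such roots.
\<close>

lemma laguerre_poly_roots:
  obtains X where "finite X" "card X = N" "\<And>x. x \<in> X \<Longrightarrow> x > 0 \<and> poly (laguerre_poly N) x = 0"
proof -
  let ?Q = "laguerre_poly N"
  have Q0: "?Q \<noteq> 0" 
  proof (cases "N = 0")
    case True then show ?thesis by (simp add: laguerre_poly_def)
  next
    case False then show ?thesis using degree_laguerre_poly[of N] by auto
  qed
  define X where "X = {x. x > 0 \<and> odd (order x ?Q)}"
  have sub: "X \<subseteq> {x. poly ?Q x = 0}"
    by (auto simp: X_def order_root intro!: Nat.gr0I)
  then have fin: "finite X" using poly_roots_finite[OF Q0] finite_subset by blast
  have "card X \<le> N"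
    using card_mono[OF poly_roots_finite[OF Q0] sub] card_poly_roots_bound[OF Q0] degree_laguerre_poly[of N]
    by linarith
  moreover have "\<not> card X < N"
  proof
    assume less: "card X < N"
    define q where "q = (\<Prod>x\<in>X. [:-x, 1 :: real:])"
    have q0: "q \<noteq> 0" using fin by (auto simp: q_def)
    have "degree q = card X"
      unfolding q_def by (subst degree_prod_eq_sum_degree) auto
    then have orth: "exp_moment (?Q * q) = 0" using less by (intro laguerre_poly_orthogonal) simp
    have ordq: "order x q = (if x \<in> X then 1 else 0)" for x
    proof -
      have "order x q = (\<Sum>y\<in>X. order x [:-y, 1:])"
        unfolding q_def using fin
        by (induction X rule: finite_induct)
           (simp_all add: order_mult del: mult_pCons_left mult_pCons_right)
    also have "\<dots> = (\<Sum>y\<in>X. if x = y then 1 else 0)"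
        by (intro sum.cong) (use order_power_n_n[of _ 1] in \<open>auto intro!: order_0I\<close>)
      finally show ?thesis using fin by simp
    qed
    have "even (order x (?Q * q))" if "x > 0" for x
      using that Q0 q0 by (subst order_mult) (auto simp: ordq X_def)
    then have "(\<forall>x>0. poly (?Q * q) x \<ge> 0) \<or> (\<forall>x>0. poly (?Q * q) x \<le> 0)"
      using Q0 q0 by (intro even_order_imp_sign_const) auto
    then show False
    proof
      assume "\<forall>x>0. poly (?Q * q) x \<ge> 0"
      then have "exp_moment (?Q * q) > 0" using Q0 q0 by (intro exp_moment_pos) auto
      with orth show False by simp
    next
      assume "\<forall>x>0. poly (?Q * q) x \<le> 0"
      then have "exp_moment (smult (-1) (?Q * q)) > 0" using Q0 q0 by (intro exp_moment_pos) auto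
      with orth show False by (simp only: exp_moment_smult)
    qed
  qed
  ultimately show ?thesis using fin sub by (intro that[of X]) (auto simp: X_def)
qed

lemma linear_factors_dvd:
  fixes p :: "real poly"
  assumes "finite X" "\<And>x. x \<in> X \<Longrightarrow> poly p x = 0"
  shows "(\<Prod>x\<in>X. [:-x, 1:]) dvd p"
  using assms
proof (induction X arbitrary: p rule: finite_induct)
  case (insert a X)
  then obtain q where q: "p = [:-a, 1:] * q"
    by (metis dvdE insertI1 poly_eq_0_iff_dvd)
  have "poly q x = 0" if "x \<in> X" for x
    using insert.prems[of x] insert.hyps that by (auto simp: q)
  from insert.IH[OF this] show ?case
    using insert.hyps mult_dvd_mono[OF dvd_refl] by (simp add: q del: mult_pCons_left mult_pCons_right)
qed auto

text \<open>
  The weights are the integrals of the Lagrange basis polynomials. They are positive because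
  \<open>l\<close> and \<open>l\<^sup>2\<close> have the same integral for each basis polynomial \<open>l\<close>: the difference vanishes at all nodes,
  so it is the orthogonal polynomial times a polynomial of smaller degree.
\<close>

theorem gauss_laguerre_quadrature:
  obtains X w where "finite X" "card X = Suc m" "\<And>x. x \<in> X \<Longrightarrow> x > (0::real) \<and> w x > (0::real)"
    "\<And>k. k \<le> m \<Longrightarrow> (\<Sum>x\<in>X. w x * x ^ k) = fact k"
proof -
  let ?Q = "laguerre_poly (Suc m)"
  obtain X where X: "finite X" "card X = Suc m" "\<And>x. x \<in> X \<Longrightarrow> x > 0 \<and> poly ?Q x = 0"
    using laguerre_poly_roots[of "Suc m"] by blast
  let ?l = "lagrange_basis X"
  define w where "w x = exp_moment (?l x)" for x
  let ?M = "\<Prod>x\<in>X. [:-x, 1 :: real:]"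
  have degM: "degree ?M = Suc m"
    by (subst degree_prod_eq_sum_degree) (auto simp: X)
  have "?M dvd ?Q" using X by (intro linear_factors_dvd) auto
  then obtain c where c: "?Q = ?M * c" by (elim dvdE)
  have Q0: "?Q \<noteq> 0" using degree_laguerre_poly[of "Suc m"] by auto
  then have "degree c = 0"
    using degree_laguerre_poly[of "Suc m"] degM unfolding c by (subst (asm) degree_mult_eq) auto
  then obtain d where d: "c = [:d:]" by (metis degree_eq_zeroE)
  have d0: "d \<noteq> 0" using Q0 c d by auto
  have orth: "exp_moment (?M * s) = 0" if "degree s < Suc m" for s
  proof -
    have "exp_moment (?Q * s) = d * exp_moment (?M * s)"
      by (simp add: c d exp_moment_smult)
    then show ?thesis using laguerre_poly_orthogonal[OF that] d0 by simp
  qed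
  have pos: "w x > 0" if x: "x \<in> X" for x
  proof -
    have l0: "?l x \<noteq> 0" using poly_lagrange_basis[OF X(1) x x] by auto
    have "?M dvd (?l x * ?l x - ?l x)"
      using X x by (intro linear_factors_dvd) (auto simp: poly_lagrange_basis)
    then obtain s where s: "?l x * ?l x - ?l x = ?M * s" by (elim dvdE)
    have "exp_moment (?M * s) = 0"
    proof (cases "s = 0")
      case False
      have "degree (?l x) \<le> m" using degree_lagrange_basis[OF X(1) x] X by simp
      then have "degree (?l x * ?l x - ?l x) \<le> 2 * m"
        by (intro degree_diff_le) (auto simp: degree_mult_eq l0)
      then have "Suc m + degree s \<le> 2 * m"
        unfolding s using False X degM by (subst (asm) degree_mult_eq) auto
      then show ?thesis by (intro orth) simp
    qed simp
    then have "w x = exp_moment (?l x * ?l x)"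
      using exp_moment_diff[of "?l x * ?l x" "?l x"] by (simp add: s w_def)
    also have "\<dots> > 0" using l0 by (intro exp_moment_pos) auto
    finally show ?thesis .
  qed
  have "(\<Sum>x\<in>X. w x * x ^ k) = fact k" if "k \<le> m" for k
  proof -
    have "monom 1 k = (\<Sum>x\<in>X. smult (x ^ k) (?l x))"
      using lagrange_interpolation[of X "monom 1 k"] X that
      by (simp add: poly_monom degree_monom_eq)
    then have "exp_moment (monom 1 k) = (\<Sum>x\<in>X. x ^ k * w x)"
      by (simp add: exp_moment_sum exp_moment_smult w_def)
    then show ?thesis by (simp add: exp_moment_monom mult.commute)
  qed
  with X pos show ?thesis by (intro that[of X w]) auto
qed

section \<open>Open sets of prescribed density\<close>

definition power_integral :: "nat \<Rightarrow> real set \<Rightarrow> real" where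
  "power_integral k S = (LINT t:S|lborel. t ^ k)"

text \<open>
  The class of sets on which the halving below can be iterated: finite disjoint unions of open intervals.
\<close>

inductive interval_union :: "real set \<Rightarrow> bool" where
  empty: "interval_union {}"
| add: "a < b \<Longrightarrow> interval_union U \<Longrightarrow> {a<..<b} \<inter> U = {} \<Longrightarrow> interval_union ({a<..<b} \<union> U)"

lemma interval_union_open: "interval_union U \<Longrightarrow> open U"
  by (induction rule: interval_union.induct) auto

lemma interval_union_bounded: "interval_union U \<Longrightarrow> bounded U"
  by (induction rule: interval_union.induct) auto

lemma interval_union_interval: "a < b \<Longrightarrow> interval_union {a<..<b}"
  using interval_union.add[OF _ interval_union.empty] by simp

lemma interval_union_Un:
  "interval_union U \<Longrightarrow> interval_union V \<Longrightarrow> U \<inter> V = {} \<Longrightarrow> interval_union (U \<union> V)"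
proof (induction rule: interval_union.induct)
  case (add a b U)
  then have "interval_union ({a<..<b} \<union> (U \<union> V))"
    by (intro interval_union.add) auto
  then show ?case by (simp add: Un_assoc)
qed simp

lemma image_plus_greaterThanLessThan: "(+) d ` {a<..<b :: real} = {d + a<..<d + b}"
  by (auto simp: image_iff intro!: bexI[of _ "_ - d"])

lemma interval_union_shift: "interval_union U \<Longrightarrow> interval_union ((+) d ` U)"
proof (induction rule: interval_union.induct)
  case (add a b U)
  have im: "(+) d ` {a<..<b} = {d + a<..<d + b}"
    by (simp add: image_plus_greaterThanLessThan)
  then have "(+) d ` ({a<..<b} \<union> U) = {d + a<..<d + b} \<union> (+) d ` U"
    by (simp add: image_Un)
  moreover have "{d + a<..<d + b} \<inter> (+) d ` U = {}"
    using add.hyps(3) unfolding im[symmetric] by auto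
  ultimately show ?case
    using interval_union.add[of "d + a" "d + b" "(+) d ` U"] add by simp
qed (simp add: interval_union.empty)

lemma set_integrable_power:
  assumes "bounded S" "S \<in> sets borel"
  shows "set_integrable lborel S (\<lambda>t::real. t ^ k)"
proof -
  obtain a where a: "S \<subseteq> {-a..a}"
    using assms(1) by (auto simp: bounded_iff abs_le_iff) force
  have "set_integrable lborel {-a..a} (\<lambda>t::real. t ^ k)"
    by (intro borel_integrable_atLeastAtMost' continuous_intros)
  then show ?thesis
    by (rule set_integrable_subset) (use a assms in auto)
qed

lemma power_integral_Un:
  assumes "bounded S" "open S" "bounded T" "open T" "S \<inter> T = {}"
  shows "power_integral k (S \<union> T) = power_integral k S + power_integral k T"
  unfolding power_integral_def
  by (rule set_integral_Un) (use assms in \<open>auto intro!: set_integrable_power\<close>)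

text \<open>
  By the binomial theorem the top moment changes under translation only through lower moments. If two
  sets have equal lower moments, translating both keeps the difference of their top moments.
\<close>

lemma power_integral_shift:
  assumes "bounded S" "open S"
  shows "power_integral k ((+) d ` S) = (\<Sum>i\<le>k. of_nat (k choose i) * d ^ (k - i) * power_integral i S)"
proof -
  have "power_integral k ((+) d ` S) = (\<integral>t. indicator ((+) d ` S) (d + 1 * t) *\<^sub>R (d + 1 * t) ^ k \<partial>lborel)"
    unfolding power_integral_def set_lebesgue_integral_def
    by (subst lborel_integral_real_affine[of 1 _ d]) auto
  also have "\<dots> = (LINT t:S|lborel. (\<Sum>i\<le>k. of_nat (k choose i) * d ^ (k - i) * t ^ i))"
    unfolding set_lebesgue_integral_def
    by (intro Bochner_Integration.integral_cong refl)
       (auto simp: indicator_def add.commute[of d] binomial_ring mult_ac)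
  also have "\<dots> = (\<Sum>i\<le>k. LINT t:S|lborel. of_nat (k choose i) * d ^ (k - i) * t ^ i)"
    unfolding set_lebesgue_integral_def scaleR_sum_right
    by (intro Bochner_Integration.integral_sum)
       (unfold set_integrable_def [symmetric], use assms in
         \<open>auto intro!: set_integrable_mult_right set_integrable_power\<close>)
  finally show ?thesis
    by (simp add: power_integral_def)
qed

text \<open>
  In the construction \<open>V \<union> W\<close> misses finitely many points of \<open>U\<close>. That nothing more is lost is recorded by
  the additivity for all \<open>k\<close>, also beyond the order \<open>m\<close>, which the step from \<open>m\<close> to \<open>m + 1\<close> requires.
\<close>

definition halvable :: "nat \<Rightarrow> real set \<Rightarrow> bool" where
  "halvable m U \<longleftrightarrow> (\<exists>V W. interval_union V \<and> interval_union W \<and> V \<union> W \<subseteq> U \<and> V \<inter> W = {} \<and>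
     (\<forall>k. power_integral k V + power_integral k W = power_integral k U) \<and>
     (\<forall>k\<le>m. power_integral k V = power_integral k W))"

lemma power_integral_split:
  assumes "a < c" "c < b"
  shows "power_integral k {a<..<b} = power_integral k {a<..<c} + power_integral k {c<..<b}"
proof -
  have "power_integral k {a<..<b} = power_integral k ({a<..<c} \<union> {c<..<b})"
    unfolding power_integral_def
  proof (rule set_integral_cong_set)
    have "AE x in lborel. x \<noteq> c" by (rule AE_lborel_singleton)
    then show "AE x in lborel. (x \<in> {a<..<c} \<union> {c<..<b}) = (x \<in> {a<..<b})"
      by eventually_elim (use assms in auto)
  qed (auto simp: set_borel_measurable_def)
  also have "\<dots> = power_integral k {a<..<c} + power_integral k {c<..<b}"
    by (rule power_integral_Un) auto
  finally show ?thesis .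
qed

text \<open>
  The Thue-Morse construction. Halve the left half of the interval into \<open>V\<close> and \<open>W\<close> up to order \<open>m\<close>, and
  repeat the picture with exchanged roles in the right half. The moments of order \<open>m + 1\<close> of \<open>V\<close> and \<open>W\<close> may
  differ, but by \<open>power_integral_shift\<close> the same difference occurs with opposite sign on the right.
\<close>

lemma halvable_interval: "a < b \<Longrightarrow> halvable m {a<..<b}"
proof (induction m arbitrary: a b)
  case 0
  define c where "c = (a + b) / 2"
  have c: "a < c" "c < b" using 0 by (auto simp: c_def)
  have len: "power_integral 0 {x<..<y} = y - x" if "x < y" for x y
    using that by (simp add: power_integral_def set_lebesgue_integral_def)
  show ?case
    unfolding halvable_def
    by (rule exI[of _ "{a<..<c}"], rule exI[of _ "{c<..<b}"])
       (use c in \<open>auto simp: interval_union_interval power_integral_split[OF c] len c_def field_simps\<close>)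
next
  case (Suc m)
  define c where "c = (a + b) / 2"
  define d where "d = c - a"
  have c: "a < c" "c < b" using Suc.prems by (auto simp: c_def)
  have im: "(+) d ` {a<..<c} = {c<..<b}"
    unfolding image_plus_greaterThanLessThan by (simp add: d_def c_def field_simps)
  obtain V W where VW: "interval_union V" "interval_union W" "V \<union> W \<subseteq> {a<..<c}" "V \<inter> W = {}"
     "\<And>k. power_integral k V + power_integral k W = power_integral k {a<..<c}"
     "\<And>k. k \<le> m \<Longrightarrow> power_integral k V = power_integral k W"
    using Suc.IH[OF c(1)] unfolding halvable_def by blast
  note bo = interval_union_open interval_union_bounded
  have sub: "(+) d ` V \<subseteq> {c<..<b}" "(+) d ` W \<subseteq> {c<..<b}"
    using VW(3) by (auto simp flip: im)
  have less: "x < c" if "x \<in> V \<union> W" for x using that VW(3) by auto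
  have dis: "S \<inter> (+) d ` T = {}" if "S \<subseteq> V \<union> W" "T \<subseteq> V \<union> W" for S T
  proof -
    have "(+) d ` T \<subseteq> {c<..<b}" using sub that(2) by blast
    then show ?thesis using less that(1) by fastforce
  qed
  have dis': "(V \<union> (+) d ` W) \<inter> (W \<union> (+) d ` V) = {}"
    using VW(4) dis[of V V] dis[of W W] by auto
  have sh: "power_integral k ((+) d ` S) =
      (\<Sum>i<k. of_nat (k choose i) * d ^ (k - i) * power_integral i S) + power_integral k S"
    if "interval_union S" for k S
    using that bo by (subst power_integral_shift) (auto simp: lessThan_Suc_atMost[symmetric])
  have eq: "power_integral k (V \<union> (+) d ` W) = power_integral k V + power_integral k ((+) d ` W)"
           "power_integral k (W \<union> (+) d ` V) = power_integral k W + power_integral k ((+) d ` V)" for k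
    using VW(1,2) dis[of V W] dis[of W V] by (auto intro!: power_integral_Un bo interval_union_shift)
  have tot: "power_integral k (V \<union> (+) d ` W) + power_integral k (W \<union> (+) d ` V)
        = power_integral k {a<..<b}" for k
  proof -
    have "power_integral k ((+) d ` V) + power_integral k ((+) d ` W) =
        power_integral k ((+) d ` {a<..<c})"
      by (simp add: sh VW interval_union_interval c(1) sum.distrib distrib_left
          flip: VW(5))
    then show ?thesis
      using VW(5)[of k] unfolding eq power_integral_split[OF c] im by linarith
  qed
  have half: "power_integral k (V \<union> (+) d ` W) = power_integral k (W \<union> (+) d ` V)"
    if "k \<le> Suc m" for k
  proof -
    have "(\<Sum>i<k. of_nat (k choose i) * d ^ (k - i) * power_integral i V) =
          (\<Sum>i<k. of_nat (k choose i) * d ^ (k - i) * power_integral i W)"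
      using that VW(6) by (intro sum.cong) auto
    then show ?thesis
      unfolding eq by (simp add: sh VW)
  qed
  show ?case
    unfolding halvable_def
  proof (rule exI[of _ "V \<union> (+) d ` W"], rule exI[of _ "W \<union> (+) d ` V"], intro conjI allI impI)
    show "interval_union (V \<union> (+) d ` W)" "interval_union (W \<union> (+) d ` V)"
      using VW(1,2) dis[of V W] dis[of W V] by (auto intro!: interval_union_Un interval_union_shift)
    have "V \<union> W \<subseteq> {a<..<b}" using VW(3) c by fastforce
    moreover have "{c<..<b} \<subseteq> {a<..<b}" using c by fastforce
    ultimately show "V \<union> (+) d ` W \<union> (W \<union> (+) d ` V) \<subseteq> {a<..<b}"
      using sub by blast
  qed (use dis' tot half in auto)
qed

lemma halvable_interval_union: "interval_union U \<Longrightarrow> halvable m U"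
proof (induction rule: interval_union.induct)
  case empty
  then show ?case
    unfolding halvable_def by (intro exI[of _ "{}"]) (auto simp: interval_union.empty power_integral_def set_lebesgue_integral_def)
next
  case (add a b U)
  obtain V W where VW: "interval_union V" "interval_union W" "V \<union> W \<subseteq> U" "V \<inter> W = {}"
     "\<And>k. power_integral k V + power_integral k W = power_integral k U"
     "\<And>k. k \<le> m \<Longrightarrow> power_integral k V = power_integral k W"
    using add.IH unfolding halvable_def by blast
  obtain V' W' where VW': "interval_union V'" "interval_union W'" "V' \<union> W' \<subseteq> {a<..<b}" "V' \<inter> W' = {}"
     "\<And>k. power_integral k V' + power_integral k W' = power_integral k {a<..<b}"
     "\<And>k. k \<le> m \<Longrightarrow> power_integral k V' = power_integral k W'"
    using halvable_interval[OF add.hyps(1), of m] unfolding halvable_def by blast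
  note bo = interval_union_open interval_union_bounded
  have dis: "V' \<inter> V = {}" "W' \<inter> W = {}" "V' \<inter> W = {}" "W' \<inter> V = {}"
    using VW(3) VW'(3) add.hyps(3) by auto
  have eq: "power_integral k (V' \<union> V) = power_integral k V' + power_integral k V"
           "power_integral k (W' \<union> W) = power_integral k W' + power_integral k W"
           "power_integral k ({a<..<b} \<union> U) = power_integral k {a<..<b} + power_integral k U" for k
    using VW VW' dis add.hyps by (auto intro!: power_integral_Un bo interval_union_interval)
  show ?case
    unfolding halvable_def
  proof (rule exI[of _ "V' \<union> V"], rule exI[of _ "W' \<union> W"], intro conjI allI impI)
    show "interval_union (V' \<union> V)" "interval_union (W' \<union> W)"
      using VW VW' dis by (auto intro!: interval_union_Un)
    show "V' \<union> V \<union> (W' \<union> W) \<subseteq> {a<..<b} \<union> U" using VW VW' by auto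
    show "(V' \<union> V) \<inter> (W' \<union> W) = {}" using VW VW' dis by auto
  next
    fix k
    show "power_integral k (V' \<union> V) + power_integral k (W' \<union> W) = power_integral k ({a<..<b} \<union> U)"
      using VW(5)[of k] VW'(5)[of k] unfolding eq by linarith
  next
    fix k assume "k \<le> m"
    then show "power_integral k (V' \<union> V) = power_integral k (W' \<union> W)"
      using VW(6)[of k] VW'(6)[of k] unfolding eq by linarith
  qed
qed

lemma binary_expansion:
  fixes \<theta> :: real
  assumes "0 \<le> \<theta>" "\<theta> < 1"
  shows "(\<lambda>n. of_bool (odd \<lfloor>2 ^ Suc n * \<theta>\<rfloor>) / 2 ^ Suc n) sums \<theta>"
proof -
  define s where "s n = real_of_int \<lfloor>2 ^ n * \<theta>\<rfloor> / 2 ^ n" for n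
  have dig: "of_bool (odd \<lfloor>2 * x\<rfloor>) = real_of_int \<lfloor>2 * x\<rfloor> - 2 * real_of_int \<lfloor>x\<rfloor>" for x :: real
  proof -
    have "\<lfloor>2 * x\<rfloor> = 2 * \<lfloor>x\<rfloor> \<or> \<lfloor>2 * x\<rfloor> = 2 * \<lfloor>x\<rfloor> + 1" by linarith
    then show ?thesis by auto
  qed
  have "(\<lambda>n. s (Suc n) - s n) sums (\<theta> - s 0)"
  proof (rule telescope_sums)
    show "s \<longlonglongrightarrow> \<theta>"
    proof (rule real_tendsto_sandwich[where f = "\<lambda>n. \<theta> - (1/2) ^ n" and h = "\<lambda>n. \<theta>"])
      show "\<forall>\<^sub>F n in sequentially. \<theta> - (1 / 2) ^ n \<le> s n"
      proof (intro always_eventually allI)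
        fix n
        have "2 ^ n * \<theta> - 1 \<le> real_of_int \<lfloor>2 ^ n * \<theta>\<rfloor>" by linarith
        then have "(2 ^ n * \<theta> - 1) / 2 ^ n \<le> s n"
          unfolding s_def by (intro divide_right_mono) auto
        then show "\<theta> - (1 / 2) ^ n \<le> s n" by (simp add: field_simps power_divide)
      qed
      show "\<forall>\<^sub>F n in sequentially. s n \<le> \<theta>"
      proof (intro always_eventually allI)
        fix n
        have "real_of_int \<lfloor>2 ^ n * \<theta>\<rfloor> \<le> 2 ^ n * \<theta>" by linarith
        then show "s n \<le> \<theta>" by (simp add: s_def field_simps)
      qed
      have "(\<lambda>n. \<theta> - (1 / 2) ^ n) \<longlonglongrightarrow> \<theta> - 0"
        by (intro tendsto_intros LIMSEQ_power_zero) auto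
      then show "(\<lambda>n. \<theta> - (1 / 2) ^ n) \<longlonglongrightarrow> \<theta>" by simp
    qed auto
  qed
  moreover have "s 0 = 0" using assms by (simp add: s_def floor_eq_iff)
  moreover have "s (Suc n) - s n = of_bool (odd \<lfloor>2 ^ Suc n * \<theta>\<rfloor>) / 2 ^ Suc n" for n
    using dig[of "2 ^ n * \<theta>"] by (simp add: s_def field_simps)
  ultimately show ?thesis by simp
qed

text \<open>
  Iterated halving gives disjoint sets of densities \<open>1/2, 1/4, \<dots>\<close>, each exact up to order \<open>m\<close>. The union
  of those selected by the binary digits of \<open>\<theta>\<close> has density \<open>\<theta>\<close>. Exactness for real \<open>\<theta>\<close> turns the moment
  problem for sets into a linear problem for densities.
\<close>

theorem exact_density_subset:
  fixes a b \<theta> :: real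
  assumes "a < b" "0 \<le> \<theta>" "\<theta> \<le> 1"
  obtains A where "open A" "A \<subseteq> {a<..<b}"
    "\<And>k. k \<le> m \<Longrightarrow> power_integral k A = \<theta> * power_integral k {a<..<b}"
proof (cases "\<theta> = 1")
  case True
  then show ?thesis by (intro that[of "{a<..<b}"]) auto
next
  case False
  with assms have \<theta>: "\<theta> < 1" by simp
  have "\<forall>U. \<exists>V W. interval_union U \<longrightarrow> interval_union V \<and> interval_union W \<and> V \<union> W \<subseteq> U \<and> V \<inter> W = {} \<and>
     (\<forall>k\<le>m. power_integral k V = power_integral k U / 2 \<and> power_integral k W = power_integral k U / 2)"
  proof
    fix U
    have "power_integral k V = power_integral k U / 2 \<and> power_integral k W = power_integral k U / 2"
      if "power_integral k V + power_integral k W = power_integral k U"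
         "power_integral k V = power_integral k W" for k V W
      using that by linarith
    then show "\<exists>V W. interval_union U \<longrightarrow> interval_union V \<and> interval_union W \<and> V \<union> W \<subseteq> U \<and> V \<inter> W = {} \<and>
     (\<forall>k\<le>m. power_integral k V = power_integral k U / 2 \<and> power_integral k W = power_integral k U / 2)"
      using halvable_interval_union[of U m] unfolding halvable_def by metis
  qed
  then obtain V W where VW: "\<And>U. interval_union U \<Longrightarrow> interval_union (V U) \<and> interval_union (W U) \<and>
     V U \<union> W U \<subseteq> U \<and> V U \<inter> W U = {} \<and>
     (\<forall>k\<le>m. power_integral k (V U) = power_integral k U / 2 \<and> power_integral k (W U) = power_integral k U / 2)"
    by metis
  define U where "U n = (V ^^ n) {a<..<b}" for n
  define H where "H n = W (U n)" for n
  have U: "interval_union (U n)" for n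
    by (induction n) (use VW assms in \<open>auto simp: U_def interval_union_interval\<close>)
  have U_Suc: "U (Suc n) = V (U n)" for n by (simp add: U_def)
  have pU: "power_integral k (U n) = power_integral k {a<..<b} / 2 ^ n" if "k \<le> m" for k n
  proof (induction n)
    case (Suc n)
    have "power_integral k (U (Suc n)) = power_integral k (U n) / 2"
      using VW[OF U[of n]] that by (simp add: U_Suc)
    with Suc show ?case by simp
  qed (simp add: U_def)
  have pH: "power_integral k (H n) = power_integral k {a<..<b} / 2 ^ Suc n" if "k \<le> m" for k n
    using VW[OF U[of n]] that pU[OF that, of n] by (auto simp: H_def)
  have U_mono: "U n \<subseteq> U k" if "k \<le> n" for k n
    using that by (rule lift_Suc_antimono_le[rotated]) (use VW[OF U] in \<open>auto simp: U_Suc\<close>)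
  have H_sub: "H n \<subseteq> U n" for n using VW[OF U] by (auto simp: H_def)
  have H_dis: "H i \<inter> H j = {}" if "i < j" for i j
    using H_sub[of j] U_mono[of "Suc i" j] VW[OF U[of i]] that by (auto simp: H_def U_Suc)
  define d where "d n = odd \<lfloor>2 ^ Suc n * \<theta>\<rfloor>" for n
  define D where "D n = (if d n then H n else {})" for n
  have D: "interval_union (D n)" for n
    using VW[OF U] by (auto simp: D_def H_def interval_union.empty)
  have sub: "(\<Union>n. D n) \<subseteq> {a<..<b}"
    using H_sub U_mono[of 0] by (auto simp: D_def U_def split: if_splits)
  have op: "open (\<Union>n. D n)" using D interval_union_open by blast
  have "power_integral k (\<Union>n. D n) = \<theta> * power_integral k {a<..<b}" if "k \<le> m" for k
  proof -
    have "power_integral k (\<Union>n. D n) = (\<Sum>n. power_integral k (D n))"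
      unfolding power_integral_def
    proof (rule lebesgue_integral_countable_add)
      show "D n \<in> sets lborel" for n using interval_union_open[OF D] by simp
      show "D i \<inter> D j = {}" if "i \<noteq> j" for i j
        using that H_dis[of i j] H_dis[of j i] by (cases "i < j") (auto simp: D_def)
      show "set_integrable lborel (\<Union>n. D n) (\<lambda>t. t ^ k)"
        by (rule set_integrable_power) (use op sub bounded_subset[of "{a<..<b}"] in auto)
    qed
    also have "(\<lambda>n. power_integral k (D n)) = (\<lambda>n. of_bool (d n) / 2 ^ Suc n * power_integral k {a<..<b})"
      by (auto simp: D_def pH[OF that] fun_eq_iff power_integral_def[of _ "{}"] set_lebesgue_integral_def)
    also have "(\<Sum>n. \<dots> n) = \<theta> * power_integral k {a<..<b}"
      using binary_expansion[OF assms(2) \<theta>] unfolding d_def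
      by (intro sums_unique[symmetric] sums_mult2)
    finally show ?thesis .
  qed
  with op sub show ?thesis by (intro that[of "\<Union>n. D n"]) auto
qed

section \<open>Densities on boxes with prescribed moments\<close>

lemma power_integral_interval:
  assumes "a \<le> b"
  shows "power_integral k {a<..<b} = (b ^ Suc k - a ^ Suc k) / real (Suc k)"
proof -
  have "power_integral k {a<..<b} = (LINT t:{a..b}|lborel. t ^ k)"
    unfolding power_integral_def
  proof (rule set_integral_cong_set)
    have "AE x in lborel. x \<noteq> a \<and> x \<noteq> b"
      using AE_lborel_singleton[of a] AE_lborel_singleton[of b] by eventually_elim auto
    then show "AE x in lborel. (x \<in> {a..b}) = (x \<in> {a<..<b})"
      by eventually_elim auto
  qed (auto simp: set_borel_measurable_def)
  also have "\<dots> = (b ^ Suc k - a ^ Suc k) / real (Suc k)"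
    unfolding set_lebesgue_integral_def using integral_power[OF assms, of k] by (simp add: mult.commute)
  finally show ?thesis .
qed

lemma power_integral_half_open:
  "power_integral k {a..<b} = power_integral k {a<..<b}"
  unfolding power_integral_def
proof (rule set_integral_cong_set)
  have "AE x in lborel. x \<noteq> a" by (rule AE_lborel_singleton)
  then show "AE x in lborel. (x \<in> {a<..<b}) = (x \<in> {a..<b})"
    by eventually_elim auto
qed (auto simp: set_borel_measurable_def)

lemma prod_sum_univ:
  fixes F :: "'n::finite \<Rightarrow> real \<Rightarrow> real"
  assumes "finite R"
  shows "(\<Sum>r\<in>{r. \<forall>j. r j \<in> R}. \<Prod>j\<in>UNIV. F j (r j)) = (\<Prod>j\<in>UNIV. \<Sum>x\<in>R. F j x)"
proof -
  have "{r. \<forall>j. r j \<in> R} = (\<Pi>\<^sub>E j\<in>(UNIV :: 'n set). R)" by (auto simp: PiE_def)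
  then show ?thesis using assms by (simp add: prod_sum_PiE)
qed

text \<open>
  The factor by which the average of \<open>t^k\<close> over the interval from \<open>r\<close> to \<open>r (1 + \<rho>)\<close> differs from \<open>r^k\<close>. It
  does not depend on \<open>r\<close>, and it is close to 1 for small \<open>\<rho>\<close>.
\<close>

lemma power_quotient_tendsto:
  "((\<lambda>\<rho>::real. ((1 + \<rho>) ^ Suc k - 1) / (real (Suc k) * \<rho>)) \<longlongrightarrow> 1) (at_right 0)"
proof -
  have "((\<lambda>\<rho>::real. (1 + \<rho>) ^ Suc k) has_field_derivative real (Suc k)) (at 0)"
    by (rule derivative_eq_intros refl | simp)+
  then have "((\<lambda>\<rho>::real. ((1 + \<rho>) ^ Suc k - 1) / \<rho>) \<longlongrightarrow> real (Suc k)) (at 0)"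
    by (simp add: has_field_derivative_iff)
  then have "((\<lambda>\<rho>::real. ((1 + \<rho>) ^ Suc k - 1) / \<rho> / real (Suc k)) \<longlongrightarrow> real (Suc k) / real (Suc k)) (at_right 0)"
    by (intro tendsto_divide tendsto_const) (auto simp: filterlim_at_split)
  then show ?thesis by (simp add: mult.commute)
qed

text \<open>
  The length is proportional to \<open>r\<close>, so the average of \<open>t^k\<close> over the interval is \<open>r^k\<close> times a factor
  that is the same for all nodes \<open>r\<close>.
\<close>

definition mult_interval :: "real \<Rightarrow> real \<Rightarrow> real set" where
  "mult_interval \<rho> r = {r<..<r * (1 + \<rho>)}"

lemma finite_multi_degree_le: "finite {\<alpha> :: 'n::finite \<Rightarrow> nat. multi_degree \<alpha> \<le> m}"
proof (rule finite_subset)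
  show "{\<alpha> :: 'n \<Rightarrow> nat. multi_degree \<alpha> \<le> m} \<subseteq> (\<Pi>\<^sub>E j\<in>UNIV. {..m})"
  proof
    fix \<alpha> :: "'n \<Rightarrow> nat" assume "\<alpha> \<in> {\<alpha>. multi_degree \<alpha> \<le> m}"
    moreover have "\<alpha> j \<le> multi_degree \<alpha>" for j
      unfolding multi_degree_def by (rule member_le_sum) auto
    ultimately show "\<alpha> \<in> (\<Pi>\<^sub>E j\<in>UNIV. {..m})" by (auto simp: PiE_def intro: order_trans)
  qed
qed (simp add: finite_PiE)

text \<open>
  For quadrature nodes \<open>X\<close> with weights \<open>w\<close>, the discrete form of the quotient of exponential variables
  puts the weight \<open>w\<^sub>b b\<^sup>m \<Prod>\<^sub>j w(a\<^sub>j)\<close> on the point \<open>(a\<^sub>j / b)\<^sub>j\<close>, which lies in the grid over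
  \<open>R = X / X\<close>. To pass from points to boxes, the weights of the numerators are replaced by positive
  weights \<open>z\<close> with moments \<open>k! / c\<^sub>k\<close>, where \<open>c\<^sub>k\<close> is the factor from \<open>power_quotient_tendsto\<close>; for small \<open>\<rho>\<close>
  these are small perturbations of \<open>w\<close> by the dual weights.
  
  The small error \<open>\<sigma>\<close> will be the vector of moments of the skeleton. It is absorbed by the
  tensor products \<open>\<phi>\<close> of the dual weights, which live on the subgrid \<open>X / b0\<close>, where the density \<open>g\<close> is
  strictly positive.
\<close>

theorem box_densities:
  fixes m :: nat
  obtains R \<rho> C0 where "finite R" "R \<noteq> {}" "\<And>r. r \<in> R \<Longrightarrow> r > 0" "\<rho> > 0"
    "\<And>r r'. r \<in> R \<Longrightarrow> r' \<in> R \<Longrightarrow> r < r' \<Longrightarrow> r * (1 + \<rho>) < r'" "C0 \<ge> 0"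
    "\<And>C. C > C0 \<Longrightarrow> \<exists>\<eta>>0. \<forall>\<sigma> :: ('n::finite \<Rightarrow> nat) \<Rightarrow> real. (\<forall>\<alpha>. multi_degree \<alpha> \<le> m \<longrightarrow> \<bar>\<sigma> \<alpha>\<bar> \<le> \<eta>) \<longrightarrow>
       (\<exists>\<theta>. (\<forall>r. 0 \<le> \<theta> r \<and> \<theta> r \<le> 1) \<and> (\<forall>\<alpha>. multi_degree \<alpha> \<le> m \<longrightarrow>
         (\<Sum>r\<in>{r. \<forall>j. r j \<in> R}. \<theta> r * (\<Prod>j\<in>UNIV. pi * power_integral (\<alpha> j) (mult_interval \<rho> (r j)))) =
         fact (m - multi_degree \<alpha>) * (\<Prod>j\<in>UNIV. fact (\<alpha> j)) / (C * fact m) - \<sigma> \<alpha>))"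
proof -
  obtain X w where X: "finite X" "card X = Suc m" and Xpos: "\<And>x. x \<in> X \<Longrightarrow> x > (0::real) \<and> w x > (0::real)"
    and quad: "\<And>k. k \<le> m \<Longrightarrow> (\<Sum>x\<in>X. w x * x ^ k) = fact k"
    using gauss_laguerre_quadrature[of m] by metis
  define \<psi> where "\<psi> i x = coeff (lagrange_basis X x) i" for i x
  have \<psi>: "(\<Sum>x\<in>X. \<psi> i x * x ^ k) = (if i = k then 1 else 0)" if "i \<le> m" "k \<le> m" for i k
    unfolding \<psi>_def using power_dual_weights[OF X(1)] X(2) that by simp
  define c where "c \<rho> k = ((1 + \<rho>) ^ Suc k - 1) / (real (Suc k) * \<rho>)" for \<rho> :: real and k
  have c_lim: "((\<lambda>\<rho>. c \<rho> k) \<longlongrightarrow> 1) (at_right 0)" for k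
    unfolding c_def by (rule power_quotient_tendsto)
  define z where "z \<rho> x = w x + (\<Sum>k\<le>m. (fact k / c \<rho> k - fact k) * \<psi> k x)" for \<rho> x
  define R where "R = (\<lambda>(a, b). a / b) ` (X \<times> X)"
  have finR: "finite R" using X by (simp add: R_def)
  have Rpos: "r > 0" if "r \<in> R" for r using that Xpos by (auto simp: R_def)
  obtain b0 where b0: "b0 \<in> X" using X(2) by fastforce
  have Rne: "R \<noteq> {}" using b0 by (auto simp: R_def)
  have "\<forall>\<^sub>F \<rho> in at_right 0. \<forall>x\<in>X. z \<rho> x > 0"
  proof (rule eventually_ball_finite[OF X(1)], rule ballI)
    fix x assume x: "x \<in> X"
    have "((\<lambda>\<rho>. z \<rho> x) \<longlongrightarrow> w x + (\<Sum>k\<le>m. (fact k / 1 - fact k) * \<psi> k x)) (at_right 0)"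
      unfolding z_def by (intro tendsto_intros c_lim) auto
    then have "((\<lambda>\<rho>. z \<rho> x) \<longlongrightarrow> w x) (at_right 0)" by simp
    then show "\<forall>\<^sub>F \<rho> in at_right 0. z \<rho> x > 0"
      using Xpos[OF x] by (intro order_tendstoD(1)) auto
  qed
  moreover have "\<forall>\<^sub>F \<rho> in at_right (0::real). \<forall>r\<in>R. \<forall>r'\<in>R. r < r' \<longrightarrow> r * (1 + \<rho>) < r'"
  proof (intro eventually_ball_finite finR ballI)
    fix r r' assume "r \<in> R" "r' \<in> R"
    have "((\<lambda>\<rho>. r * (1 + \<rho>)) \<longlongrightarrow> r * (1 + 0)) (at_right 0)" by (intro tendsto_intros)
    then show "\<forall>\<^sub>F \<rho> in at_right 0. r < r' \<longrightarrow> r * (1 + \<rho>) < r'"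
      by (cases "r < r'") (auto dest: order_tendstoD(2)[of _ _ _ r'])
  qed
  moreover have "\<forall>\<^sub>F \<rho> in at_right (0::real). \<rho> > 0" by (simp add: eventually_at_right_less)
  ultimately have "\<forall>\<^sub>F \<rho> in at_right 0. (\<forall>x\<in>X. z \<rho> x > 0) \<and>
      (\<forall>r\<in>R. \<forall>r'\<in>R. r < r' \<longrightarrow> r * (1 + \<rho>) < r') \<and> \<rho> > 0"
    by eventually_elim auto
  then obtain \<rho> where zpos: "\<And>x. x \<in> X \<Longrightarrow> z \<rho> x > 0"
    and gap: "\<And>r r'. r \<in> R \<Longrightarrow> r' \<in> R \<Longrightarrow> r < r' \<Longrightarrow> r * (1 + \<rho>) < r'" and \<rho>: "\<rho> > 0"
    using eventually_happens'[OF trivial_limit_at_right_real] by blast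
  have c0: "c \<rho> k > 0" for k
  proof -
    have "(1 + \<rho>) ^ Suc k > 1" using \<rho> by (intro one_less_power) auto
    then show ?thesis using \<rho> by (simp add: c_def)
  qed
  define J where "J k r = pi * power_integral k (mult_interval \<rho> r)" for k r
  have J: "J k r = pi * \<rho> * c \<rho> k * r ^ Suc k" if "r > 0" for k r
  proof -
    have "r \<le> r * (1 + \<rho>)" using that \<rho> by simp
    then have "power_integral k (mult_interval \<rho> r) = ((r * (1 + \<rho>)) ^ Suc k - r ^ Suc k) / real (Suc k)"
      unfolding mult_interval_def by (rule power_integral_interval)
    also have "\<dots> = \<rho> * c \<rho> k * r ^ Suc k"
    proof -
      have "(a * b - a) / n = \<rho> * ((b - 1) / (n * \<rho>)) * a" if "n > 0" for a b n :: real
        using that \<rho> by (simp add: field_simps)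
      then show ?thesis unfolding c_def power_mult_distrib by simp
    qed
    finally show ?thesis by (simp add: J_def)
  qed
  have zmom: "(\<Sum>x\<in>X. z \<rho> x * x ^ k) = fact k / c \<rho> k" if k: "k \<le> m" for k
  proof -
    have "(\<Sum>x\<in>X. z \<rho> x * x ^ k) = (\<Sum>x\<in>X. w x * x ^ k) +
        (\<Sum>x\<in>X. \<Sum>i\<le>m. (fact i / c \<rho> i - fact i) * (\<psi> i x * x ^ k))"
      by (simp add: z_def sum.distrib distrib_right sum_distrib_right mult.assoc)
    also have "(\<Sum>x\<in>X. \<Sum>i\<le>m. (fact i / c \<rho> i - fact i) * (\<psi> i x * x ^ k)) =
        (\<Sum>i\<le>m. (fact i / c \<rho> i - fact i) * (\<Sum>x\<in>X. \<psi> i x * x ^ k))"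
      by (subst sum.swap) (simp add: sum_distrib_left)
    also have "\<dots> = (\<Sum>i\<le>m. if i = k then fact i / c \<rho> i - fact i else 0)"
      using k by (intro sum.cong) (auto simp: \<psi>)
    also have "\<dots> = fact k / c \<rho> k - fact k" using k by simp
    finally show ?thesis using quad[OF k] by simp
  qed
  have scale: "(\<Sum>r\<in>R. (if r * b \<in> X then f (r * b) else 0) / (pi * \<rho> * r) * J k r) =
      c \<rho> k / b ^ k * (\<Sum>x\<in>X. f x * x ^ k)" if b: "b \<in> X" for b f k
  proof -
    have bpos: "b > 0" using Xpos b by auto
    have "(\<Sum>r\<in>R. (if r * b \<in> X then f (r * b) else 0) / (pi * \<rho> * r) * J k r) =
        (\<Sum>r\<in>(\<lambda>x. x / b) ` X. (if r * b \<in> X then f (r * b) else 0) / (pi * \<rho> * r) * J k r)"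
    proof (rule sum.mono_neutral_right[OF finR])
      show "(\<lambda>x. x / b) ` X \<subseteq> R" using b by (auto simp: R_def)
      show "\<forall>r\<in>R - (\<lambda>x. x / b) ` X. (if r * b \<in> X then f (r * b) else 0) / (pi * \<rho> * r) * J k r = 0"
      proof
        fix r assume r: "r \<in> R - (\<lambda>x. x / b) ` X"
        have "r * b \<notin> X"
        proof
          assume "r * b \<in> X"
          then have "r * b / b \<in> (\<lambda>x. x / b) ` X" by blast
          then show False using r bpos by simp
        qed
        then show "(if r * b \<in> X then f (r * b) else 0) / (pi * \<rho> * r) * J k r = 0" by simp
      qed
    qed
    also have "\<dots> = (\<Sum>x\<in>X. f x / (pi * \<rho> * (x / b)) * J k (x / b))"
      using bpos by (subst sum.reindex) (auto simp: inj_on_def intro!: sum.cong)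
    also have "\<dots> = (\<Sum>x\<in>X. c \<rho> k / b ^ k * (f x * x ^ k))"
    proof (intro sum.cong refl)
      fix x assume x: "x \<in> X"
      then have "x > 0" using Xpos by auto
      then show "f x / (pi * \<rho> * (x / b)) * J k (x / b) = c \<rho> k / b ^ k * (f x * x ^ k)"
        using bpos \<rho> by (simp add: J power_divide field_simps)
    qed
    finally show ?thesis by (simp add: sum_distrib_left)
  qed
  \<comment> \<open>the factor of the density in one coordinate for the denominator \<open>b\<close>, zero off \<open>X / b\<close>\<close>
  define \<zeta> where "\<zeta> b r = (if r * b \<in> X then z \<rho> (r * b) else 0) / (pi * \<rho> * r)" for b r
  have \<zeta>mom: "(\<Sum>r\<in>R. \<zeta> b r * J k r) = fact k / b ^ k" if "b \<in> X" "k \<le> m" for b k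
    unfolding \<zeta>_def scale[OF that(1)] zmom[OF that(2)] using c0[of k] by simp
  have \<zeta>nn: "\<zeta> b r \<ge> 0" if "r \<in> R" for b r
    using zpos Rpos[OF that] \<rho> by (auto simp: \<zeta>_def less_imp_le)
  define Rn where "Rn = {r :: 'n \<Rightarrow> real. \<forall>j. r j \<in> R}"
  have finRn: "finite Rn"
  proof -
    have "Rn = (\<Pi>\<^sub>E j\<in>(UNIV :: 'n set). R)" by (auto simp: Rn_def PiE_def)
    then show ?thesis using finR by (simp add: finite_PiE)
  qed
  define g where "g r = (\<Sum>b\<in>X. w b * b ^ m * (\<Prod>j\<in>UNIV. \<zeta> b (r j)))" for r :: "'n \<Rightarrow> real"
  have gmom: "(\<Sum>r\<in>Rn. g r * (\<Prod>j\<in>UNIV. J (\<alpha> j) (r j))) = fact (m - multi_degree \<alpha>) * (\<Prod>j\<in>UNIV. fact (\<alpha> j))"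
    if \<alpha>: "multi_degree \<alpha> \<le> m" for \<alpha>
  proof -
    have \<alpha>j: "\<alpha> j \<le> m" for j
      using \<alpha> member_le_sum[of j UNIV \<alpha>] unfolding multi_degree_def by simp
    have "(\<Sum>r\<in>Rn. g r * (\<Prod>j\<in>UNIV. J (\<alpha> j) (r j))) =
        (\<Sum>r\<in>Rn. \<Sum>b\<in>X. w b * b ^ m * (\<Prod>j\<in>UNIV. \<zeta> b (r j) * J (\<alpha> j) (r j)))"
      by (simp add: g_def sum_distrib_right prod.distrib mult.assoc)
    also have "\<dots> = (\<Sum>b\<in>X. w b * b ^ m * (\<Sum>r\<in>Rn. \<Prod>j\<in>UNIV. \<zeta> b (r j) * J (\<alpha> j) (r j)))"
      by (subst sum.swap) (simp add: sum_distrib_left)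
    also have "\<dots> = (\<Sum>b\<in>X. w b * b ^ m * (\<Prod>j\<in>UNIV. \<Sum>r\<in>R. \<zeta> b r * J (\<alpha> j) r))"
    proof (intro sum.cong refl)
      fix b
      show "w b * b ^ m * (\<Sum>r\<in>Rn. \<Prod>j\<in>UNIV. \<zeta> b (r j) * J (\<alpha> j) (r j)) =
          w b * b ^ m * (\<Prod>j\<in>UNIV. \<Sum>r\<in>R. \<zeta> b r * J (\<alpha> j) r)"
        unfolding Rn_def using prod_sum_univ[OF finR, of "\<lambda>j x. \<zeta> b x * J (\<alpha> j) x"] by simp
    qed
    also have "\<dots> = (\<Sum>b\<in>X. w b * b ^ (m - multi_degree \<alpha>) * (\<Prod>j\<in>UNIV. fact (\<alpha> j)))"
    proof (intro sum.cong refl)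
      fix b assume b: "b \<in> X"
      then have "b > 0" using Xpos by auto
      have "b ^ m = b ^ (m - multi_degree \<alpha>) * (\<Prod>j\<in>UNIV. b ^ \<alpha> j)"
        using \<alpha> by (simp add: multi_degree_def flip: power_sum power_add)
      then show "w b * b ^ m * (\<Prod>j\<in>UNIV. \<Sum>r\<in>R. \<zeta> b r * J (\<alpha> j) r) =
          w b * b ^ (m - multi_degree \<alpha>) * (\<Prod>j\<in>UNIV. fact (\<alpha> j))"
        using \<open>b > 0\<close> b \<alpha>j by (simp add: \<zeta>mom prod_dividef)
    qed
    also have "\<dots> = fact (m - multi_degree \<alpha>) * (\<Prod>j\<in>UNIV. fact (\<alpha> j))"
      using quad[of "m - multi_degree \<alpha>"] by (simp flip: sum_distrib_right)
    finally show ?thesis .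
  qed
  \<comment> \<open>dual to the moments of the intervals, with support in \<open>X / b0\<close>\<close>
  define \<xi> where "\<xi> i r = b0 ^ i / c \<rho> i * ((if r * b0 \<in> X then \<psi> i (r * b0) else 0) / (pi * \<rho> * r))" for i r
  have \<xi>mom: "(\<Sum>r\<in>R. \<xi> i r * J k r) = (if i = k then 1 else 0)" if "i \<le> m" "k \<le> m" for i k
  proof -
    have "(\<Sum>r\<in>R. \<xi> i r * J k r) = b0 ^ i / c \<rho> i * (c \<rho> k / b0 ^ k * (\<Sum>x\<in>X. \<psi> i x * x ^ k))"
      unfolding scale[OF b0, symmetric] \<xi>_def by (simp add: sum_distrib_left mult.assoc)
    then show ?thesis using \<psi>[OF that] c0[of k] Xpos[OF b0] by simp
  qed
  define \<phi> where "\<phi> \<beta> r = (\<Prod>j\<in>UNIV. \<xi> (\<beta> j) (r j))" for \<beta> :: "'n \<Rightarrow> nat" and r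
  have \<phi>mom: "(\<Sum>r\<in>Rn. \<phi> \<beta> r * (\<Prod>j\<in>UNIV. J (\<alpha> j) (r j))) = (if \<beta> = \<alpha> then 1 else 0)"
    if \<alpha>: "multi_degree \<alpha> \<le> m" and \<beta>: "multi_degree \<beta> \<le> m" for \<alpha> \<beta>
  proof -
    have le: "\<alpha> j \<le> m" "\<beta> j \<le> m" for j
      using \<alpha> \<beta> member_le_sum[of j UNIV \<alpha>] member_le_sum[of j UNIV \<beta>] unfolding multi_degree_def by simp_all
    have "(\<Sum>r\<in>Rn. \<phi> \<beta> r * (\<Prod>j\<in>UNIV. J (\<alpha> j) (r j))) = (\<Sum>r\<in>Rn. \<Prod>j\<in>UNIV. \<xi> (\<beta> j) (r j) * J (\<alpha> j) (r j))"
      by (simp add: \<phi>_def prod.distrib)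
    also have "\<dots> = (\<Prod>j\<in>UNIV. if \<beta> j = \<alpha> j then 1 else 0)"
      unfolding Rn_def prod_sum_univ[OF finR, of "\<lambda>j x. \<xi> (\<beta> j) x * J (\<alpha> j) x"]
      by (simp only: \<xi>mom[OF le(2) le(1)])
    also have "\<dots> = (if \<beta> = \<alpha> then 1 else 0)"
      by (auto simp: fun_eq_iff intro!: prod_zero)
    finally show ?thesis .
  qed
  have gnn: "g r \<ge> 0" if "r \<in> Rn" for r
    unfolding g_def using that Xpos
    by (intro sum_nonneg mult_nonneg_nonneg prod_nonneg \<zeta>nn) (auto simp: Rn_def less_imp_le)
  have supp: "g r > 0 \<or> (\<forall>\<beta>. \<phi> \<beta> r = 0)" if r: "r \<in> Rn" for r
  proof (cases "\<forall>j. r j * b0 \<in> X")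
    case True
    have "0 < w b0 * b0 ^ m * (\<Prod>j\<in>UNIV. \<zeta> b0 (r j))"
      using True Xpos b0 zpos r Rpos \<rho> by (intro mult_pos_pos prod_pos) (auto simp: \<zeta>_def Rn_def)
    also have "\<dots> \<le> g r"
      unfolding g_def
      by (rule member_le_sum[OF b0 _ X(1)])
         (use r Xpos in \<open>auto simp: Rn_def less_imp_le intro!: mult_nonneg_nonneg prod_nonneg \<zeta>nn\<close>)
    finally show ?thesis by simp
  next
    case False
    then obtain j where "r j * b0 \<notin> X" by auto
    then have "\<xi> i (r j) = 0" for i by (simp add: \<xi>_def)
    then have "\<phi> \<beta> r = 0" for \<beta> unfolding \<phi>_def by (intro prod_zero) auto
    then show ?thesis by simp
  qed
  \<comment> \<open>the factor 2 leaves room below 1 for the perturbation\<close>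
  define C0 where "C0 = 2 * (\<Sum>r\<in>Rn. g r) / fact m"
  have C0: "C0 \<ge> 0" unfolding C0_def using gnn by (simp add: sum_nonneg)
  let ?D = "{\<beta> :: 'n \<Rightarrow> nat. multi_degree \<beta> \<le> m}"
  have finD: "finite ?D" by (rule finite_multi_degree_le)
  have main: "\<exists>\<eta>>0. \<forall>\<sigma> :: ('n \<Rightarrow> nat) \<Rightarrow> real. (\<forall>\<alpha>. multi_degree \<alpha> \<le> m \<longrightarrow> \<bar>\<sigma> \<alpha>\<bar> \<le> \<eta>) \<longrightarrow>
       (\<exists>\<theta>. (\<forall>r. 0 \<le> \<theta> r \<and> \<theta> r \<le> 1) \<and> (\<forall>\<alpha>. multi_degree \<alpha> \<le> m \<longrightarrow>
         (\<Sum>r\<in>Rn. \<theta> r * (\<Prod>j\<in>UNIV. J (\<alpha> j) (r j))) =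
         fact (m - multi_degree \<alpha>) * (\<Prod>j\<in>UNIV. fact (\<alpha> j)) / (C * fact m) - \<sigma> \<alpha>))"
    if C: "C > C0" for C
  proof -
    have Cpos: "C > 0" using C C0 by simp
    define G where "G r = g r / (C * fact m)" for r
    have Gnn: "0 \<le> G r" if "r \<in> Rn" for r using gnn[OF that] Cpos by (simp add: G_def)
    have G2: "G r \<le> 1 / 2" if "r \<in> Rn" for r
    proof -
      have "g r \<le> (\<Sum>r\<in>Rn. g r)" using that gnn finRn by (intro member_le_sum) auto
      also have "\<dots> = C0 * fact m / 2" by (simp add: C0_def)
      also have "\<dots> \<le> C * fact m / 2" using C by (simp add: divide_right_mono)
      finally show ?thesis using Cpos by (simp add: G_def field_simps)
    qed
    define M where "M r = (\<Sum>\<beta>\<in>?D. \<bar>\<phi> \<beta> r\<bar>)" for r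
    have Mnn: "M r \<ge> 0" for r unfolding M_def by (simp add: sum_nonneg)
    \<comment> \<open>the admissible size of \<open>\<sigma>\<close> at the node \<open>r\<close>, with a default value where no perturbation occurs\<close>
    define e where "e r = (if M r = 0 then 1 else min (G r) (1 / 2) / M r)" for r
    have epos: "e r > 0" if r: "r \<in> Rn" for r
    proof (cases "M r = 0")
      case False
      have "\<not> (\<forall>\<beta>. \<phi> \<beta> r = 0)"
      proof
        assume "\<forall>\<beta>. \<phi> \<beta> r = 0"
        then have "M r = 0" by (simp add: M_def)
        then show False using False by simp
      qed
      then have "G r > 0" using supp[OF r] Cpos by (auto simp: G_def)
      then show ?thesis using False Mnn[of r] by (simp add: e_def)
    qed (simp add: e_def)
    define \<eta> where "\<eta> = Min (insert 1 (e ` Rn))"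
    have \<eta>: "\<eta> > 0" using finRn epos by (auto simp: \<eta>_def)
    have \<eta>M: "\<eta> * M r \<le> min (G r) (1 / 2)" if r: "r \<in> Rn" for r
    proof -
      have "\<eta> \<le> e r" unfolding \<eta>_def using finRn r by (intro Min_le) auto
      then have "\<eta> * M r \<le> e r * M r" using Mnn by (intro mult_right_mono)
      also have "\<dots> \<le> min (G r) (1 / 2)" using Gnn[OF r] by (auto simp: e_def min_def)
      finally show ?thesis .
    qed
    show ?thesis
    proof (intro exI[of _ \<eta>] conjI \<eta> allI impI)
      fix \<sigma> :: "('n \<Rightarrow> nat) \<Rightarrow> real" assume \<sigma>: "\<forall>\<alpha>. multi_degree \<alpha> \<le> m \<longrightarrow> \<bar>\<sigma> \<alpha>\<bar> \<le> \<eta>"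
      define \<theta> where "\<theta> r = (if r \<in> Rn then G r - (\<Sum>\<beta>\<in>?D. \<sigma> \<beta> * \<phi> \<beta> r) else 0)" for r
      have "0 \<le> \<theta> r \<and> \<theta> r \<le> 1" for r
      proof (cases "r \<in> Rn")
        case True
        have "\<bar>\<Sum>\<beta>\<in>?D. \<sigma> \<beta> * \<phi> \<beta> r\<bar> \<le> (\<Sum>\<beta>\<in>?D. \<eta> * \<bar>\<phi> \<beta> r\<bar>)"
          by (rule order_trans[OF sum_abs]) (use \<sigma> in \<open>auto simp: abs_mult intro!: sum_mono mult_right_mono\<close>)
        also have "\<dots> = \<eta> * M r" by (simp add: M_def sum_distrib_left)
        also have "\<dots> \<le> min (G r) (1 / 2)" by (rule \<eta>M[OF True])
        finally have "\<bar>\<Sum>\<beta>\<in>?D. \<sigma> \<beta> * \<phi> \<beta> r\<bar> \<le> min (G r) (1 / 2)" .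
        then show ?thesis using G2[OF True] True by (auto simp: \<theta>_def abs_le_iff)
      qed (simp add: \<theta>_def)
      moreover have "(\<Sum>r\<in>Rn. \<theta> r * (\<Prod>j\<in>UNIV. J (\<alpha> j) (r j))) =
         fact (m - multi_degree \<alpha>) * (\<Prod>j\<in>UNIV. fact (\<alpha> j)) / (C * fact m) - \<sigma> \<alpha>"
        if \<alpha>: "multi_degree \<alpha> \<le> m" for \<alpha>
      proof -
        have "(\<Sum>r\<in>Rn. \<theta> r * (\<Prod>j\<in>UNIV. J (\<alpha> j) (r j))) =
            (\<Sum>r\<in>Rn. g r * (\<Prod>j\<in>UNIV. J (\<alpha> j) (r j)) / (C * fact m)) -
            (\<Sum>r\<in>Rn. \<Sum>\<beta>\<in>?D. \<sigma> \<beta> * (\<phi> \<beta> r * (\<Prod>j\<in>UNIV. J (\<alpha> j) (r j))))"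
          by (simp add: \<theta>_def G_def left_diff_distrib sum_subtractf sum_distrib_right mult.assoc)
        also have "(\<Sum>r\<in>Rn. \<Sum>\<beta>\<in>?D. \<sigma> \<beta> * (\<phi> \<beta> r * (\<Prod>j\<in>UNIV. J (\<alpha> j) (r j)))) =
            (\<Sum>\<beta>\<in>?D. \<sigma> \<beta> * (\<Sum>r\<in>Rn. \<phi> \<beta> r * (\<Prod>j\<in>UNIV. J (\<alpha> j) (r j))))"
          by (subst sum.swap) (simp add: sum_distrib_left)
        also have "\<dots> = (\<Sum>\<beta>\<in>?D. if \<beta> = \<alpha> then \<sigma> \<beta> else 0)"
          using \<alpha> by (intro sum.cong) (auto simp: \<phi>mom)
        also have "\<dots> = \<sigma> \<alpha>" using \<alpha> finD by simp
        finally show ?thesis by (simp add: gmom[OF \<alpha>] flip: sum_divide_distrib)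
      qed
      ultimately show "\<exists>\<theta>. (\<forall>r. 0 \<le> \<theta> r \<and> \<theta> r \<le> 1) \<and> (\<forall>\<alpha>. multi_degree \<alpha> \<le> m \<longrightarrow>
         (\<Sum>r\<in>Rn. \<theta> r * (\<Prod>j\<in>UNIV. J (\<alpha> j) (r j))) =
         fact (m - multi_degree \<alpha>) * (\<Prod>j\<in>UNIV. fact (\<alpha> j)) / (C * fact m) - \<sigma> \<alpha>)"
        by (intro exI[of _ \<theta>]) blast
    qed
  qed
  show ?thesis
    by (rule that[of R \<rho> C0])
       (use finR Rne Rpos \<rho> gap C0 main in \<open>auto simp: Rn_def J_def\<close>)
qed

section \<open>Moments of products of annuli\<close>

lemma emeasure_lborel_complex_annulus:
  fixes a b :: real
  assumes "0 \<le> a" "a \<le> b"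
  shows "emeasure lborel {z :: complex. (cmod z)\<^sup>2 \<in> {a..<b}} = ennreal (pi * (b - a))"
proof -
  have ball: "emeasure lborel {z :: complex. (cmod z)\<^sup>2 < c} = ennreal (pi * c)" if "0 \<le> c" for c
  proof -
    have "(cmod z)\<^sup>2 < c \<longleftrightarrow> cmod z < sqrt c" for z :: complex
      using real_sqrt_less_iff[of "(cmod z)\<^sup>2" c] by simp
    then have "{z :: complex. (cmod z)\<^sup>2 < c} = ball 0 (sqrt c)"
      by (simp add: ball_def)
    moreover have "emeasure lborel (ball (0 :: complex) (sqrt c)) = ennreal (unit_ball_vol 2 * sqrt c ^ 2)"
      using that by (subst emeasure_ball) auto
    ultimately show ?thesis using that by (simp add: unit_ball_vol_2)
  qed
  have "{z :: complex. (cmod z)\<^sup>2 \<in> {a..<b}} = {z. (cmod z)\<^sup>2 < b} - {z. (cmod z)\<^sup>2 < a}"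
    by auto
  moreover have "emeasure lborel \<dots> = ennreal (pi * b) - ennreal (pi * a)"
    using assms ball[of a] ball[of b] by (subst emeasure_Diff) (auto)
  ultimately show ?thesis
    using assms by (simp add: ennreal_minus right_diff_distrib)
qed

text \<open>
  The annulus \<open>a \<le> \<bar>w\<bar>\<^sup>2 < b\<close> has area \<open>\<pi> (b - a)\<close>.
\<close>

lemma distr_cmod_square:
  "distr (lborel :: complex measure) borel (\<lambda>z. (cmod z)\<^sup>2) =
   density lborel (\<lambda>t. ennreal pi * indicator {0..} t)"
  (is "?L = ?R")
proof (rule measure_eqI_generator_eq[where E = "range (\<lambda>(a, b). {a..<b::real})" and \<Omega> = UNIV
      and A = "\<lambda>i. {- real i..<real i}"])
  have ico: "{a..<b} \<inter> {c..<d} = {max a c..<min b d}" for a b c d :: real by auto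
  show "Int_stable (range (\<lambda>(a, b). {a..<b::real}))"
    by (auto simp: Int_stable_def ico)
  show "range (\<lambda>(a, b). {a..<b::real}) \<subseteq> Pow UNIV" by simp
  have L: "emeasure ?L {a..<b} = ennreal (pi * (max 0 b - max 0 a))" if "a \<le> b" for a b
  proof -
    have "emeasure ?L {a..<b} = emeasure lborel {z :: complex. (cmod z)\<^sup>2 \<in> {a..<b}}"
      by (subst emeasure_distr) (auto simp: vimage_def)
    also have "{z :: complex. (cmod z)\<^sup>2 \<in> {a..<b}} = {z. (cmod z)\<^sup>2 \<in> {max 0 a..<max 0 b}}"
      by (auto simp: less_max_iff_disj) 
    also have "emeasure lborel \<dots> = ennreal (pi * (max 0 b - max 0 a))"
      using that by (intro emeasure_lborel_complex_annulus) auto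
    finally show ?thesis .
  qed
  have R: "emeasure ?R {a..<b} = ennreal (pi * (max 0 b - max 0 a))" if "a \<le> b" for a b
  proof -
    have "emeasure ?R {a..<b} = (\<integral>\<^sup>+t. ennreal pi * indicator {max 0 a..<max 0 b} t \<partial>lborel)"
      by (subst emeasure_density) (auto intro!: nn_integral_cong simp: indicator_def)
    also have "\<dots> = ennreal (pi * (max 0 b - max 0 a))"
      using that by (simp add: nn_integral_cmult ennreal_mult)
    finally show ?thesis .
  qed
  show "emeasure ?L X = emeasure ?R X" if X': "X \<in> range (\<lambda>(a, b). {a..<b::real})" for X
  proof -
    obtain a b where X: "X = {a..<b}" using X' by auto
    show ?thesis
      by (cases "a \<le> b") (use L[of a b] R[of a b] in \<open>auto simp: X\<close>)
  qed
  have "sets borel = sigma_sets UNIV (range (\<lambda>(a, b). {a..<b::real}))"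
    by (subst borel_eq_atLeastLessThan) (auto intro!: sets_measure_of)
  then show "sets ?L = sigma_sets UNIV (range (\<lambda>(a, b). {a..<b::real}))"
    "sets ?R = sigma_sets UNIV (range (\<lambda>(a, b). {a..<b::real}))" by simp_all
  show "range (\<lambda>i. {- real i..<real i}) \<subseteq> range (\<lambda>(a, b). {a..<b::real})" by auto
  show "(\<Union>i. {- real i..<real i}) = UNIV"
  proof -
    have "\<exists>i. - real i \<le> x \<and> x < real i" for x :: real
    proof -
      obtain i where "\<bar>x\<bar> < real i" using reals_Archimedean2 by blast
      then show ?thesis by (intro exI[of _ i]) auto
    qed
    then show ?thesis by auto
  qed
  show "emeasure ?L {- real i..<real i} \<noteq> \<infinity>" for i
    using L[of "- real i" "real i"] by simp
qed

text \<open>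
  Comparing boxes identifies Lebesgue measure with the product of the measures of the coordinates, which
  makes the product form of Tonelli's theorem available.
\<close>

lemma lborel_vec_eq:
  "(lborel :: (complex ^ 'n::finite) measure) =
     distr (PiM UNIV (\<lambda>_. lborel)) borel (\<lambda>f. \<chi> j. f j)"
proof (rule lborel_eqI)
  interpret P: product_sigma_finite "\<lambda>_ :: 'n. lborel :: complex measure"
    by standard
  fix l u :: "complex ^ 'n"
  have Basis_vec: "(Basis :: (complex ^ 'n) set) = (\<Union>j. \<Union>b\<in>Basis. {axis j b})"
    by (auto simp: Basis_vec_def)
  assume "\<And>b. b \<in> Basis \<Longrightarrow> l \<bullet> b \<le> u \<bullet> b"
  then have le: "l $ j \<bullet> b \<le> u $ j \<bullet> b" if "b \<in> Basis" for j b
    using that unfolding Basis_vec by (force simp: inner_axis)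
  have meas: "(\<lambda>f. \<chi> j. f j) \<in> measurable (PiM UNIV (\<lambda>_ :: 'n. lborel :: complex measure)) borel"
    by (rule borel_measurable_euclidean_space[THEN iffD2]) (auto simp: Basis_vec inner_axis)
  have "(\<lambda>f. \<chi> j. f j) -` box l u \<inter> space (PiM UNIV (\<lambda>_ :: 'n. lborel :: complex measure))
      = (\<Pi>\<^sub>E j\<in>UNIV. box (l $ j) (u $ j))"
    by (auto simp: space_PiM box_def Basis_vec inner_axis PiE_def)
  then have "emeasure (distr (PiM UNIV (\<lambda>_. lborel)) borel (\<lambda>f. \<chi> j. f j)) (box l u) =
    emeasure (PiM UNIV (\<lambda>_ :: 'n. lborel)) (\<Pi>\<^sub>E j\<in>UNIV. box (l $ j) (u $ j))"
    by (subst emeasure_distr[OF meas]) auto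
  also have "\<dots> = (\<Prod>j\<in>UNIV. emeasure lborel (box (l $ j) (u $ j)))"
    by (rule P.emeasure_PiM) auto
  also have "\<dots> = (\<Prod>j\<in>UNIV. ennreal (\<Prod>b\<in>Basis. (u $ j - l $ j) \<bullet> b))"
    using le by (intro prod.cong refl emeasure_lborel_box) auto
  also have "\<dots> = ennreal (\<Prod>j\<in>UNIV. \<Prod>b\<in>Basis. (u $ j - l $ j) \<bullet> b)"
    using le by (subst prod_ennreal) (auto intro!: prod_nonneg simp: inner_diff_left)
  also have "(\<Prod>j\<in>UNIV. \<Prod>b\<in>Basis. (u $ j - l $ j) \<bullet> b) = (\<Prod>b\<in>Basis. (u - l) \<bullet> b)"
  proof -
    have "(\<Prod>b\<in>Basis. (u - l) \<bullet> b) = (\<Prod>j\<in>UNIV. \<Prod>b\<in>(\<Union>b\<in>Basis. {axis j b}). (u - l) \<bullet> b)"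
      unfolding Basis_vec
      by (rule prod.UNION_disjoint) (auto simp: axis_eq_axis dest: nonzero_Basis)
    also have "\<dots> = (\<Prod>j\<in>UNIV. \<Prod>b\<in>Basis. (u - l) \<bullet> axis j b)"
      by (intro prod.cong refl) (subst prod.UNION_disjoint, auto simp: axis_eq_axis)
    finally show ?thesis by (simp add: inner_axis)
  qed
  finally show "emeasure (distr (PiM UNIV (\<lambda>_. lborel)) borel (\<lambda>f. \<chi> j. f j)) (box l u) =
     ennreal (\<Prod>b\<in>Basis. (u - l) \<bullet> b)" .
qed simp

text \<open>
  The image of Lebesgue measure on the complex plane under \<open>\<bar>w\<bar>\<^sup>2\<close>, weighted with \<open>t^k\<close>.
\<close>

definition moment_measure :: "nat \<Rightarrow> real measure" where
  "moment_measure k = density lborel (\<lambda>t. ennreal (pi * t ^ k) * indicator {0..} t)"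

definition modulus_box :: "('n::finite \<Rightarrow> real set) \<Rightarrow> (complex ^ 'n) set" where
  "modulus_box A = {z. \<forall>j. (cmod (z $ j))\<^sup>2 \<in> A j}"

text \<open>
  Its value at \<open>\<Omega>\<close> is the squared norm of \<open>z\<^sup>\<alpha>\<close> over \<open>\<Omega>\<close>. Treating this moment as a measure in \<open>\<Omega>\<close> lets the
  additivity of measures do the bookkeeping for the pieces of the domain.
\<close>

definition monomial_measure :: "('n::finite \<Rightarrow> nat) \<Rightarrow> (complex ^ 'n) measure" where
  "monomial_measure \<alpha> = density lborel (\<lambda>z. ennreal (\<Prod>j\<in>UNIV. (cmod (z $ j))\<^sup>2 ^ \<alpha> j))"

lemma sets_monomial_measure [simp, measurable_cong]: "sets (monomial_measure \<alpha>) = sets borel"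
  by (simp add: monomial_measure_def)

lemma sets_moment_measure [simp, measurable_cong]: "sets (moment_measure k) = sets borel"
  by (simp add: moment_measure_def)

lemma borel_measurable_vec_nth [measurable]: "(\<lambda>z :: complex ^ 'n. z $ j) \<in> borel_measurable borel"
  by (intro borel_measurable_continuous_onI continuous_intros)

lemma sets_modulus_box:
  assumes "\<And>j. A j \<in> sets borel"
  shows "modulus_box A \<in> sets (borel :: (complex ^ 'n::finite) measure)"
proof -
  have "{z :: complex ^ 'n \<in> space borel. \<forall>j\<in>UNIV. (cmod (z $ j))\<^sup>2 \<in> A j} \<in> sets borel"
    by (intro sets.sets_Collect_finite_All) (use assms in measurable)
  then show ?thesis by (simp add: modulus_box_def)
qed

lemma emeasure_monomial_measure_modulus_box:
  fixes \<alpha> :: "'n::finite \<Rightarrow> nat"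
  assumes A: "\<And>j. A j \<in> sets borel"
  shows "emeasure (monomial_measure \<alpha>) (modulus_box A) = (\<Prod>j\<in>UNIV. emeasure (moment_measure (\<alpha> j)) (A j))"
proof -
  interpret P: product_sigma_finite "\<lambda>_ :: 'n. lborel :: complex measure"
    by standard
  note [measurable] = A
  define f where "f j w = ennreal ((cmod w)\<^sup>2 ^ \<alpha> j) * indicator (A j) ((cmod w)\<^sup>2)" for j w
  have f [measurable]: "f j \<in> borel_measurable borel" for j
    unfolding f_def by measurable
  have meas: "(\<lambda>f. \<chi> j. f j) \<in> measurable (PiM UNIV (\<lambda>_ :: 'n. lborel :: complex measure)) borel"
    by (rule borel_measurable_euclidean_space[THEN iffD2]) (auto simp: Basis_vec_def inner_axis)
  have "emeasure (monomial_measure \<alpha>) (modulus_box A) =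
      (\<integral>\<^sup>+z. ennreal (\<Prod>j\<in>UNIV. (cmod (z $ j))\<^sup>2 ^ \<alpha> j) * indicator (modulus_box A) z \<partial>lborel)"
    unfolding monomial_measure_def
    by (rule emeasure_density) (use sets_modulus_box[of A] A in auto)
  also have "\<dots> = (\<integral>\<^sup>+z. (\<Prod>j\<in>UNIV. f j (z $ j)) \<partial>lborel)"
  proof (rule nn_integral_cong)
    fix z :: "complex ^ 'n"
    show "ennreal (\<Prod>j\<in>UNIV. (cmod (z $ j))\<^sup>2 ^ \<alpha> j) * indicator (modulus_box A) z = (\<Prod>j\<in>UNIV. f j (z $ j))"
    proof (cases "z \<in> modulus_box A")
      case True
      then have "f j (z $ j) = ennreal ((cmod (z $ j))\<^sup>2 ^ \<alpha> j)" for j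
        by (simp add: modulus_box_def f_def)
      with True show ?thesis by (simp add: prod_ennreal)
    next
      case False
      then obtain j where "(cmod (z $ j))\<^sup>2 \<notin> A j" by (auto simp: modulus_box_def)
      then have "f j (z $ j) = 0" by (simp add: f_def)
      with False show ?thesis by (auto intro!: prod_zero[symmetric])
    qed
  qed
  also have "\<dots> = (\<integral>\<^sup>+g. (\<Prod>j\<in>UNIV. f j ((\<chi> j. g j) $ j)) \<partial>(PiM UNIV (\<lambda>_ :: 'n. lborel)))"
    by (subst lborel_vec_eq, rule nn_integral_distr[OF meas]) measurable
  also have "\<dots> = (\<integral>\<^sup>+g. (\<Prod>j\<in>UNIV. f j (g j)) \<partial>(PiM UNIV (\<lambda>_ :: 'n. lborel)))"
    by simp
  also have "\<dots> = (\<Prod>j\<in>UNIV. \<integral>\<^sup>+w. f j w \<partial>lborel)"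
    by (rule P.product_nn_integral_prod) auto
  moreover have "(\<integral>\<^sup>+w. f j w \<partial>lborel) = emeasure (moment_measure (\<alpha> j)) (A j)" for j
  proof -
    have "(\<integral>\<^sup>+w. f j w \<partial>lborel) =
        (\<integral>\<^sup>+t. ennreal (t ^ \<alpha> j) * indicator (A j) t \<partial>(distr (lborel :: complex measure) borel (\<lambda>z. (cmod z)\<^sup>2)))"
      by (subst nn_integral_distr) (auto simp: f_def[abs_def])
    also have "\<dots> = (\<integral>\<^sup>+t. ennreal pi * indicator {0..} t * (ennreal (t ^ \<alpha> j) * indicator (A j) t) \<partial>lborel)"
      unfolding distr_cmod_square by (subst nn_integral_density) auto
    also have "\<dots> = (\<integral>\<^sup>+t. ennreal (pi * t ^ \<alpha> j) * indicator {0..} t * indicator (A j) t \<partial>lborel)"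
      by (intro nn_integral_cong) (auto simp: indicator_def ennreal_mult')
    also have "\<dots> = emeasure (moment_measure (\<alpha> j)) (A j)"
      unfolding moment_measure_def by (subst emeasure_density) auto
    finally show ?thesis .
  qed
  ultimately show ?thesis by simp
qed

section \<open>Fourier coefficients on the circle\<close>

text \<open>
  Differentiation under the integral sign requires a jointly continuous derivative. Cauchy's formula for
  the derivative supplies it, as an integral of a jointly continuous function.
\<close>

lemma holomorphic_integral_param:
  fixes \<Phi> :: "complex \<Rightarrow> real \<Rightarrow> complex"
  assumes r: "r > 0"
    and cont: "continuous_on (cball z0 r \<times> cbox a b) (\<lambda>(w, t). \<Phi> w t)"
    and hol: "\<And>t. t \<in> cbox a b \<Longrightarrow> (\<lambda>w. \<Phi> w t) holomorphic_on ball z0 r"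
  shows "(\<lambda>w. integral (cbox a b) (\<Phi> w)) holomorphic_on ball z0 r"
proof -
  define D where "D w t = 1 / (2 * of_real pi * \<i>) *
      contour_integral (circlepath z0 r) (\<lambda>u. \<Phi> u t / (u - w)\<^sup>2)" for w t
  define g where "g s = z0 + of_real r * exp (2 * of_real pi * \<i> * of_real s)" for s
  define g' where "g' s = 2 * of_real pi * \<i> * of_real r * exp (2 * of_real pi * \<i> * of_real s)" for s
  have g_sphere: "g s \<in> sphere z0 r" for s
    using r by (auto simp: g_def dist_norm norm_mult)
  have D_eq: "D w t = 1 / (2 * of_real pi * \<i>) * integral (cbox 0 1) (\<lambda>s. \<Phi> (g s) t / (g s - w)\<^sup>2 * g' s)" for w t
    unfolding D_def contour_integral_integral vector_derivative_circlepath
    by (simp add: circlepath g_def g'_def mult_ac)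
  have cont2: "continuous_on ((ball z0 r \<times> cbox a b) \<times> cbox 0 1)
      (\<lambda>(x, s). \<Phi> (g s) (snd x) / (g s - fst x)\<^sup>2 * g' s)"
  proof -
    have "continuous_on ((ball z0 r \<times> cbox a b) \<times> cbox 0 1)
        (\<lambda>y. (\<lambda>(w, t). \<Phi> w t) (g (snd y), snd (fst y)))"
    proof (rule continuous_on_compose2[OF cont])
      show "continuous_on ((ball z0 r \<times> cbox a b) \<times> cbox 0 1) (\<lambda>y. (g (snd y), snd (fst y)))"
        unfolding g_def by (intro continuous_intros)
      have "g s \<in> cball z0 r" for s using g_sphere[of s] by simp
      then show "(\<lambda>y. (g (snd y), snd (fst y))) ` ((ball z0 r \<times> cbox a b) \<times> cbox 0 1) \<subseteq> cball z0 r \<times> cbox a b"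
        by (auto simp del: mem_cball)
    qed
    moreover have "g s \<noteq> w" if "w \<in> ball z0 r" for s w
      using g_sphere[of s] that by auto
    ultimately show ?thesis
      unfolding case_prod_beta
      by (intro continuous_intros) (auto simp: g_def g'_def intro!: continuous_intros)
  qed
  have contD: "continuous_on (ball z0 r \<times> cbox a b) (\<lambda>(w, t). D w t)"
    unfolding D_eq case_prod_beta
    by (intro continuous_intros integral_continuous_on_param) (use cont2 in \<open>simp add: case_prod_beta\<close>)
  show ?thesis
  proof (rule leibniz_rule_holomorphic[where fx = D])
    fix w t assume w: "w \<in> ball z0 r" and t: "t \<in> cbox a b"
    have "continuous_on (cball z0 r) (\<lambda>w. \<Phi> w t)"
    proof -
      have "continuous_on (cball z0 r) (\<lambda>w. (\<lambda>(w, t). \<Phi> w t) (w, t))"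
        by (rule continuous_on_compose2[OF cont]) (use t in \<open>auto intro!: continuous_intros\<close>)
      then show ?thesis by simp
    qed
    from Cauchy_derivative_integral_circlepath(2)[OF this hol[OF t] w]
    show "((\<lambda>w. \<Phi> w t) has_field_derivative D w t) (at w within ball z0 r)"
      unfolding D_def by (rule has_field_derivative_at_within)
  next
    fix w assume "w \<in> ball z0 r"
    then have "continuous_on (cbox a b) (\<Phi> w)"
    proof -
      assume w: "w \<in> ball z0 r"
      have "continuous_on (cbox a b) (\<lambda>t. (\<lambda>(w, t). \<Phi> w t) (w, t))"
        by (rule continuous_on_compose2[OF cont]) (use w in \<open>auto intro!: continuous_intros\<close>)
      then show ?thesis by simp
    qed
    then show "\<Phi> w integrable_on cbox a b" by (rule integrable_continuous)
  qed (use contD in auto)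
qed

lemma integral_shift_real:
  fixes h :: "real \<Rightarrow> complex"
  assumes "continuous_on UNIV h"
  shows "integral {a..b} (\<lambda>t. h (t + c)) = integral {a + c..b + c} h"
proof -
  have "(h has_integral integral {a + c..b + c} h) (cbox (a + c) (b + c))"
    by (simp add: integrable_integral integrable_continuous_interval continuous_on_subset[OF assms])
  then have "((\<lambda>t. h (t + c)) has_integral integral {a + c..b + c} h) ((\<lambda>x. x - c) ` {a + c..b + c})"
    using has_integral_affinity[of h _ "a + c" "b + c" 1 c] by simp
  moreover have "(\<lambda>x. x - c) ` {a + c..b + c} = {a..b}"
    by (auto simp: image_iff intro!: bexI[of _ "_ + c"])
  ultimately show ?thesis by (simp add: integral_unique)
qed

lemma integral_periodic:
  fixes h :: "real \<Rightarrow> complex"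
  assumes cont: "continuous_on UNIV h" and per: "\<And>t. h (t + p) = h t" and c: "0 \<le> c" "c \<le> p"
  shows "integral {0..p} (\<lambda>t. h (t + c)) = integral {0..p} h"
proof -
  have int: "h integrable_on {x..y}" for x y
    by (rule integrable_continuous_interval) (rule continuous_on_subset[OF cont], simp)
  have "integral {0..p} (\<lambda>t. h (t + c)) = integral {c..p + c} h"
    using integral_shift_real[OF cont, of 0 p c] by simp
  also have "\<dots> = integral {c..p} h + integral {p..p + c} h"
    using c by (intro Henstock_Kurzweil_Integration.integral_combine[symmetric] int) auto
  also have "integral {p..p + c} h = integral {0..c} h"
    using integral_shift_real[OF cont, of 0 c p] by (simp add: per add.commute)
  also have "integral {c..p} h + integral {0..c} h = integral {0..p} h"
    using c Henstock_Kurzweil_Integration.integral_combine[of 0 c p h, OF _ _ int] by (simp add: add.commute)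
  finally show ?thesis .
qed

definition circle_coeff :: "(complex \<Rightarrow> complex) \<Rightarrow> int \<Rightarrow> complex" where
  "circle_coeff F k = integral {0..2 * pi} (\<lambda>t. F (cis t) * cis (- (of_int k * t)))"

lemma continuous_on_cis_compose:
  assumes "continuous_on (sphere 0 1) F"
  shows "continuous_on S (\<lambda>t::real. F (cis t))"
  by (rule continuous_on_compose2[OF assms]) (auto intro!: continuous_intros)

lemma circle_coeff_integrable:
  assumes "continuous_on (sphere 0 1) F"
  shows "(\<lambda>t. F (cis t) * cis (- (of_int k * t))) integrable_on {a..b}"
  by (intro integrable_continuous_interval continuous_intros continuous_on_cis_compose assms)

lemma circle_coeff_add:
  assumes "continuous_on (sphere 0 1) F" "continuous_on (sphere 0 1) G"
  shows "circle_coeff (\<lambda>u. F u + G u) k = circle_coeff F k + circle_coeff G k"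
  unfolding circle_coeff_def distrib_right
  by (rule Henstock_Kurzweil_Integration.integral_add) (intro circle_coeff_integrable assms)+

lemma circle_coeff_cmult: "circle_coeff (\<lambda>u. c * F u) k = c * circle_coeff F k"
  unfolding circle_coeff_def mult.assoc by (rule integral_mult_right)

lemma circle_coeff_shift: "circle_coeff (\<lambda>u. F u * u) k = circle_coeff F (k - 1)"
proof -
  have "cis t * cis (- (of_int k * t)) = cis (- (of_int (k - 1) * t))" for t
    by (simp add: cis_mult algebra_simps)
  then show ?thesis unfolding circle_coeff_def mult.assoc by simp
qed

lemma circle_coeff_shift': "circle_coeff (\<lambda>u. F u * cnj u) k = circle_coeff F (k + 1)"
proof -
  have "cnj (cis t) * cis (- (of_int k * t)) = cis (- (of_int (k + 1) * t))" for t
    by (simp add: cis_cnj cis_mult algebra_simps)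
  then show ?thesis unfolding circle_coeff_def mult.assoc by simp
qed

text \<open>
  On the circle a real linear function is a combination of \<open>u\<close> and its conjugate, and multiplication by
  these shifts the coefficients. The statement is about all \<open>F\<close> at once, so that a product of two polynomials
  is handled by applying it twice.
\<close>

lemma circle_coeff_mult_polynomial_eq_0:
  assumes "real_polynomial_function q"
  shows "continuous_on (sphere 0 1) F \<Longrightarrow> (\<And>k. circle_coeff F k = 0) \<Longrightarrow>
    (\<forall>k. circle_coeff (\<lambda>u. F u * of_real (q u)) k = 0)"
  using assms(1)
proof (induction arbitrary: F rule: real_polynomial_function.induct)
  case (linear q)
  define c where "c = (of_real (q 1) - \<i> * of_real (q \<i>)) / 2"
  define d where "d = (of_real (q 1) + \<i> * of_real (q \<i>)) / 2"
  have q: "of_real (q u) = c * u + d * cnj u" for u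
  proof -
    have "u = Re u *\<^sub>R 1 + Im u *\<^sub>R \<i>" by (simp add: complex_eq_iff)
    then have "q u = q (Re u *\<^sub>R 1 + Im u *\<^sub>R \<i>)" by (rule arg_cong)
    also have "\<dots> = Re u * q 1 + Im u * q \<i>"
      using bounded_linear.linear[OF linear(1)] by (simp add: linear_add linear_scale)
    finally show ?thesis by (simp add: c_def d_def complex_eq_iff field_simps)
  qed
  have "circle_coeff (\<lambda>u. F u * of_real (q u)) k =
      circle_coeff (\<lambda>u. c * (F u * u) + d * (F u * cnj u)) k" for k
    by (simp add: q algebra_simps)
  also have "\<dots> k = 0" for k
    using linear(2,3)
    by (subst circle_coeff_add)
       (auto simp: circle_coeff_cmult circle_coeff_shift circle_coeff_shift' intro!: continuous_intros)
  finally show ?case by simp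
next
  case (const c)
  then show ?case by (simp add: circle_coeff_cmult mult.commute[of _ "of_real c"])
next
  case (add q1 q2)
  have "continuous_on (sphere 0 1) q" if "real_polynomial_function q" for q :: "complex \<Rightarrow> real"
    using that by (intro continuous_at_imp_continuous_on ballI continuous_real_polymonial_function)
  then have "continuous_on (sphere 0 1) (\<lambda>u. F u * of_real (q1 u))"
    "continuous_on (sphere 0 1) (\<lambda>u. F u * of_real (q2 u))"
    using add by (auto intro!: continuous_intros)
  from circle_coeff_add[OF this] add show ?case
    by (simp add: distrib_left)
next
  case (mult q1 q2)
  have "continuous_on (sphere 0 1) q1"
    using mult(1) by (intro continuous_at_imp_continuous_on ballI continuous_real_polymonial_function)
  then have "\<forall>k. circle_coeff (\<lambda>u. (F u * of_real (q1 u)) * of_real (q2 u)) k = 0"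
    using mult by (intro mult.IH(2)) (auto intro!: continuous_intros)
  then show ?case by (simp add: mult.assoc)
qed

text \<open>
  By Weierstrass approximation the real part and the imaginary part of \<open>F\<close> are uniform limits of polynomials,
  so \<open>F\<close> is orthogonal to them; hence the integrals of their squares vanish.
\<close>

lemma circle_coeff_unique:
  assumes cont: "continuous_on (sphere 0 1) F" and zero: "\<And>k. circle_coeff F k = 0"
    and u: "cmod u = 1"
  shows "F u = 0"
proof -
  have part: "Q (F u) = 0" if Q: "Q = Re \<or> Q = Im" for Q
  proof -
    let ?G = "\<lambda>u. of_real (Q (F u)) :: complex"
    have cQ: "continuous_on (sphere 0 1) (\<lambda>u. Q (F u))"
      using Q cont by (auto intro!: continuous_intros)
    define I where "I = integral {0..2 * pi} (\<lambda>t. (Q (F (cis t)))\<^sup>2)"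
    define B where "B = integral {0..2 * pi} (\<lambda>t. norm (F (cis t)))"
    have cQt: "continuous_on S (\<lambda>t. Q (F (cis t)))" for S
      by (rule continuous_on_compose2[OF cQ]) (auto intro!: continuous_intros)
    have cFt: "continuous_on S (\<lambda>t. F (cis t))" for S
      by (rule continuous_on_cis_compose[OF cont])
    have B0: "B \<ge> 0" unfolding B_def
      by (rule integral_nonneg) (auto intro!: integrable_continuous_interval continuous_intros cFt)
    have Ie: "I \<le> e * B" if e: "e > 0" for e
    proof -
      obtain q where q: "real_polynomial_function q" "\<And>u. u \<in> sphere 0 1 \<Longrightarrow> \<bar>Q (F u) - q u\<bar> < e"
        using Stone_Weierstrass_real_polynomial_function[OF compact_sphere cQ e] by blast
      have cq: "continuous_on (sphere 0 1) q"
        using q(1) by (intro continuous_at_imp_continuous_on ballI continuous_real_polymonial_function)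
      have cqt: "continuous_on S (\<lambda>t. q (cis t))" for S
        by (rule continuous_on_compose2[OF cq]) (auto intro!: continuous_intros)
      have "integral {0..2 * pi} (\<lambda>t. F (cis t) * of_real (q (cis t))) = 0"
        using circle_coeff_mult_polynomial_eq_0[OF q(1) cont zero] by (auto simp: circle_coeff_def dest: spec[of _ 0])
      then have i0: "((\<lambda>t. F (cis t) * of_real (q (cis t))) has_integral 0) {0..2 * pi}"
        using integrable_integral[OF integrable_continuous_interval[of 0 "2 * pi" "\<lambda>t. F (cis t) * of_real (q (cis t))"]]
        by (simp add: continuous_on_mult continuous_on_of_real cFt cqt)
      have "((\<lambda>t. Q (F (cis t) * of_real (q (cis t)))) has_integral Q 0) {0..2 * pi}"
        using Q has_integral_linear[OF i0 bounded_linear_Re] has_integral_linear[OF i0 bounded_linear_Im]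
        by (auto simp: o_def)
      then have 0: "((\<lambda>t. Q (F (cis t)) * q (cis t)) has_integral 0) {0..2 * pi}"
        using Q by auto
      have "I = integral {0..2 * pi} (\<lambda>t. (Q (F (cis t)))\<^sup>2 - Q (F (cis t)) * q (cis t))"
        unfolding I_def using 0
        by (subst Henstock_Kurzweil_Integration.integral_diff)
           (auto intro!: integrable_continuous_interval continuous_intros cQt simp: has_integral_iff)
      also have "\<dots> \<le> integral {0..2 * pi} (\<lambda>t. e * norm (F (cis t)))"
      proof (rule integral_le)
        fix t assume "t \<in> {0..2 * pi}"
        have "\<bar>Q (F (cis t))\<bar> \<le> norm (F (cis t))" using Q abs_Re_le_cmod abs_Im_le_cmod by blast
        moreover have "\<bar>Q (F (cis t)) - q (cis t)\<bar> \<le> e" using q(2)[of "cis t"] by simp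
        ultimately have "\<bar>Q (F (cis t))\<bar> * \<bar>Q (F (cis t)) - q (cis t)\<bar> \<le> norm (F (cis t)) * e"
          by (intro mult_mono) auto
        then have "Q (F (cis t)) * (Q (F (cis t)) - q (cis t)) \<le> norm (F (cis t)) * e"
          by (simp flip: abs_mult)
        then show "(Q (F (cis t)))\<^sup>2 - Q (F (cis t)) * q (cis t) \<le> e * norm (F (cis t))"
          by (simp add: power2_eq_square algebra_simps)
      qed (auto intro!: integrable_continuous_interval continuous_intros cQt cqt cFt)
      finally show ?thesis by (simp add: B_def)
    qed
    have "I \<le> 0"
    proof (rule field_le_epsilon)
      fix e :: real assume "e > 0"
      then have "I \<le> e / (B + 1) * B" using B0 by (intro Ie) auto
      also have "\<dots> \<le> e" using B0 \<open>e > 0\<close> by (simp add: field_simps)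
      finally show "I \<le> 0 + e" by simp
    qed
    moreover have "I \<ge> 0" unfolding I_def
      by (rule integral_nonneg) (auto intro!: integrable_continuous_interval continuous_intros cQt)
    ultimately have I0: "I = 0" by simp
    have "continuous_on {0..2 * pi} (\<lambda>t. (Q (F (cis t)))\<^sup>2)" by (intro continuous_intros cQt)
    then have hi: "((\<lambda>t. (Q (F (cis t)))\<^sup>2) has_integral 0) (cbox 0 (2 * pi))"
      using I0 unfolding I_def cbox_interval by (simp add: has_integral_iff integrable_continuous_interval)
    obtain t where t: "t \<in> cbox 0 (2 * pi)" "u = cis t"
    proof -
      have "u = cis (Arg2pi u)" using Arg2pi_eq[of u] u by (simp add: cis_conv_exp)
      then show ?thesis using Arg2pi_ge_0[of u] Arg2pi_lt_2pi[of u] by (intro that[of "Arg2pi u"]) auto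
    qed
    have "(Q (F (cis t)))\<^sup>2 = 0"
      by (rule has_integral_0_cbox_imp_0[OF _ _ hi _ t(1)]) (auto intro!: continuous_intros cQt simp: box_eq_empty not_le)
    then show ?thesis using t by simp
  qed
  show ?thesis using part[of Re] part[of Im] by (simp add: complex_eq_iff)
qed

text \<open>
  The Cauchy-Schwarz inequality for a mean value: expand the variance of \<open>\<bar>h\<bar>\<close>.
\<close>

lemma norm_integral_square_le:
  fixes h :: "real \<Rightarrow> complex"
  assumes "continuous_on {0..p} h" "p > 0"
  shows "(norm (integral {0..p} h / of_real p))\<^sup>2 \<le> integral {0..p} (\<lambda>t. (norm (h t))\<^sup>2) / p"
proof -
  define c where "c = integral {0..p} (\<lambda>t. norm (h t)) / p"
  have int: "h integrable_on {0..p}" "(\<lambda>t. norm (h t)) integrable_on {0..p}"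
    "(\<lambda>t. (norm (h t))\<^sup>2) integrable_on {0..p}"
    by (auto intro!: integrable_continuous_interval continuous_intros assms)
  have "norm (integral {0..p} h) \<le> integral {0..p} (\<lambda>t. norm (h t))"
    by (rule integral_norm_bound_integral) (use int in auto)
  then have 1: "norm (integral {0..p} h / of_real p) \<le> c"
    using assms by (simp add: c_def norm_divide divide_right_mono)
  have "0 \<le> integral {0..p} (\<lambda>t. (norm (h t) - c)\<^sup>2)"
    by (rule integral_nonneg) (auto intro!: integrable_continuous_interval continuous_intros assms)
  also have "(\<lambda>t. (norm (h t) - c)\<^sup>2) = (\<lambda>t. (norm (h t))\<^sup>2 - 2 * c * norm (h t) + c\<^sup>2)"
    by (simp add: power2_diff algebra_simps)
  also have "integral {0..p} \<dots> = integral {0..p} (\<lambda>t. (norm (h t))\<^sup>2) - 2 * c * (c * p) + p * c\<^sup>2"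
  proof -
    have "((\<lambda>t. (norm (h t))\<^sup>2 - 2 * c * norm (h t) + c\<^sup>2) has_integral
       (integral {0..p} (\<lambda>t. (norm (h t))\<^sup>2) - 2 * c * integral {0..p} (\<lambda>t. norm (h t)) + (p - 0) *\<^sub>R c\<^sup>2)) {0..p}"
      using assms(2) int has_integral_const_real[of "c\<^sup>2" 0 p]
      by (intro has_integral_add has_integral_diff has_integral_mult_right integrable_integral) auto
    moreover have "integral {0..p} (\<lambda>t. norm (h t)) = c * p" using assms by (simp add: c_def)
    ultimately show ?thesis by (simp add: integral_unique)
  qed
  finally have "c\<^sup>2 * p \<le> integral {0..p} (\<lambda>t. (norm (h t))\<^sup>2)"
    by (simp add: power2_eq_square algebra_simps)
  then have "c\<^sup>2 \<le> integral {0..p} (\<lambda>t. (norm (h t))\<^sup>2) / p"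
    using assms by (simp add: field_simps)
  moreover have "(norm (integral {0..p} h / of_real p))\<^sup>2 \<le> c\<^sup>2"
    using 1 by (intro power_mono) auto
  ultimately show ?thesis by linarith
qed

section \<open>Rotation of one coordinate\<close>

lemma emeasure_lborel_vec_box:
  fixes S :: "'n::finite \<Rightarrow> complex set"
  assumes S: "\<And>j. S j \<in> sets borel"
  shows "emeasure lborel {z :: complex ^ 'n. \<forall>j. z $ j \<in> S j} = (\<Prod>j\<in>UNIV. emeasure lborel (S j))"
proof -
  interpret P: product_sigma_finite "\<lambda>_ :: 'n. lborel :: complex measure"
    by standard
  note [measurable] = S
  have meas: "(\<lambda>f. \<chi> j. f j) \<in> measurable (PiM UNIV (\<lambda>_ :: 'n. lborel :: complex measure)) borel"
    by (rule borel_measurable_euclidean_space[THEN iffD2]) (auto simp: Basis_vec_def inner_axis)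
  have "{z :: complex ^ 'n \<in> space borel. \<forall>j\<in>UNIV. z $ j \<in> S j} \<in> sets borel"
    by (intro sets.sets_Collect_finite_All) auto
  then have sets: "{z :: complex ^ 'n. \<forall>j. z $ j \<in> S j} \<in> sets borel" by simp
  have "(\<lambda>f. \<chi> j. f j) -` {z :: complex ^ 'n. \<forall>j. z $ j \<in> S j} \<inter> space (PiM UNIV (\<lambda>_ :: 'n. lborel :: complex measure))
      = (\<Pi>\<^sub>E j\<in>UNIV. S j)"
    by (auto simp: space_PiM PiE_def)
  then show ?thesis
    by (subst lborel_vec_eq, subst emeasure_distr[OF meas sets]) (simp add: P.emeasure_PiM)
qed

text \<open>
  Rotation invariance of Lebesgue measure on the plane is carried over from the invariance under orthogonal
  maps of \<open>real ^ 2\<close>.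
\<close>

definition complex_of_vec :: "real ^ 2 \<Rightarrow> complex" where
  "complex_of_vec v = Complex (v $ 1) (v $ 2)"

definition vec_of_complex :: "complex \<Rightarrow> real ^ 2" where
  "vec_of_complex z = (\<chi> i. if i = 1 then Re z else Im z)"

lemma vec_of_complex_inverse [simp]: "complex_of_vec (vec_of_complex z) = z"
  by (simp add: complex_of_vec_def vec_of_complex_def)

lemma complex_of_vec_inverse [simp]: "vec_of_complex (complex_of_vec v) = v"
  by (simp add: complex_of_vec_def vec_of_complex_def vec_eq_iff forall_2)

lemma linear_complex_of_vec: "linear complex_of_vec"
  by (rule linearI) (auto simp: complex_of_vec_def complex_eq_iff)

lemma linear_vec_of_complex: "linear vec_of_complex"
  by (rule linearI) (auto simp: vec_of_complex_def vec_eq_iff)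

lemma norm_complex_of_vec [simp]: "norm (complex_of_vec v) = norm v"
  by (simp add: complex_of_vec_def norm_vec_def L2_set_def sum_2 cmod_def)

lemma norm_vec_of_complex [simp]: "norm (vec_of_complex z) = norm z"
  using norm_complex_of_vec[of "vec_of_complex z"] by simp

lemma distr_complex_of_vec: "distr lborel borel complex_of_vec = (lborel :: complex measure)"
proof (rule lborel_eqI[symmetric])
  fix l u :: complex
  assume le: "\<And>b. b \<in> Basis \<Longrightarrow> l \<bullet> b \<le> u \<bullet> b"
  have meas: "complex_of_vec \<in> measurable lborel borel"
    by (simp add: borel_measurable_continuous_onI linear_continuous_on linear_conv_bounded_linear[symmetric] linear_complex_of_vec)
  have "complex_of_vec -` box l u \<inter> space lborel = box (vec_of_complex l) (vec_of_complex u)"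
    by (auto simp: in_box_complex_iff mem_box_cart complex_of_vec_def vec_of_complex_def forall_2)
  then have "emeasure (distr lborel borel complex_of_vec) (box l u) = emeasure lborel (box (vec_of_complex l) (vec_of_complex u))"
    by (subst emeasure_distr[OF meas]) auto
  also have "\<dots> = ennreal (\<Prod>b\<in>Basis. (vec_of_complex u - vec_of_complex l) \<bullet> b)"
    using le[of 1] le[of \<i>]
    by (intro emeasure_lborel_box) (auto simp: vec_of_complex_def Basis_vec_def inner_axis Basis_complex_def)
  also have "(\<Prod>b\<in>Basis. (vec_of_complex u - vec_of_complex l) \<bullet> b) = (\<Prod>b\<in>Basis. (u - l) \<bullet> b)"
  proof -
    have B: "(Basis :: (real ^ 2) set) = {axis 1 1, axis 2 1}"
      by (auto simp: Basis_vec_def UNIV_2)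
    moreover have "axis 1 1 \<noteq> (axis 2 1 :: real ^ 2)" by (simp add: axis_eq_axis)
    ultimately show ?thesis
      unfolding B by (simp add: Basis_complex_def inner_axis vec_of_complex_def)
  qed
  finally show "emeasure (distr lborel borel complex_of_vec) (box l u) = ennreal (\<Prod>b\<in>Basis. (u - l) \<bullet> b)" .
qed simp

lemma emeasure_lborel_complex_rotate:
  fixes l u :: complex
  shows "emeasure lborel {z. cis \<phi> * z \<in> box l u} = emeasure lborel (box l u)"
proof -
  define f where "f v = vec_of_complex (cis (- \<phi>) * complex_of_vec v)" for v
  define B where "B = complex_of_vec -` box l u"
  have cont: "continuous_on UNIV complex_of_vec"
    by (simp add: linear_continuous_on linear_conv_bounded_linear[symmetric] linear_complex_of_vec)
  then have meas: "complex_of_vec \<in> measurable lborel borel"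
    by (simp add: borel_measurable_continuous_onI)
  have f: "orthogonal_transformation f"
    unfolding orthogonal_transformation
    by (auto simp: f_def norm_mult intro!: linearI simp: linear_add[OF linear_vec_of_complex]
        linear_add[OF linear_complex_of_vec] linear_scale[OF linear_vec_of_complex]
        linear_scale[OF linear_complex_of_vec] distrib_left)
  have opB: "open B" unfolding B_def using open_vimage[OF open_box cont] .
  have "bounded B"
  proof -
    obtain c where "\<And>z. z \<in> box l u \<Longrightarrow> norm z \<le> c" using bounded_box[of l u] by (auto simp: bounded_iff)
    then show ?thesis unfolding B_def bounded_iff by (intro exI[of _ c]) (metis norm_complex_of_vec vimage_eq)
  qed
  with opB have B: "B \<in> lmeasurable" by (simp add: lmeasurable_open)
  have fB: "f ` B = complex_of_vec -` {z. cis \<phi> * z \<in> box l u}"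
  proof (intro set_eqI iffI)
    fix v assume "v \<in> f ` B"
    then show "v \<in> complex_of_vec -` {z. cis \<phi> * z \<in> box l u}"
      by (auto simp: f_def B_def cis_mult simp flip: mult.assoc)
  next
    fix v assume v: "v \<in> complex_of_vec -` {z. cis \<phi> * z \<in> box l u}"
    have "v = f (vec_of_complex (cis \<phi> * complex_of_vec v))"
      by (simp add: f_def cis_mult flip: mult.assoc)
    moreover have "vec_of_complex (cis \<phi> * complex_of_vec v) \<in> B" using v by (simp add: B_def)
    ultimately show "v \<in> f ` B" by blast
  qed
  have opR: "open {z. cis \<phi> * z \<in> box l u}"
    using open_vimage[OF open_box, of "\<lambda>z. cis \<phi> * z" l u]
    by (simp add: vimage_def continuous_intros)
  have opfB: "open (f ` B)" unfolding fB
    using open_vimage[OF opR cont] .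
  have "emeasure lborel (f ` B) = emeasure lborel B"
  proof -
    have "emeasure lebesgue (f ` B) = emeasure lebesgue B"
      using measure_orthogonal_image[OF f B] measurable_orthogonal_image[OF f B] B
      by (simp add: emeasure_eq_measure2)
    then show ?thesis using opB opfB by (simp add: emeasure_completion)
  qed
  moreover have "emeasure lborel (complex_of_vec -` S) = emeasure lborel S" if "open S" for S
    using that emeasure_distr[OF meas, of S] by (simp add: distr_complex_of_vec)
  ultimately show ?thesis
    using opR open_box[of l u] unfolding fB unfolding B_def by metis
qed

definition upd_coord :: "complex ^ 'n \<Rightarrow> 'n::finite \<Rightarrow> complex \<Rightarrow> complex ^ 'n" where
  "upd_coord z j w = (\<chi> i. if i = j then w else z $ i)"

definition rotate_coord :: "'n::finite \<Rightarrow> real \<Rightarrow> complex ^ 'n \<Rightarrow> complex ^ 'n" where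
  "rotate_coord j \<phi> z = upd_coord z j (cis \<phi> * z $ j)"

lemma upd_coord_nth: "upd_coord z j w $ i = (if i = j then w else z $ i)"
  by (simp add: upd_coord_def)

lemma upd_coord_same [simp]: "upd_coord z j (z $ j) = z"
  by (simp add: vec_eq_iff upd_coord_nth)

lemma upd_coord_upd_coord [simp]: "upd_coord (upd_coord z j v) j w = upd_coord z j w"
  by (simp add: vec_eq_iff upd_coord_nth)

lemma rotate_coord_nth: "rotate_coord j \<phi> z $ i = (if i = j then cis \<phi> * z $ i else z $ i)"
  by (simp add: rotate_coord_def upd_coord_nth)

lemma rotate_coord_add: "rotate_coord j \<phi> (rotate_coord j \<psi> z) = rotate_coord j (\<phi> + \<psi>) z"
  by (simp add: vec_eq_iff rotate_coord_nth cis_mult flip: mult.assoc)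

lemma rotate_coord_commute:
  "i \<noteq> j \<Longrightarrow> rotate_coord i \<phi> (rotate_coord j \<psi> z) = rotate_coord j \<psi> (rotate_coord i \<phi> z)"
  by (auto simp: vec_eq_iff rotate_coord_nth)

lemma rotate_coord_0 [simp]: "rotate_coord j 0 z = z"
  by (simp add: vec_eq_iff rotate_coord_nth)

lemma rotate_coord_period: "rotate_coord j (\<phi> + 2 * pi) z = rotate_coord j \<phi> z"
proof -
  have "cis (\<phi> + 2 * pi) = cis \<phi>" by (simp add: cis_mult[symmetric] flip: cis_mult)
  then show ?thesis by (simp add: rotate_coord_def)
qed

lemma continuous_on_upd_coord [continuous_intros]:
  assumes "continuous_on S f" "continuous_on S g"
  shows "continuous_on S (\<lambda>x. upd_coord (f x) j (g x))"
  unfolding upd_coord_def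
proof (rule continuous_on_vec_lambda)
  fix i show "continuous_on S (\<lambda>x. if i = j then g x else f x $ i)"
    using assms by (cases "i = j") (auto intro!: continuous_intros)
qed

lemma continuous_on_rotate_coord [continuous_intros]:
  assumes "continuous_on S f" "continuous_on S g"
  shows "continuous_on S (\<lambda>x. rotate_coord j (f x) (g x))"
  unfolding rotate_coord_def by (intro continuous_intros assms)

lemma distr_rotate_coord: "distr lborel borel (rotate_coord (j :: 'n::finite) \<phi>) = lborel"
proof (rule lborel_eqI[symmetric])
  fix l u :: "complex ^ 'n"
  assume le: "\<And>b. b \<in> Basis \<Longrightarrow> l \<bullet> b \<le> u \<bullet> b"
  have meas: "rotate_coord j \<phi> \<in> measurable lborel borel"
    by (simp add: borel_measurable_continuous_onI continuous_intros)
  have box: "z \<in> box l u \<longleftrightarrow> (\<forall>i. z $ i \<in> box (l $ i) (u $ i))" for z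
    by (auto simp: mem_box Basis_vec_def inner_axis)
  define S where "S i = (if i = j then {w. cis \<phi> * w \<in> box (l $ i) (u $ i)} else box (l $ i) (u $ i))" for i
  have opS: "open (S i)" for i
    using open_vimage[OF open_box, of "\<lambda>z. cis \<phi> * z" "l $ i" "u $ i"]
    by (cases "i = j") (auto simp: S_def vimage_def continuous_intros open_box)
  have "emeasure (distr lborel borel (rotate_coord j \<phi>)) (box l u)
      = emeasure lborel {z. \<forall>i. z $ i \<in> S i}"
    by (subst emeasure_distr[OF meas]) (auto simp: box S_def rotate_coord_nth vimage_def intro!: arg_cong[of _ _ "emeasure lborel"] split: if_splits)
  also have "\<dots> = (\<Prod>i\<in>UNIV. emeasure lborel (S i))"
    using opS by (intro emeasure_lborel_vec_box) auto
  also have "\<dots> = (\<Prod>i\<in>UNIV. emeasure lborel (box (l $ i) (u $ i)))"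
    by (intro prod.cong) (auto simp: S_def emeasure_lborel_complex_rotate)
  also have "\<dots> = emeasure lborel {z. \<forall>i. z $ i \<in> box (l $ i) (u $ i)}"
    by (intro emeasure_lborel_vec_box[symmetric]) auto
  also have "{z. \<forall>i. z $ i \<in> box (l $ i) (u $ i)} = box l u" using box by auto
  also have "emeasure lborel (box l u) = ennreal (\<Prod>b\<in>Basis. (u - l) \<bullet> b)"
    using le by (intro emeasure_lborel_box) auto
  finally show "emeasure (distr lborel borel (rotate_coord j \<phi>)) (box l u) = ennreal (\<Prod>b\<in>Basis. (u - l) \<bullet> b)" .
qed simp

lemma nn_integral_rotate_coord:
  assumes "g \<in> borel_measurable borel"
  shows "(\<integral>\<^sup>+z. g (rotate_coord j \<phi> z) \<partial>lborel) = (\<integral>\<^sup>+z. g z \<partial>lborel)"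
proof -
  have "rotate_coord j \<phi> \<in> measurable lborel borel"
    by (simp add: borel_measurable_continuous_onI continuous_intros)
  from nn_integral_distr[OF this, of g] assms show ?thesis by (simp add: distr_rotate_coord)
qed

section \<open>Fourier coefficients along the coordinate circles\<close>

definition rotation_closed :: "(complex ^ 'n::finite) set \<Rightarrow> bool" where
  "rotation_closed \<Omega> \<longleftrightarrow> (\<forall>z\<in>\<Omega>. \<forall>j \<phi>. rotate_coord j \<phi> z \<in> \<Omega>)"

text \<open>
  Averaging over rotations preserves this class by one-variable arguments. For the Frechet derivative in
  \<open>holomorphic_cn\<close> one would first have to know that it depends continuously on the point.
\<close>

definition separately_holomorphic :: "(complex ^ 'n::finite) set \<Rightarrow> (complex ^ 'n \<Rightarrow> complex) \<Rightarrow> bool" where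
  "separately_holomorphic \<Omega> f \<longleftrightarrow> continuous_on \<Omega> f \<and>
     (\<forall>z\<in>\<Omega>. \<forall>j. (\<lambda>w. f (upd_coord z j w)) field_differentiable at (z $ j))"

text \<open>
  The \<open>k\<close>-th Fourier coefficient of \<open>f\<close> along the circle through \<open>z\<close> in the \<open>j\<close>-th coordinate. As an operator
  on functions it is the projection to the functions of weight \<open>k\<close> in that coordinate.
\<close>

definition coord_coeff :: "'n::finite \<Rightarrow> int \<Rightarrow> (complex ^ 'n \<Rightarrow> complex) \<Rightarrow> complex ^ 'n \<Rightarrow> complex" where
  "coord_coeff j k f z = circle_coeff (\<lambda>u. f (upd_coord z j (u * z $ j))) k / of_real (2 * pi)"

definition weight_on :: "(complex ^ 'n::finite) set \<Rightarrow> 'n \<Rightarrow> int \<Rightarrow> (complex ^ 'n \<Rightarrow> complex) \<Rightarrow> bool" where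
  "weight_on \<Omega> j k f \<longleftrightarrow> (\<forall>z\<in>\<Omega>. \<forall>\<phi>. f (rotate_coord j \<phi> z) = cis (of_int k * \<phi>) * f z)"

lemma coord_coeff_integral:
  "coord_coeff j k f z =
     integral (cbox 0 (2 * pi)) (\<lambda>t. f (rotate_coord j t z) * cis (- (of_int k * t))) / of_real (2 * pi)"
  by (simp add: coord_coeff_def circle_coeff_def rotate_coord_def)

lemma coord_coeff_cong:
  assumes "rotation_closed \<Omega>" "z \<in> \<Omega>" "\<And>z. z \<in> \<Omega> \<Longrightarrow> f z = g z"
  shows "coord_coeff j k f z = coord_coeff j k g z"
  using assms by (simp add: coord_coeff_integral rotation_closed_def)

lemma continuous_on_circle_slice:
  assumes "rotation_closed \<Omega>" "continuous_on \<Omega> f" "z \<in> \<Omega>"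
  shows "continuous_on (sphere 0 1) (\<lambda>u. f (upd_coord z j (u * z $ j)))"
proof (rule continuous_on_compose2[OF assms(2)])
  show "(\<lambda>u. upd_coord z j (u * z $ j)) ` sphere 0 1 \<subseteq> \<Omega>"
  proof safe
    fix u :: complex assume "u \<in> sphere 0 1"
    then have "u = cis (Arg2pi u)" using Arg2pi_eq[of u] by (simp add: cis_conv_exp)
    moreover have "rotate_coord j (Arg2pi u) z \<in> \<Omega>" using assms by (simp add: rotation_closed_def)
    ultimately show "upd_coord z j (u * z $ j) \<in> \<Omega>" by (simp add: rotate_coord_def)
  qed
qed (intro continuous_intros)

lemma coord_coeff_add:
  assumes "rotation_closed \<Omega>" "continuous_on \<Omega> f" "continuous_on \<Omega> g" "z \<in> \<Omega>"
  shows "coord_coeff j k (\<lambda>z. f z + g z) z = coord_coeff j k f z + coord_coeff j k g z"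
  using assms by (simp add: coord_coeff_def circle_coeff_add continuous_on_circle_slice add_divide_distrib)

lemma coord_coeff_cmult: "coord_coeff j k (\<lambda>z. c * f z) z = c * coord_coeff j k f z"
  by (simp add: coord_coeff_def circle_coeff_cmult)

lemma coord_coeff_unique:
  assumes "rotation_closed \<Omega>" "continuous_on \<Omega> f" "z \<in> \<Omega>" "\<And>k. coord_coeff j k f z = 0"
  shows "f z = 0"
  using circle_coeff_unique[OF continuous_on_circle_slice[OF assms(1-3), of j], of 1] assms(4)
  by (simp add: coord_coeff_def)

lemma continuous_on_rotate_param:
  assumes "rotation_closed \<Omega>" "continuous_on \<Omega> f"
  shows "continuous_on (\<Omega> \<times> T) (\<lambda>(z, t). f (rotate_coord j t z) * cis (- (of_int k * t)))"
proof -
  have "continuous_on (\<Omega> \<times> T) (\<lambda>x. f (rotate_coord j (snd x) (fst x)))"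
    by (rule continuous_on_compose2[OF assms(2)])
       (use assms(1) in \<open>auto simp: rotation_closed_def intro!: continuous_intros\<close>)
  then show ?thesis unfolding case_prod_beta by (intro continuous_intros)
qed

lemma continuous_on_coord_coeff:
  assumes "rotation_closed \<Omega>" "continuous_on \<Omega> f"
  shows "continuous_on \<Omega> (coord_coeff j k f)"
  unfolding coord_coeff_integral[abs_def]
  by (intro continuous_intros integral_continuous_on_param continuous_on_rotate_param assms) auto

lemma separately_holomorphic_slice:
  assumes "open \<Omega>" "separately_holomorphic \<Omega> f" "open U" "\<And>w. w \<in> U \<Longrightarrow> upd_coord z j w \<in> \<Omega>"
  shows "(\<lambda>w. f (upd_coord z j w)) holomorphic_on U"
  unfolding holomorphic_on_open[OF assms(3)]
proof
  fix w assume "w \<in> U"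
  then have "(\<lambda>v. f (upd_coord (upd_coord z j w) j v)) field_differentiable at (upd_coord z j w $ j)"
    using assms(2) assms(4)[of w] unfolding separately_holomorphic_def by blast
  then show "\<exists>f'. ((\<lambda>w. f (upd_coord z j w)) has_field_derivative f') (at w)"
    by (simp add: field_differentiable_def upd_coord_nth)
qed

lemma ex_ball_slice:
  assumes "open \<Omega>" "z \<in> \<Omega>"
  obtains r where "r > 0" "\<And>w. w \<in> cball (z $ j) r \<Longrightarrow> upd_coord z j w \<in> \<Omega>"
proof -
  have "open ((\<lambda>w. upd_coord z j w) -` \<Omega>)"
    by (rule open_vimage[OF assms(1)]) (intro continuous_intros)
  moreover have "z $ j \<in> (\<lambda>w. upd_coord z j w) -` \<Omega>" using assms by simp
  ultimately obtain r where "r > 0" "cball (z $ j) r \<subseteq> (\<lambda>w. upd_coord z j w) -` \<Omega>"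
    by (meson open_contains_cball)
  then show ?thesis by (intro that[of r]) auto
qed

text \<open>
  Rotating the \<open>j\<close>-th coordinate maps slices to slices, also when the slice is in the \<open>j\<close>-th
  direction, so the integrand is holomorphic along every slice.
\<close>

lemma separately_holomorphic_coord_coeff:
  assumes op: "open \<Omega>" and rot: "rotation_closed \<Omega>" and f: "separately_holomorphic \<Omega> f"
  shows "separately_holomorphic \<Omega> (coord_coeff j k f)"
  unfolding separately_holomorphic_def
proof (intro conjI ballI allI)
  show "continuous_on \<Omega> (coord_coeff j k f)"
    using f by (intro continuous_on_coord_coeff rot) (simp add: separately_holomorphic_def)
next
  fix z i assume z: "z \<in> \<Omega>"
  obtain r where r: "r > 0" "\<And>w. w \<in> cball (z $ i) r \<Longrightarrow> upd_coord z i w \<in> \<Omega>"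
    using ex_ball_slice[OF op z] by blast
  define \<Phi> where "\<Phi> w t = f (rotate_coord j t (upd_coord z i w)) * cis (- (of_int k * t))" for w t
  have contf: "continuous_on \<Omega> f" using f by (simp add: separately_holomorphic_def)
  have cont: "continuous_on (cball (z $ i) r \<times> cbox 0 (2 * pi)) (\<lambda>(w, t). \<Phi> w t)"
  proof -
    have "continuous_on (cball (z $ i) r \<times> cbox 0 (2 * pi))
       (\<lambda>x. (\<lambda>(z, t). f (rotate_coord j t z) * cis (- (of_int k * t))) (upd_coord z i (fst x), snd x))"
      by (rule continuous_on_compose2[OF continuous_on_rotate_param[OF rot contf, of UNIV]])
         (use r(2) in \<open>auto intro!: continuous_intros\<close>)
    then show ?thesis by (simp add: \<Phi>_def case_prod_beta)
  qed
  have hol: "(\<lambda>w. \<Phi> w t) holomorphic_on ball (z $ i) r" for t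
  proof (cases "i = j")
    case True
    have "(\<lambda>w. f (upd_coord z j w)) holomorphic_on (\<lambda>w. cis t * w) ` ball (z $ i) r"
    proof (rule separately_holomorphic_slice[OF op f])
      have "open ((\<lambda>w. inverse (cis t) * w) -` ball (z $ i) r)"
        by (intro open_vimage continuous_intros) auto
      moreover have "(\<lambda>w. inverse (cis t) * w) -` ball (z $ i) r = (\<lambda>w. cis t * w) ` ball (z $ i) r"
      proof (intro set_eqI iffI)
        fix w assume "w \<in> (\<lambda>w. inverse (cis t) * w) -` ball (z $ i) r"
        moreover have "w = cis t * (inverse (cis t) * w)" by (simp add: cis_mult flip: mult.assoc)
        ultimately show "w \<in> (\<lambda>w. cis t * w) ` ball (z $ i) r" by blast
      qed (auto simp: cis_mult simp flip: mult.assoc)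
      ultimately show "open ((\<lambda>w. cis t * w) ` ball (z $ i) r)" by simp
      fix w assume "w \<in> (\<lambda>w. cis t * w) ` ball (z $ i) r"
      then obtain v where v: "v \<in> ball (z $ i) r" "w = cis t * v" by blast
      then have "rotate_coord j t (upd_coord z j v) \<in> \<Omega>"
        using r(2)[of v] rot True by (auto simp: rotation_closed_def)
      then show "upd_coord z j w \<in> \<Omega>" by (simp add: rotate_coord_def upd_coord_nth v)
    qed
    then have "(\<lambda>w. f (upd_coord z j w)) \<circ> (\<lambda>w. cis t * w) holomorphic_on ball (z $ i) r"
      by (intro holomorphic_on_compose holomorphic_intros)
    then show ?thesis
      unfolding \<Phi>_def by (intro holomorphic_intros) (simp add: True rotate_coord_def upd_coord_nth o_def)
  next
    case False
    have eq: "rotate_coord j t (upd_coord z i w) = upd_coord (rotate_coord j t z) i w" for w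
      using False by (auto simp: vec_eq_iff rotate_coord_nth upd_coord_nth)
    have "(\<lambda>w. f (upd_coord (rotate_coord j t z) i w)) holomorphic_on ball (z $ i) r"
      using r(2) rot
      by (intro separately_holomorphic_slice[OF op f]) (auto simp: rotation_closed_def simp flip: eq)
    then show ?thesis unfolding \<Phi>_def eq by (intro holomorphic_intros)
  qed
  have "(\<lambda>w. integral (cbox 0 (2 * pi)) (\<Phi> w)) holomorphic_on ball (z $ i) r"
    using r(1) cont hol by (rule holomorphic_integral_param)
  then have "(\<lambda>w. coord_coeff j k f (upd_coord z i w)) holomorphic_on ball (z $ i) r"
    unfolding coord_coeff_integral \<Phi>_def by (intro holomorphic_intros) auto
  then show "(\<lambda>w. coord_coeff j k f (upd_coord z i w)) field_differentiable at (z $ i)"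
    using r(1) by (simp add: holomorphic_on_imp_differentiable_at)
qed

lemma weight_on_coord_coeff:
  assumes rot: "rotation_closed \<Omega>" and cont: "continuous_on \<Omega> f"
  shows "weight_on \<Omega> j k (coord_coeff j k f)"
  unfolding weight_on_def
proof (intro ballI allI)
  fix z \<phi> assume z: "z \<in> \<Omega>"
  have per: "cis (of_int n * (t + 2 * pi * of_int p)) = cis (of_int n * t)" for n p t
    using cis_multiple_2pi[of "of_int (n * p)"] by (simp add: distrib_left mult_ac flip: cis_mult)
  define h where "h t = f (rotate_coord j t z) * cis (- (of_int k * t))" for t
  have conth: "continuous_on UNIV h"
  proof -
    have "continuous_on UNIV (\<lambda>t. (\<lambda>(z, t). f (rotate_coord j t z) * cis (- (of_int k * t))) (z, t))"
      by (rule continuous_on_compose2[OF continuous_on_rotate_param[OF rot cont, of UNIV]])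
         (use z in \<open>auto intro!: continuous_intros\<close>)
    then show ?thesis by (simp add: h_def[abs_def])
  qed
  have hper: "h (t + 2 * pi) = h t" for t
    using per[of "- k" t 1] by (simp add: h_def rotate_coord_period)
  have main: "coord_coeff j k f (rotate_coord j c z) = cis (of_int k * c) * coord_coeff j k f z"
    if c: "0 \<le> c" "c \<le> 2 * pi" for c
  proof -
    have "f (rotate_coord j t (rotate_coord j c z)) * cis (- (of_int k * t)) = cis (of_int k * c) * h (t + c)" for t
      by (simp add: h_def rotate_coord_add cis_mult algebra_simps)
    then have "coord_coeff j k f (rotate_coord j c z) = cis (of_int k * c) * integral {0..2 * pi} (\<lambda>t. h (t + c)) / of_real (2 * pi)"
      by (simp add: coord_coeff_integral)
    also have "integral {0..2 * pi} (\<lambda>t. h (t + c)) = integral {0..2 * pi} h"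
      by (rule integral_periodic[OF conth hper c])
    finally show ?thesis by (simp add: coord_coeff_integral h_def[abs_def])
  qed
  define p where "p = \<lfloor>\<phi> / (2 * pi)\<rfloor>"
  define c where "c = \<phi> - 2 * pi * of_int p"
  have "of_int p \<le> \<phi> / (2 * pi)" "\<phi> / (2 * pi) < of_int p + 1" unfolding p_def by linarith+
  then have c: "0 \<le> c" "c \<le> 2 * pi" by (auto simp: c_def field_simps)
  have \<phi>: "\<phi> = c + 2 * pi * of_int p" by (simp add: c_def)
  have "cis \<phi> = cis c" using per[of 1 c p] by (simp add: \<phi>)
  then have "rotate_coord j \<phi> z = rotate_coord j c z" by (simp add: rotate_coord_def)
  moreover have "cis (of_int k * \<phi>) = cis (of_int k * c)" using per[of k c p] by (simp add: \<phi>)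
  ultimately show "coord_coeff j k f (rotate_coord j \<phi> z) = cis (of_int k * \<phi>) * coord_coeff j k f z"
    using main[OF c] by simp
qed

lemma weight_on_coord_coeff_other:
  assumes rot: "rotation_closed \<Omega>" and f: "weight_on \<Omega> i l f" and ij: "i \<noteq> j"
  shows "weight_on \<Omega> i l (coord_coeff j k f)"
  unfolding weight_on_def
proof (intro ballI allI)
  fix z \<phi> assume z: "z \<in> \<Omega>"
  have "f (rotate_coord j t (rotate_coord i \<phi> z)) = cis (of_int l * \<phi>) * f (rotate_coord j t z)" for t
    using f rot z ij by (subst rotate_coord_commute) (auto simp: weight_on_def rotation_closed_def)
  then show "coord_coeff j k f (rotate_coord i \<phi> z) = cis (of_int l * \<phi>) * coord_coeff j k f z"
    by (simp add: coord_coeff_integral mult.assoc)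
qed

lemma integral_cis_int:
  assumes "n \<noteq> 0"
  shows "integral {0..2 * pi} (\<lambda>t. cis (of_int n * t)) = 0"
proof -
  have "((\<lambda>t. cis (of_int n * t)) has_integral
      (cis (of_int n * (2 * pi)) / (\<i> * of_int n) - cis (of_int n * 0) / (\<i> * of_int n))) {0..2 * pi}"
  proof (rule fundamental_theorem_of_calculus)
    fix t :: real
    have "((\<lambda>w. exp (\<i> * of_int n * w) / (\<i> * of_int n)) has_field_derivative
        exp (\<i> * of_int n * of_real t)) (at (of_real t))"
      using assms by (auto intro!: derivative_eq_intros)
    from has_vector_derivative_real_field[OF this, of "{0..2 * pi}"]
    show "((\<lambda>t. cis (of_int n * t) / (\<i> * of_int n)) has_vector_derivative cis (of_int n * t))
        (at t within {0..2 * pi})" by (simp add: cis_conv_exp mult.assoc)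
  qed simp
  moreover have "cis (of_int n * (2 * pi)) = 1"
    using cis_multiple_2pi[of "of_int n"] by (simp add: mult.commute)
  ultimately show ?thesis by (simp add: integral_unique)
qed

lemma coord_coeff_weight:
  assumes "weight_on \<Omega> j l f" "z \<in> \<Omega>"
  shows "coord_coeff j k f z = (if k = l then f z else 0)"
proof -
  have "f (rotate_coord j t z) * cis (- (of_int k * t)) = f z * cis (of_int (l - k) * t)" for t
    using assms by (simp add: weight_on_def cis_mult algebra_simps)
  then have "coord_coeff j k f z = f z * integral {0..2 * pi} (\<lambda>t. cis (of_int (l - k) * t)) / of_real (2 * pi)"
    by (simp add: coord_coeff_integral)
  then show ?thesis
    using integral_cis_int[of "l - k"] by (auto simp: scaleR_conv_of_real)
qed

definition square_nn_integral :: "(complex ^ 'n::finite) set \<Rightarrow> (complex ^ 'n \<Rightarrow> complex) \<Rightarrow> ennreal" where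
  "square_nn_integral \<Omega> f = (\<integral>\<^sup>+z. ennreal ((cmod (f z))\<^sup>2) * indicator \<Omega> z \<partial>lborel)"

text \<open>
  Projections contract the norm: apply Cauchy-Schwarz on each circle, exchange the integrals, and use
  that rotations preserve Lebesgue measure.
\<close>

lemma square_nn_integral_coord_coeff:
  fixes f :: "complex ^ 'n::finite \<Rightarrow> complex"
  assumes op: "open \<Omega>" and rot: "rotation_closed \<Omega>" and cont: "continuous_on \<Omega> f"
  shows "square_nn_integral \<Omega> (coord_coeff j k f) \<le> square_nn_integral \<Omega> f"
proof -
  define q where "q z = ennreal ((cmod (f z))\<^sup>2) * indicator \<Omega> z" for z
  have q_eq: "q = (\<lambda>z. ennreal (indicator \<Omega> z *\<^sub>R (cmod (f z))\<^sup>2))"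
    by (auto simp: q_def indicator_def fun_eq_iff)
  have qm [measurable]: "q \<in> borel_measurable borel"
    unfolding q_eq using op cont
    by (intro measurable_compose[OF borel_measurable_continuous_on_indicator measurable_ennreal])
       (auto intro!: continuous_intros)
  have rm [measurable]: "(\<lambda>x. rotate_coord j (snd x) (fst x)) \<in> measurable (lborel \<Otimes>\<^sub>M lborel) (borel :: (complex ^ 'n) measure)"
  proof -
    have "(\<lambda>x. rotate_coord j (snd x) (fst x)) \<in> measurable (borel :: ((complex ^ 'n) \<times> real) measure) (borel :: (complex ^ 'n) measure)"
      by (intro borel_measurable_continuous_onI continuous_intros)
    then show ?thesis by (simp add: borel_prod[symmetric] cong: measurable_cong_sets)
  qed
  have pt: "ennreal ((cmod (coord_coeff j k f z))\<^sup>2) * indicator \<Omega> z \<le>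
      ennreal (1 / (2 * pi)) * (\<integral>\<^sup>+t. q (rotate_coord j t z) * indicator {0..2 * pi} t \<partial>lborel)" for z
  proof (cases "z \<in> \<Omega>")
    case z: True
    have contt: "continuous_on {0..2 * pi} (\<lambda>t. f (rotate_coord j t z))"
      by (rule continuous_on_compose2[OF cont])
         (use rot z in \<open>auto simp: rotation_closed_def intro!: continuous_intros\<close>)
    have "(cmod (coord_coeff j k f z))\<^sup>2 \<le>
        integral {0..2 * pi} (\<lambda>t. (cmod (f (rotate_coord j t z) * cis (- (of_int k * t))))\<^sup>2) / (2 * pi)"
      unfolding coord_coeff_integral cbox_interval
      by (rule norm_integral_square_le) (auto intro!: continuous_intros contt)
    also have "\<dots> = 1 / (2 * pi) * integral {0..2 * pi} (\<lambda>t. (cmod (f (rotate_coord j t z)))\<^sup>2)"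
      by (simp add: norm_mult)
    finally have le: "(cmod (coord_coeff j k f z))\<^sup>2 \<le> \<dots>" .
    have si: "set_integrable lborel {0..2 * pi} (\<lambda>t. (cmod (f (rotate_coord j t z)))\<^sup>2)"
      by (intro borel_integrable_atLeastAtMost' continuous_intros contt)
    have "ennreal (integral {0..2 * pi} (\<lambda>t. (cmod (f (rotate_coord j t z)))\<^sup>2)) =
       (\<integral>\<^sup>+t. ennreal (indicator {0..2 * pi} t *\<^sub>R (cmod (f (rotate_coord j t z)))\<^sup>2) \<partial>lborel)"
      using si unfolding set_borel_integral_eq_integral(2)[OF si, symmetric] set_integrable_def set_lebesgue_integral_def
      by (intro nn_integral_eq_integral[symmetric]) auto
    also have "\<dots> = (\<integral>\<^sup>+t. q (rotate_coord j t z) * indicator {0..2 * pi} t \<partial>lborel)"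
      using rot z by (intro nn_integral_cong) (auto simp: q_def indicator_def rotation_closed_def)
    finally have eq: "ennreal (integral {0..2 * pi} (\<lambda>t. (cmod (f (rotate_coord j t z)))\<^sup>2)) = \<dots>" .
    have "ennreal ((cmod (coord_coeff j k f z))\<^sup>2) \<le>
        ennreal (1 / (2 * pi) * integral {0..2 * pi} (\<lambda>t. (cmod (f (rotate_coord j t z)))\<^sup>2))"
      using le by (rule ennreal_leI)
    also have "\<dots> = ennreal (1 / (2 * pi)) * (\<integral>\<^sup>+t. q (rotate_coord j t z) * indicator {0..2 * pi} t \<partial>lborel)"
      by (subst ennreal_mult') (auto simp: eq)
    finally show ?thesis using z by simp
  qed simp
  have "square_nn_integral \<Omega> (coord_coeff j k f) \<le>
      (\<integral>\<^sup>+z. ennreal (1 / (2 * pi)) * (\<integral>\<^sup>+t. q (rotate_coord j t z) * indicator {0..2 * pi} t \<partial>lborel) \<partial>lborel)"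
    unfolding square_nn_integral_def by (intro nn_integral_mono pt)
  also have "\<dots> = ennreal (1 / (2 * pi)) * (\<integral>\<^sup>+z. \<integral>\<^sup>+t. q (rotate_coord j t z) * indicator {0..2 * pi} t \<partial>lborel \<partial>lborel)"
    by (rule nn_integral_cmult) measurable
  also have "(\<integral>\<^sup>+z. \<integral>\<^sup>+t. q (rotate_coord j t z) * indicator {0..2 * pi} t \<partial>lborel \<partial>lborel)
      = (\<integral>\<^sup>+t. \<integral>\<^sup>+z. q (rotate_coord j t z) * indicator {0..2 * pi} t \<partial>lborel \<partial>lborel)"
    by (rule lborel_pair.Fubini'[symmetric]) (simp add: case_prod_beta)
  also have "\<dots> = (\<integral>\<^sup>+t. (\<integral>\<^sup>+z. q z \<partial>lborel) * indicator {0..2 * pi} t \<partial>lborel)"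
  proof (rule nn_integral_cong)
    fix t
    have "(\<lambda>z. q (rotate_coord j t z)) \<in> borel_measurable borel"
      by (rule measurable_compose[OF _ qm]) (intro borel_measurable_continuous_onI continuous_intros)
    then have "(\<integral>\<^sup>+z. q (rotate_coord j t z) * indicator {0..2 * pi} t \<partial>lborel) =
        (\<integral>\<^sup>+z. q (rotate_coord j t z) \<partial>lborel) * indicator {0..2 * pi} t"
      by (intro nn_integral_multc) simp
    then show "(\<integral>\<^sup>+z. q (rotate_coord j t z) * indicator {0..2 * pi} t \<partial>lborel) =
        (\<integral>\<^sup>+z. q z \<partial>lborel) * indicator {0..2 * pi} t"
      by (simp add: nn_integral_rotate_coord[OF qm])
  qed
  also have "\<dots> = (\<integral>\<^sup>+z. q z \<partial>lborel) * ennreal (2 * pi)"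
    by (subst nn_integral_cmult) auto
  also have "ennreal (1 / (2 * pi)) * \<dots> = (\<integral>\<^sup>+z. q z \<partial>lborel)"
  proof -
    have "ennreal (1 / (2 * pi)) * ennreal (2 * pi) = 1"
      by (subst ennreal_mult'[symmetric]) auto
    then show ?thesis by (simp add: mult.left_commute)
  qed
  finally show ?thesis by (simp add: square_nn_integral_def q_def)
qed

section \<open>Bergman spaces of Reinhardt domains\<close>

definition torus_coeff :: "'n::finite list \<Rightarrow> ('n \<Rightarrow> int) \<Rightarrow> (complex ^ 'n \<Rightarrow> complex) \<Rightarrow> complex ^ 'n \<Rightarrow> complex" where
  "torus_coeff js \<alpha> f = foldr (\<lambda>j. coord_coeff j (\<alpha> j)) js f"

lemma torus_coeff_Nil [simp]: "torus_coeff [] \<alpha> f = f"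
  and torus_coeff_Cons [simp]: "torus_coeff (j # js) \<alpha> f = coord_coeff j (\<alpha> j) (torus_coeff js \<alpha> f)"
  by (simp_all add: torus_coeff_def)

lemma continuous_on_torus_coeff:
  "rotation_closed \<Omega> \<Longrightarrow> continuous_on \<Omega> f \<Longrightarrow> continuous_on \<Omega> (torus_coeff js \<alpha> f)"
  by (induction js) (auto intro: continuous_on_coord_coeff)

lemma separately_holomorphic_torus_coeff:
  "open \<Omega> \<Longrightarrow> rotation_closed \<Omega> \<Longrightarrow> separately_holomorphic \<Omega> f \<Longrightarrow>
    separately_holomorphic \<Omega> (torus_coeff js \<alpha> f)"
  by (induction js) (auto intro: separately_holomorphic_coord_coeff)

lemma weight_on_torus_coeff:
  assumes "rotation_closed \<Omega>" "continuous_on \<Omega> f" "distinct js" "j \<in> set js"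
  shows "weight_on \<Omega> j (\<alpha> j) (torus_coeff js \<alpha> f)"
  using assms(3,4)
proof (induction js)
  case (Cons i js)
  show ?case
  proof (cases "j = i")
    case True
    then show ?thesis
      using weight_on_coord_coeff[OF assms(1) continuous_on_torus_coeff[OF assms(1,2)]] by simp
  next
    case False
    then show ?thesis
      using Cons by (simp add: weight_on_coord_coeff_other[OF assms(1)])
  qed
qed simp

lemma square_nn_integral_torus_coeff:
  assumes "open \<Omega>" "rotation_closed \<Omega>" "continuous_on \<Omega> f"
  shows "square_nn_integral \<Omega> (torus_coeff js \<alpha> f) \<le> square_nn_integral \<Omega> f"
proof (induction js)
  case (Cons j js)
  then show ?case
    using order_trans[OF square_nn_integral_coord_coeff[OF assms(1,2) continuous_on_torus_coeff[OF assms(2,3)]]]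
    by simp
qed simp

text \<open>
  If \<open>f\<close> is not zero then some coefficient in one coordinate is not zero, and so on through the list.
\<close>

lemma torus_coeff_unique:
  assumes rot: "rotation_closed \<Omega>" and cont: "continuous_on \<Omega> f" and "distinct js"
    and "\<And>\<alpha> z. z \<in> \<Omega> \<Longrightarrow> torus_coeff js \<alpha> f z = 0" and "z \<in> \<Omega>"
  shows "f z = 0"
  using assms(3-5)
proof (induction js arbitrary: z)
  case Nil
  then show ?case by simp
next
  case (Cons j js)
  have upd: "torus_coeff js (\<alpha>(j := k)) f = torus_coeff js \<alpha> f" for \<alpha> k
  proof -
    have "torus_coeff is (\<alpha>(j := k)) f = torus_coeff is \<alpha> f" if "j \<notin> set is" for "is"
      using that by (induction "is") auto
    then show ?thesis using Cons.prems(1) by simp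
  qed
  show ?case
  proof (rule Cons.IH)
    fix \<alpha> z assume z: "z \<in> \<Omega>"
    show "torus_coeff js \<alpha> f z = 0"
    proof (rule coord_coeff_unique[OF rot continuous_on_torus_coeff[OF rot cont] z])
      fix k show "coord_coeff j k (torus_coeff js \<alpha> f) z = 0"
        using Cons.prems(2)[OF z, of "\<alpha>(j := k)"] by (simp add: upd del: fun_upd_apply) (simp add: fun_upd_def)
    qed
  qed (use Cons.prems in auto)
qed

lemma torus_coeff_add:
  assumes "rotation_closed \<Omega>" "continuous_on \<Omega> f" "continuous_on \<Omega> g" "z \<in> \<Omega>"
  shows "torus_coeff js \<alpha> (\<lambda>z. f z + g z) z = torus_coeff js \<alpha> f z + torus_coeff js \<alpha> g z"
  using assms(4)
proof (induction js arbitrary: z)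
  case (Cons j js)
  have "coord_coeff j (\<alpha> j) (torus_coeff js \<alpha> (\<lambda>z. f z + g z)) z =
      coord_coeff j (\<alpha> j) (\<lambda>z. torus_coeff js \<alpha> f z + torus_coeff js \<alpha> g z) z"
    by (rule coord_coeff_cong[OF assms(1) Cons.prems Cons.IH])
  then show ?case
    using assms Cons.prems by (simp add: coord_coeff_add[OF assms(1)] continuous_on_torus_coeff)
qed simp

lemma torus_coeff_cmult: "torus_coeff js \<alpha> (\<lambda>z. c * f z) = (\<lambda>z. c * torus_coeff js \<alpha> f z)"
  by (induction js) (auto simp: coord_coeff_cmult)

lemma torus_coeff_sum:
  assumes rot: "rotation_closed \<Omega>" and z: "z \<in> \<Omega>" and "finite A" and "\<And>a. a \<in> A \<Longrightarrow> continuous_on \<Omega> (f a)"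
  shows "torus_coeff js \<alpha> (\<lambda>z. \<Sum>a\<in>A. f a z) z = (\<Sum>a\<in>A. torus_coeff js \<alpha> (f a) z)"
  using assms(3,4)
proof (induction A rule: finite_induct)
  case empty
  have "torus_coeff js \<alpha> (\<lambda>z. 0 * 0) z = 0" by (subst torus_coeff_cmult) simp
  then show ?case by simp
next
  case (insert a A)
  then show ?case
    using torus_coeff_add[OF rot _ _ z, of "f a" "\<lambda>z. \<Sum>a\<in>A. f a z" js \<alpha>]
    by (simp add: continuous_on_sum)
qed

lemma torus_coeff_weight:
  assumes rot: "rotation_closed \<Omega>" and w: "\<And>j. weight_on \<Omega> j (\<beta> j) f" and z: "z \<in> \<Omega>"
  shows "torus_coeff js \<alpha> f z = (if \<forall>j\<in>set js. \<alpha> j = \<beta> j then f z else 0)"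
  using z
proof (induction js arbitrary: z)
  case (Cons j js)
  let ?P = "\<forall>j\<in>set js. \<alpha> j = \<beta> j"
  have "torus_coeff (j # js) \<alpha> f z = coord_coeff j (\<alpha> j) (\<lambda>z. (if ?P then 1 else 0) * f z) z"
    using Cons by (auto intro!: coord_coeff_cong[OF rot])
  also have "\<dots> = (if ?P then 1 else 0) * (if \<alpha> j = \<beta> j then f z else 0)"
    unfolding coord_coeff_cmult using coord_coeff_weight[OF w Cons.prems] by simp
  finally show ?case by auto
qed simp

definition nonzero_coords :: "(complex ^ 'n::finite) set" where
  "nonzero_coords = {z. \<forall>j. z $ j \<noteq> 0}"

lemma open_nonzero_coords: "open (nonzero_coords :: (complex ^ 'n::finite) set)"
proof -
  have "nonzero_coords = (\<Inter>j. (\<lambda>z :: complex ^ 'n. z $ j) -` (- {0}))"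
    by (auto simp: nonzero_coords_def)
  also have "open \<dots>"
    by (intro open_INT ballI open_vimage continuous_intros) auto
  finally show ?thesis .
qed

text \<open>
  A function of one variable \<open>v \<noteq> 0\<close> that is invariant under rotation has derivative zero. So \<open>h\<close> does not change
  when one coordinate is moved within a disc, and all points of a polydisc are reached by moving the
  coordinates one after the other.
\<close>

lemma weight_zero_locally_constant:
  fixes a :: "complex ^ 'n::finite"
  assumes op: "open \<Omega>" and h: "separately_holomorphic \<Omega> h" and w: "\<And>j. weight_on \<Omega> j 0 h"
    and nz: "\<Omega> \<subseteq> nonzero_coords" and a: "a \<in> \<Omega>"
  obtains T where "open T" "a \<in> T" "T \<subseteq> \<Omega>" "\<And>z. z \<in> T \<Longrightarrow> h z = h a"
proof -
  obtain r where r: "r > 0" "ball a r \<subseteq> \<Omega>" using op a openE by blast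
  define \<delta> where "\<delta> = r / (real CARD('n) + 1)"
  have \<delta>: "\<delta> > 0" using r by (simp add: \<delta>_def add_nonneg_pos)
  define T where "T = {z. \<forall>j. z $ j \<in> ball (a $ j) \<delta>}"
  have "T = (\<Inter>j. (\<lambda>z. z $ j) -` ball (a $ j) \<delta>)" by (auto simp: T_def)
  also have "open \<dots>" by (intro open_INT ballI open_vimage continuous_intros) auto
  finally have opT: "open T" .
  have TO: "T \<subseteq> \<Omega>"
  proof
    fix z assume z: "z \<in> T"
    have "dist a z \<le> (\<Sum>j\<in>UNIV. dist (a $ j) (z $ j))"
      unfolding dist_vec_def by (rule L2_set_le_sum) auto
    also have "\<dots> \<le> (\<Sum>j\<in>(UNIV :: 'n set). \<delta>)"
      using z by (intro sum_mono) (auto simp: T_def less_imp_le)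
    also have "\<dots> < r" using r by (simp add: \<delta>_def field_simps)
    finally show "z \<in> \<Omega>" using r by auto
  qed
  have step: "h (upd_coord z j w) = h z" if z: "z \<in> T" and wb: "w \<in> ball (a $ j) \<delta>" for z j w
  proof -
    have T: "upd_coord z j v \<in> T" if "v \<in> ball (a $ j) \<delta>" for v
      using z that by (auto simp: T_def upd_coord_nth)
    have D0: "((\<lambda>v. h (upd_coord z j v)) has_field_derivative 0) (at v)" if v: "v \<in> ball (a $ j) \<delta>" for v
    proof -
      define y where "y = upd_coord z j v"
      have y: "y \<in> \<Omega>" using T[OF v] TO by (auto simp: y_def)
      have yj: "y $ j = v" by (simp add: y_def upd_coord_nth)
      have v0: "v \<noteq> 0" using y nz yj by (auto simp: nonzero_coords_def)
      obtain D where D: "((\<lambda>w. h (upd_coord y j w)) has_field_derivative D) (at v)"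
        using h y yj unfolding separately_holomorphic_def field_differentiable_def by blast
      have "((\<lambda>t. h (upd_coord y j (exp (\<i> * t) * v))) has_field_derivative D * (\<i> * v)) (at 0)"
      proof (rule DERIV_chain2[where f = "\<lambda>w. h (upd_coord y j w)" and g = "\<lambda>t. exp (\<i> * t) * v"])
        show "((\<lambda>w. h (upd_coord y j w)) has_field_derivative D) (at (exp (\<i> * 0) * v))"
          using D by simp
        show "((\<lambda>t. exp (\<i> * t) * v) has_field_derivative \<i> * v) (at 0)"
          by (auto intro!: derivative_eq_intros)
      qed
      then have "((\<lambda>t. h (upd_coord y j (exp (\<i> * of_real t) * v))) has_vector_derivative D * (\<i> * v)) (at 0)"
        using has_vector_derivative_real_field[of "\<lambda>t. h (upd_coord y j (exp (\<i> * t) * v))" _ 0 UNIV] by simp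
      moreover have "h (upd_coord y j (exp (\<i> * of_real t) * v)) = h y" for t
      proof -
        have "h (rotate_coord j t y) = h y" using w[of j] y by (simp add: weight_on_def)
        then show ?thesis by (simp add: rotate_coord_def yj cis_conv_exp)
      qed
      ultimately have "((\<lambda>t::real. h y) has_vector_derivative D * (\<i> * v)) (at 0)" by simp
      then have "D * (\<i> * v) = 0"
        using vector_derivative_unique_at[OF _ has_vector_derivative_const] by blast
      then have "D = 0" using v0 by simp
      with D show ?thesis by (simp add: y_def)
    qed
    have "\<exists>c. \<forall>v\<in>ball (a $ j) \<delta>. h (upd_coord z j v) = c"
      by (rule has_field_derivative_zero_constant[OF convex_ball])
         (rule has_field_derivative_at_within[OF D0])
    moreover have "z $ j \<in> ball (a $ j) \<delta>" using z by (simp add: T_def)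
    ultimately have "h (upd_coord z j w) = h (upd_coord z j (z $ j))" using wb by metis
    then show ?thesis by simp
  qed
  have aT: "a \<in> T" using \<delta> by (simp add: T_def)
  have "h z = h a" if z: "z \<in> T" for z
  proof -
    define m where "m S = (\<chi> j. if j \<in> S then z $ j else a $ j)" for S
    have mT: "m S \<in> T" for S using z aT by (auto simp: m_def T_def)
    have "h (m S) = h a" if "finite S" for S
      using that
    proof (induction S rule: finite_induct)
      case empty
      then show ?case by (simp add: m_def)
    next
      case (insert j S)
      have "m (insert j S) = upd_coord (m S) j (z $ j)"
        by (auto simp: m_def vec_eq_iff upd_coord_nth)
      moreover have "z $ j \<in> ball (a $ j) \<delta>" using z by (simp add: T_def)
      ultimately show ?case using step[OF mT] insert.IH by simp
    qed
    from this[of UNIV] show ?thesis by (simp add: m_def)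
  qed
  with opT aT TO show ?thesis by (rule that)
qed

text \<open>
  Every point is the limit of points without zero coordinates: replace zeros by a small \<open>s > 0\<close>.
\<close>

lemma continuous_eq_on_nonzero_coords:
  fixes f g :: "complex ^ 'n::finite \<Rightarrow> complex"
  assumes op: "open \<Omega>" and f: "continuous_on \<Omega> f" and g: "continuous_on \<Omega> g"
    and eq: "\<And>z. z \<in> \<Omega> \<inter> nonzero_coords \<Longrightarrow> f z = g z" and z: "z \<in> \<Omega>"
  shows "f z = g z"
proof -
  define p where "p s = (\<chi> j. if z $ j = 0 then of_real s else z $ j)" for s :: real
  have contp: "continuous_on UNIV p"
    unfolding p_def
  proof (rule continuous_on_vec_lambda)
    fix j show "continuous_on UNIV (\<lambda>s. if z $ j = 0 then complex_of_real s else z $ j)"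
      by (cases "z $ j = 0") (auto intro!: continuous_intros)
  qed
  have p0: "p 0 = z" by (auto simp: p_def vec_eq_iff)
  have "isCont p 0" using contp by (simp add: continuous_on_eq_continuous_at)
  then have lim: "(p \<longlongrightarrow> z) (at_right 0)"
    using p0 by (metis isCont_def filterlim_at_split)
  have fz: "((\<lambda>s. f (p s)) \<longlongrightarrow> f z) (at_right 0)"
    using f op z lim by (metis continuous_on_eq_continuous_at isCont_tendsto_compose)
  have gz: "((\<lambda>s. g (p s)) \<longlongrightarrow> g z) (at_right 0)"
    using g op z lim by (metis continuous_on_eq_continuous_at isCont_tendsto_compose)
  have "\<forall>\<^sub>F s in at_right 0. p s \<in> \<Omega>" using lim op z by (rule topological_tendstoD)
  moreover have "\<forall>\<^sub>F s in at_right (0::real). s > 0" by (simp add: eventually_at_right_less)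
  ultimately have "\<forall>\<^sub>F s in at_right 0. g (p s) = f (p s)"
  proof eventually_elim
    case (elim s)
    then have "p s \<in> nonzero_coords" by (auto simp: p_def nonzero_coords_def)
    with elim eq show ?case by auto
  qed
  from Lim_transform_eventually[OF gz this] fz show ?thesis
    using tendsto_unique[OF trivial_limit_at_right_real] by blast
qed

text \<open>
  The quotient of \<open>g\<close> by \<open>z\<^sup>\<alpha>\<close> has weight zero, so it is constant where no coordinate vanishes. A negative
  exponent is impossible: let the coordinate \<open>j\<close> of a point near the origin tend to zero; then \<open>g\<close> stays bounded
  while \<open>z\<^sup>\<alpha>\<close> does not.
\<close>

lemma weight_imp_monomial:
  fixes g :: "complex ^ 'n::finite \<Rightarrow> complex"
  assumes op: "open \<Omega>" and rot: "rotation_closed \<Omega>" and conn: "connected (\<Omega> \<inter> nonzero_coords)"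
    and zero: "0 \<in> \<Omega>" and g: "separately_holomorphic \<Omega> g" and w: "\<And>j. weight_on \<Omega> j (\<alpha> j) g"
  obtains c where "\<And>z. z \<in> \<Omega> \<Longrightarrow> g z = c * (\<Prod>j\<in>UNIV. (z $ j) ^ nat (\<alpha> j))"
    "c \<noteq> 0 \<Longrightarrow> (\<And>j. \<alpha> j \<ge> 0)"
proof -
  have contg: "continuous_on \<Omega> g" using g by (simp add: separately_holomorphic_def)
  define \<Omega>' where "\<Omega>' = \<Omega> \<inter> nonzero_coords"
  have op': "open \<Omega>'" using op open_nonzero_coords by (auto simp: \<Omega>'_def)
  define P where "P z = (\<Prod>j\<in>UNIV. (z $ j) powi (\<alpha> j))" for z :: "complex ^ 'n"
  have P0: "P z \<noteq> 0" if "z \<in> \<Omega>'" for z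
    using that by (auto simp: P_def \<Omega>'_def nonzero_coords_def)
  define h where "h z = g z / P z" for z
  have Pu: "P (upd_coord z j v) = v powi (\<alpha> j) * (\<Prod>i\<in>UNIV - {j}. (z $ i) powi (\<alpha> i))" for z j v
    unfolding P_def by (subst prod.remove[of _ j]) (auto simp: upd_coord_nth intro!: prod.cong)
  have sh: "separately_holomorphic \<Omega>' h"
    unfolding separately_holomorphic_def
  proof (intro conjI ballI allI)
    have "continuous_on \<Omega>' P" unfolding P_def
      by (intro continuous_intros) (auto simp: \<Omega>'_def nonzero_coords_def)
    then show "continuous_on \<Omega>' h"
      unfolding h_def using P0 contg
      by (intro continuous_intros) (auto simp: \<Omega>'_def intro: continuous_on_subset)
  next
    fix z j assume z: "z \<in> \<Omega>'"
    then have zj: "z $ j \<noteq> 0" by (auto simp: \<Omega>'_def nonzero_coords_def)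
    have Pz: "P (upd_coord z j (z $ j)) \<noteq> 0" using P0[OF z] by simp
    show "(\<lambda>w. h (upd_coord z j w)) field_differentiable at (z $ j)"
      unfolding h_def
    proof (rule field_differentiable_divide)
      show "(\<lambda>w. g (upd_coord z j w)) field_differentiable at (z $ j)"
        using g z by (auto simp: separately_holomorphic_def \<Omega>'_def)
      have "(\<lambda>v. v powi \<alpha> j) field_differentiable at (z $ j)"
        using zj by (intro holomorphic_on_imp_differentiable_at[of _ "- {0}"] holomorphic_intros) auto
      then show "(\<lambda>w. P (upd_coord z j w)) field_differentiable at (z $ j)"
        unfolding Pu by (intro field_differentiable_mult field_differentiable_const)
    qed (use Pz in simp)
  qed
  have wt: "weight_on \<Omega>' j 0 h" for j
    unfolding weight_on_def
  proof (intro ballI allI)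
    fix z \<phi> assume z: "z \<in> \<Omega>'"
    have "P (rotate_coord j \<phi> z) = cis (of_int (\<alpha> j) * \<phi>) * P z"
    proof -
      have "(cis \<phi> * z $ j) powi \<alpha> j = cis (of_int (\<alpha> j) * \<phi>) * (z $ j) powi \<alpha> j"
        by (simp add: power_int_mult_distrib cis_power_int)
      then have "P (rotate_coord j \<phi> z) = cis (of_int (\<alpha> j) * \<phi>) * P (upd_coord z j (z $ j))"
        unfolding rotate_coord_def Pu by simp
      then show ?thesis by simp
    qed
    then show "h (rotate_coord j \<phi> z) = cis (of_int 0 * \<phi>) * h z"
      using w[of j] z by (simp add: h_def weight_on_def \<Omega>'_def)
  qed
  have "h constant_on \<Omega>'"
  proof (rule locally_constant_imp_constant)
    show "connected \<Omega>'" using conn by (simp add: \<Omega>'_def)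
    fix a assume a: "a \<in> \<Omega>'"
    have "\<Omega>' \<subseteq> nonzero_coords" by (auto simp: \<Omega>'_def)
    then show "\<exists>T. openin (top_of_set \<Omega>') T \<and> a \<in> T \<and> (\<forall>x\<in>T. h x = h a)"
    proof (rule weight_zero_locally_constant[OF op' sh wt _ a])
      fix T assume "open T" "a \<in> T" "T \<subseteq> \<Omega>'" "\<And>z. z \<in> T \<Longrightarrow> h z = h a"
      then show "\<exists>T. openin (top_of_set \<Omega>') T \<and> a \<in> T \<and> (\<forall>x\<in>T. h x = h a)"
        by (intro exI[of _ T] conjI open_subset ballI)
    qed
  qed
  then obtain c where c: "\<And>z. z \<in> \<Omega>' \<Longrightarrow> h z = c" by (auto simp: constant_on_def)
  have gc: "g z = c * P z" if "z \<in> \<Omega>'" for z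
    using c[OF that] P0[OF that] by (simp add: h_def nonzero_divide_eq_eq)
  have nn: "\<alpha> j \<ge> 0" if c: "c \<noteq> 0" for j
  proof (rule ccontr)
    assume neg: "\<not> \<alpha> j \<ge> 0"
    obtain r where r: "r > 0" "ball 0 r \<subseteq> \<Omega>" using op zero openE by blast
    define \<delta> where "\<delta> = r / (real CARD('n) + 1)"
    have \<delta>: "\<delta> > 0" using r by (simp add: \<delta>_def add_nonneg_pos)
    define e :: "complex ^ 'n" where "e = (\<chi> i. of_real \<delta>)"
    have in\<Omega>: "upd_coord e j w \<in> \<Omega>" if w: "norm w \<le> \<delta>" for w
    proof -
      have "norm (upd_coord e j w) \<le> (\<Sum>i\<in>UNIV. norm (upd_coord e j w $ i))"
        unfolding norm_vec_def by (rule L2_set_le_sum) auto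
      also have "\<dots> \<le> (\<Sum>i\<in>(UNIV :: 'n set). \<delta>)"
        using w \<delta> by (intro sum_mono) (auto simp: upd_coord_nth e_def)
      also have "\<dots> < r" using r by (simp add: \<delta>_def field_simps)
      finally show ?thesis using r by auto
    qed
    define Q where "Q = (\<Prod>i\<in>UNIV - {j}. (e $ i) powi (\<alpha> i))"
    have Q0: "Q \<noteq> 0" using \<delta> by (auto simp: Q_def e_def)
    define k where "k = nat (- \<alpha> j)"
    have k: "k > 0" "\<alpha> j = - int k" using neg by (auto simp: k_def)
    \<comment> \<open>the left hand side tends to \<open>0\<close> with \<open>s\<close>, the right hand side is a nonzero constant\<close>
    have eq: "g (upd_coord e j (of_real s)) * of_real s ^ k = c * Q" if s: "0 < s" "s \<le> \<delta>" for s
    proof -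
      have "upd_coord e j (of_real s) \<in> \<Omega>'"
        using in\<Omega>[of "of_real s"] s \<delta> by (auto simp: \<Omega>'_def nonzero_coords_def upd_coord_nth e_def)
      then have "g (upd_coord e j (of_real s)) = c * (of_real s powi (\<alpha> j) * Q)"
        by (simp add: gc Pu Q_def)
      also have "of_real s powi (\<alpha> j) = inverse (of_real s ^ k :: complex)"
        by (simp add: k power_int_minus)
      finally show ?thesis using s by (simp add: field_simps)
    qed
    have cont: "continuous_on {0..\<delta>} (\<lambda>s. g (upd_coord e j (of_real s)) * of_real s ^ k)"
    proof -
      have "continuous_on {0..\<delta>} (\<lambda>s. g (upd_coord e j (of_real s)))"
        by (rule continuous_on_compose2[OF contg]) (use in\<Omega> in \<open>auto intro!: continuous_intros\<close>)
      then show ?thesis by (intro continuous_intros)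
    qed
    have "((\<lambda>s. g (upd_coord e j (of_real s)) * of_real s ^ k) \<longlongrightarrow> g (upd_coord e j (of_real 0)) * of_real 0 ^ k) (at 0 within {0..\<delta>})"
      using cont[unfolded continuous_on_def, rule_format, of 0] \<delta> by simp
    then have l1: "((\<lambda>s. g (upd_coord e j (of_real s)) * of_real s ^ k) \<longlongrightarrow> 0) (at 0 within {0..\<delta>})"
      using k(1) by (simp add: zero_power)
    have "\<forall>\<^sub>F s in at 0 within {0..\<delta>}. g (upd_coord e j (of_real s)) * of_real s ^ k = c * Q"
      unfolding eventually_at_filter using eq by (intro always_eventually) auto
    from Lim_transform_eventually[OF l1 this] have "((\<lambda>s. c * Q) \<longlongrightarrow> 0) (at 0 within {0..\<delta>})" .
    moreover have "at 0 within {0..\<delta>} \<noteq> bot"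
      using \<delta> by (simp add: at_within_Icc_at_right trivial_limit_at_right_real[simplified])
    ultimately have "c * Q = 0" using tendsto_unique[OF _ tendsto_const] by blast
    with c Q0 show False by simp
  qed
  have "g z = c * (\<Prod>j\<in>UNIV. (z $ j) ^ nat (\<alpha> j))" if z: "z \<in> \<Omega>" for z
  proof (rule continuous_eq_on_nonzero_coords[OF op contg _ _ z])
    show "continuous_on \<Omega> (\<lambda>z. c * (\<Prod>j\<in>UNIV. (z $ j) ^ nat (\<alpha> j)))"
      by (intro continuous_intros)
    fix z assume "z \<in> \<Omega> \<inter> nonzero_coords"
    then have gz: "g z = c * P z" using gc by (simp add: \<Omega>'_def)
    show "g z = c * (\<Prod>j\<in>UNIV. (z $ j) ^ nat (\<alpha> j))"
    proof (cases "c = 0")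
      case False
      from nn[OF this] show ?thesis unfolding gz P_def by (simp add: power_int_def)
    qed (simp add: gz)
  qed
  with nn show ?thesis by (intro that[of c]) auto
qed

lemma complex_linear_iff:
  "Vector_Spaces.linear (*s) (*) (D :: complex ^ 'n::finite \<Rightarrow> complex) \<longleftrightarrow>
    (\<forall>x y. D (x + y) = D x + D y) \<and> (\<forall>c x. D (c *s x) = c * D x)"
  by (simp add: Vector_Spaces.linear_iff vec.vector_space_axioms vector_space_over_itself.vector_space_axioms)

lemma holomorphic_cn_continuous_on: "holomorphic_cn \<Omega> f \<Longrightarrow> continuous_on \<Omega> f"
  unfolding holomorphic_cn_def
  by (meson continuous_at_imp_continuous_on has_derivative_continuous)

text \<open>
  Complex linearity of the derivative makes its restriction to a coordinate axis multiplication by a number.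
\<close>

lemma holomorphic_cn_imp_separately_holomorphic:
  assumes "holomorphic_cn \<Omega> f"
  shows "separately_holomorphic \<Omega> f"
  unfolding separately_holomorphic_def
proof (intro conjI ballI allI)
  fix z j assume "z \<in> \<Omega>"
  then obtain D where D: "(f has_derivative D) (at z)" "Vector_Spaces.linear (*s) (*) D"
    using assms by (auto simp: holomorphic_cn_def)
  have upd: "upd_coord z j w = z + axis j (w - z $ j)" for w
    by (auto simp: vec_eq_iff upd_coord_nth axis_def)
  have lin: "bounded_linear (axis j :: complex \<Rightarrow> complex ^ 'a)"
    by (intro linear_conv_bounded_linear[THEN iffD1] linearI) (auto simp: vec_eq_iff axis_def)
  have "((\<lambda>w. upd_coord z j w) has_derivative (\<lambda>h. axis j h)) (at (z $ j))"
    unfolding upd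
    by (auto intro!: derivative_eq_intros bounded_linear.has_derivative[OF lin])
  moreover have "(f has_derivative D) (at (upd_coord z j (z $ j)))" using D by simp
  ultimately have "((\<lambda>w. f (upd_coord z j w)) has_derivative (\<lambda>h. D (axis j h))) (at (z $ j))"
    by (rule has_derivative_compose)
  moreover have eq: "D (axis j h) = D (axis j 1) * h" for h
  proof -
    have "axis j h = h *s (axis j 1 :: complex ^ 'a)" by (auto simp: vec_eq_iff axis_def)
    then show ?thesis using D(2) by (simp add: complex_linear_iff)
  qed
  ultimately have "((\<lambda>w. f (upd_coord z j w)) has_field_derivative D (axis j 1)) (at (z $ j))"
    unfolding has_field_derivative_def by (subst (asm) eq)
  then show "(\<lambda>w. f (upd_coord z j w)) field_differentiable at (z $ j)"
    by (auto simp: field_differentiable_def)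
qed (rule holomorphic_cn_continuous_on[OF assms])

lemma holomorphic_cn_const: "holomorphic_cn \<Omega> (\<lambda>z. c)"
  unfolding holomorphic_cn_def complex_linear_iff
  by (intro ballI exI[of _ "\<lambda>h. 0"]) auto

lemma holomorphic_cn_coord: "holomorphic_cn \<Omega> (\<lambda>z. z $ j)"
  unfolding holomorphic_cn_def complex_linear_iff
  by (intro ballI exI[of _ "\<lambda>h. h $ j"] conjI bounded_linear_imp_has_derivative bounded_linear_vec_nth) auto

lemma holomorphic_cn_add:
  assumes "holomorphic_cn \<Omega> f" "holomorphic_cn \<Omega> g"
  shows "holomorphic_cn \<Omega> (\<lambda>z. f z + g z)"
  unfolding holomorphic_cn_def
proof
  fix z assume "z \<in> \<Omega>"
  then obtain D E where "(f has_derivative D) (at z)" "Vector_Spaces.linear (*s) (*) D"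
     "(g has_derivative E) (at z)" "Vector_Spaces.linear (*s) (*) E"
    using assms unfolding holomorphic_cn_def by blast
  then show "\<exists>D. ((\<lambda>z. f z + g z) has_derivative D) (at z) \<and> Vector_Spaces.linear (*s) (*) D"
    unfolding complex_linear_iff
    by (intro exI[of _ "\<lambda>h. D h + E h"] conjI has_derivative_add) (auto simp: algebra_simps)
qed

lemma holomorphic_cn_mult:
  assumes "holomorphic_cn \<Omega> f" "holomorphic_cn \<Omega> g"
  shows "holomorphic_cn \<Omega> (\<lambda>z. f z * g z)"
  unfolding holomorphic_cn_def
proof
  fix z assume "z \<in> \<Omega>"
  then obtain D E where "(f has_derivative D) (at z)" "Vector_Spaces.linear (*s) (*) D"
     "(g has_derivative E) (at z)" "Vector_Spaces.linear (*s) (*) E"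
    using assms unfolding holomorphic_cn_def by blast
  then show "\<exists>D. ((\<lambda>z. f z * g z) has_derivative D) (at z) \<and> Vector_Spaces.linear (*s) (*) D"
    unfolding complex_linear_iff
    by (intro exI[of _ "\<lambda>h. f z * E h + D h * g z"] conjI has_derivative_mult) (auto simp: algebra_simps)
qed

lemma holomorphic_cn_monomial: "holomorphic_cn \<Omega> (\<lambda>z. \<Prod>j\<in>UNIV. (z $ j) ^ \<alpha> j)"
proof -
  have pow: "holomorphic_cn \<Omega> (\<lambda>z. (z $ j) ^ k)" for j :: 'a and k
    by (induction k) (auto intro: holomorphic_cn_const holomorphic_cn_mult holomorphic_cn_coord)
  have "holomorphic_cn \<Omega> (\<lambda>z. \<Prod>j\<in>S. (z $ j) ^ \<alpha> j)" for S
    by (induction S rule: infinite_finite_induct) (auto intro: holomorphic_cn_const holomorphic_cn_mult pow)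
  then show ?thesis .
qed

lemma holomorphic_cn_cong:
  assumes "open \<Omega>" "\<And>z. z \<in> \<Omega> \<Longrightarrow> f z = g z" "holomorphic_cn \<Omega> f"
  shows "holomorphic_cn \<Omega> g"
  using assms(3) unfolding holomorphic_cn_def
  by (metis assms(1,2) has_derivative_transform_within_open)

lemma holomorphic_cn_monomial_on: "open \<Omega> \<Longrightarrow> holomorphic_cn \<Omega> (monomial_on \<Omega> \<alpha>)"
  by (rule holomorphic_cn_cong[OF _ _ holomorphic_cn_monomial]) (auto simp: monomial_on_def)

lemma borel_measurable_square_norm:
  fixes f :: "complex ^ 'n::finite \<Rightarrow> complex"
  assumes "open \<Omega>" "continuous_on \<Omega> f"
  shows "(\<lambda>z. indicator \<Omega> z *\<^sub>R (cmod (f z))\<^sup>2) \<in> borel_measurable borel"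
  by (intro borel_measurable_continuous_on_indicator continuous_intros assms) (use assms in auto)

lemma set_integrable_iff_square_nn_integral:
  fixes f :: "complex ^ 'n::finite \<Rightarrow> complex"
  assumes "open \<Omega>" "continuous_on \<Omega> f"
  shows "set_integrable lborel \<Omega> (\<lambda>z. (cmod (f z))\<^sup>2) \<longleftrightarrow> square_nn_integral \<Omega> f < \<infinity>"
proof -
  have "(\<integral>\<^sup>+z. ennreal (norm (indicat_real \<Omega> z *\<^sub>R (cmod (f z))\<^sup>2)) \<partial>lborel) = square_nn_integral \<Omega> f"
    unfolding square_nn_integral_def by (intro nn_integral_cong) (auto simp: indicator_def)
  then show ?thesis
    using borel_measurable_square_norm[OF assms]
    by (simp add: set_integrable_def integrable_iff_bounded)
qed

lemma bergman_space_iff: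
  assumes "open \<Omega>"
  shows "f \<in> bergman_space \<Omega> \<longleftrightarrow>
    (\<forall>z. z \<notin> \<Omega> \<longrightarrow> f z = 0) \<and> holomorphic_cn \<Omega> f \<and> square_nn_integral \<Omega> f < \<infinity>"
  using set_integrable_iff_square_nn_integral[OF assms holomorphic_cn_continuous_on]
  by (auto simp: bergman_space_def)

lemma square_nn_integral_cmult:
  fixes f :: "complex ^ 'n::finite \<Rightarrow> complex"
  assumes "open \<Omega>" "continuous_on \<Omega> f"
  shows "square_nn_integral \<Omega> (\<lambda>z. c * f z) = ennreal ((cmod c)\<^sup>2) * square_nn_integral \<Omega> f"
proof -
  have "(\<lambda>z. ennreal ((cmod (f z))\<^sup>2) * indicator \<Omega> z) = (\<lambda>z. ennreal (indicat_real \<Omega> z *\<^sub>R (cmod (f z))\<^sup>2))"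
    by (auto simp: indicator_def fun_eq_iff)
  then have "(\<lambda>z. ennreal ((cmod (f z))\<^sup>2) * indicator \<Omega> z) \<in> borel_measurable lborel"
    using borel_measurable_square_norm[OF assms] by simp
  then show ?thesis
    unfolding square_nn_integral_def
    by (subst nn_integral_cmult[symmetric]) (auto simp: norm_mult power_mult_distrib ennreal_mult mult.assoc)
qed

lemma square_nn_integral_add:
  fixes f :: "complex ^ 'n::finite \<Rightarrow> complex"
  assumes "open \<Omega>" "continuous_on \<Omega> f" "continuous_on \<Omega> g"
  shows "square_nn_integral \<Omega> (\<lambda>z. f z + g z) \<le> 2 * square_nn_integral \<Omega> f + 2 * square_nn_integral \<Omega> g"
proof -
  have m: "(\<lambda>z. ennreal ((cmod (f z))\<^sup>2) * indicator \<Omega> z) \<in> borel_measurable lborel"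
    if "continuous_on \<Omega> f" for f :: "complex ^ 'n::finite \<Rightarrow> complex"
  proof -
    have "(\<lambda>z. ennreal ((cmod (f z))\<^sup>2) * indicator \<Omega> z) = (\<lambda>z. ennreal (indicat_real \<Omega> z *\<^sub>R (cmod (f z))\<^sup>2))"
      by (auto simp: indicator_def fun_eq_iff)
    then show ?thesis using borel_measurable_square_norm[OF assms(1) that] by simp
  qed
  have pt: "ennreal ((cmod (a + b))\<^sup>2) \<le> 2 * ennreal ((cmod a)\<^sup>2) + 2 * ennreal ((cmod b)\<^sup>2)" for a b :: complex
  proof -
    have "(cmod (a + b))\<^sup>2 \<le> (cmod a + cmod b)\<^sup>2" by (intro power_mono norm_triangle_ineq) auto
    also have "\<dots> \<le> 2 * (cmod a)\<^sup>2 + 2 * (cmod b)\<^sup>2"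
      using sum_squares_bound[of "cmod a" "cmod b"] by (simp add: power2_sum)
    finally have "ennreal ((cmod (a + b))\<^sup>2) \<le> ennreal (2 * (cmod a)\<^sup>2 + 2 * (cmod b)\<^sup>2)" by (rule ennreal_leI)
    then show ?thesis by (simp add: ennreal_mult)
  qed
  have "square_nn_integral \<Omega> (\<lambda>z. f z + g z) \<le>
     (\<integral>\<^sup>+z. 2 * (ennreal ((cmod (f z))\<^sup>2) * indicator \<Omega> z) + 2 * (ennreal ((cmod (g z))\<^sup>2) * indicator \<Omega> z) \<partial>lborel)"
    unfolding square_nn_integral_def
    by (intro nn_integral_mono) (auto simp: indicator_def intro: pt)
  also have "\<dots> = 2 * square_nn_integral \<Omega> f + 2 * square_nn_integral \<Omega> g"
    unfolding square_nn_integral_def using m[OF assms(2)] m[OF assms(3)]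
    by (simp add: nn_integral_add nn_integral_cmult)
  finally show ?thesis .
qed

lemma subspace_bergman_space:
  assumes "open \<Omega>"
  shows "cfun.subspace (bergman_space \<Omega>)"
proof (rule cfun.subspaceI)
  have "square_nn_integral \<Omega> (\<lambda>z. 0) = 0" by (simp add: square_nn_integral_def)
  then show "0 \<in> bergman_space \<Omega>"
    by (simp add: bergman_space_iff[OF assms] zero_fun_def holomorphic_cn_const)
next
  fix f g assume fg: "f \<in> bergman_space \<Omega>" "g \<in> bergman_space \<Omega>"
  then have "square_nn_integral \<Omega> (\<lambda>z. f z + g z) < \<infinity>"
    by (intro le_less_trans[OF square_nn_integral_add[OF assms]])
       (auto simp: bergman_space_iff[OF assms] intro: holomorphic_cn_continuous_on simp: ennreal_mult_less_top)
  with fg show "f + g \<in> bergman_space \<Omega>"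
    by (auto simp: bergman_space_iff[OF assms] plus_fun_def intro: holomorphic_cn_add)
next
  fix c f assume f: "f \<in> bergman_space \<Omega>"
  then have "square_nn_integral \<Omega> (\<lambda>z. c * f z) < \<infinity>"
    by (auto simp: bergman_space_iff[OF assms] square_nn_integral_cmult[OF assms holomorphic_cn_continuous_on]
        ennreal_mult_less_top)
  with f show "fun_scale c f \<in> bergman_space \<Omega>"
    by (auto simp: bergman_space_iff[OF assms] fun_scale_def intro: holomorphic_cn_mult holomorphic_cn_const)
qed

lemma weight_on_monomial_on:
  assumes "rotation_closed \<Omega>"
  shows "weight_on \<Omega> j (int (\<alpha> j)) (monomial_on \<Omega> \<alpha>)"
  unfolding weight_on_def
proof (intro ballI allI)
  fix z \<phi> assume z: "z \<in> \<Omega>"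
  have "(\<Prod>i\<in>UNIV. (rotate_coord j \<phi> z $ i) ^ \<alpha> i) =
      (\<Prod>i\<in>UNIV. (if i = j then cis (real (\<alpha> j) * \<phi>) else 1) * (z $ i) ^ \<alpha> i)"
    by (intro prod.cong refl) (auto simp: rotate_coord_nth power_mult_distrib Complex.DeMoivre)
  also have "\<dots> = cis (real (\<alpha> j) * \<phi>) * (\<Prod>i\<in>UNIV. (z $ i) ^ \<alpha> i)"
    by (simp add: prod.distrib)
  finally show "monomial_on \<Omega> \<alpha> (rotate_coord j \<phi> z) = cis (of_int (int (\<alpha> j)) * \<phi>) * monomial_on \<Omega> \<alpha> z"
    using z assms by (simp add: monomial_on_def rotation_closed_def)
qed

lemma sum_fun_apply: "(\<Sum>a\<in>A. F a) z = (\<Sum>a\<in>A. F a z)"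
  for F :: "'a \<Rightarrow> 'b \<Rightarrow> complex"
  by (induction A rule: infinite_finite_induct) (auto simp: zero_fun_def plus_fun_def)

text \<open>
  The coefficient of \<open>f\<close> at an integer vector \<open>\<alpha>\<close> is \<open>c \<alpha> z\<^sup>\<alpha>\<close>, square integrable with \<open>f\<close>. So \<open>c \<alpha>\<close> vanishes unless
  \<open>\<alpha> \<in> A\<close>, and \<open>f\<close> has the same coefficients as the finite sum \<open>- p\<close> of the terms \<open>c \<alpha> z\<^sup>\<alpha>\<close>.
\<close>

theorem bergman_space_eq_span_monomials:
  fixes \<Omega> :: "(complex ^ 'n::finite) set"
  assumes op: "open \<Omega>" and rot: "rotation_closed \<Omega>" and conn: "connected (\<Omega> \<inter> nonzero_coords)"
    and zero: "0 \<in> \<Omega>" and fin: "finite A"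
    and A: "\<And>\<alpha>. square_nn_integral \<Omega> (monomial_on \<Omega> \<alpha>) < \<infinity> \<longleftrightarrow> \<alpha> \<in> A"
  shows "bergman_space \<Omega> = cspan (monomial_on \<Omega> ` A)"
proof
  have "monomial_on \<Omega> ` A \<subseteq> bergman_space \<Omega>"
    using A by (auto simp: bergman_space_iff[OF op] holomorphic_cn_monomial_on[OF op]) (simp add: monomial_on_def)
  then show "cspan (monomial_on \<Omega> ` A) \<subseteq> bergman_space \<Omega>"
    by (rule cfun.span_minimal) (rule subspace_bergman_space[OF op])
next
  show "bergman_space \<Omega> \<subseteq> cspan (monomial_on \<Omega> ` A)"
  proof
    fix f assume f: "f \<in> bergman_space \<Omega>"
    then have holf: "holomorphic_cn \<Omega> f" and sqf: "square_nn_integral \<Omega> f < \<infinity>" and f0: "\<And>z. z \<notin> \<Omega> \<Longrightarrow> f z = 0"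
      by (auto simp: bergman_space_iff[OF op])
    have sepf: "separately_holomorphic \<Omega> f" by (rule holomorphic_cn_imp_separately_holomorphic[OF holf])
    have contf: "continuous_on \<Omega> f" by (rule holomorphic_cn_continuous_on[OF holf])
    have contm: "continuous_on \<Omega> (monomial_on \<Omega> \<alpha>)" for \<alpha>
      by (rule holomorphic_cn_continuous_on[OF holomorphic_cn_monomial_on[OF op]])
    obtain js :: "'n list" where js: "set js = UNIV" "distinct js"
      using finite_distinct_list[OF finite_class.finite_UNIV] by blast
    have "\<exists>c. (\<forall>z\<in>\<Omega>. torus_coeff js \<alpha> f z = c * (\<Prod>j\<in>UNIV. (z $ j) ^ nat (\<alpha> j))) \<and> (c \<noteq> 0 \<longrightarrow> (\<forall>j. \<alpha> j \<ge> 0))" for \<alpha>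
      by (rule weight_imp_monomial[OF op rot conn zero separately_holomorphic_torus_coeff[OF op rot sepf, of js \<alpha>]
            weight_on_torus_coeff[OF rot contf js(2)]]) (use js in auto)
    then obtain c where c: "\<And>\<alpha> z. z \<in> \<Omega> \<Longrightarrow> torus_coeff js \<alpha> f z = c \<alpha> * (\<Prod>j\<in>UNIV. (z $ j) ^ nat (\<alpha> j))"
        "\<And>\<alpha> j. c \<alpha> \<noteq> 0 \<Longrightarrow> \<alpha> j \<ge> 0"
      by metis
    define C where "C \<beta> = c (\<lambda>j. int (\<beta> j))" for \<beta>
    define p where "p z = (\<Sum>\<beta>\<in>A. (- C \<beta>) * monomial_on \<Omega> \<beta> z)" for z
    have contp: "continuous_on \<Omega> p" unfolding p_def by (intro continuous_intros contm)
    have tp: "torus_coeff js \<alpha> p z = (\<Sum>\<beta>\<in>A. if (\<lambda>j. int (\<beta> j)) = \<alpha> then - C \<beta> * monomial_on \<Omega> \<beta> z else 0)"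
      if z: "z \<in> \<Omega>" for \<alpha> z
    proof -
      have "torus_coeff js \<alpha> p z = (\<Sum>\<beta>\<in>A. torus_coeff js \<alpha> (\<lambda>z. - C \<beta> * monomial_on \<Omega> \<beta> z) z)"
        unfolding p_def by (rule torus_coeff_sum[OF rot z fin]) (intro continuous_intros contm)
      also have "\<dots> = (\<Sum>\<beta>\<in>A. if (\<lambda>j. int (\<beta> j)) = \<alpha> then - C \<beta> * monomial_on \<Omega> \<beta> z else 0)"
      proof (intro sum.cong refl)
        fix \<beta> assume "\<beta> \<in> A"
        have t: "torus_coeff js \<alpha> (monomial_on \<Omega> \<beta>) z =
            (if \<forall>j\<in>set js. \<alpha> j = int (\<beta> j) then monomial_on \<Omega> \<beta> z else 0)"
          by (rule torus_coeff_weight[OF rot _ z]) (rule weight_on_monomial_on[OF rot])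
        show "torus_coeff js \<alpha> (\<lambda>z. - C \<beta> * monomial_on \<Omega> \<beta> z) z =
          (if (\<lambda>j. int (\<beta> j)) = \<alpha> then - C \<beta> * monomial_on \<Omega> \<beta> z else 0)"
          unfolding torus_coeff_cmult t
          using js by (auto simp: fun_eq_iff)
      qed
      finally show ?thesis .
    qed
    have "f z + p z = 0" if z: "z \<in> \<Omega>" for z
    proof (rule torus_coeff_unique[OF rot _ js(2) _ z])
      show "continuous_on \<Omega> (\<lambda>z. f z + p z)" by (intro continuous_intros contf contp)
      fix \<alpha> z assume z: "z \<in> \<Omega>"
      have "torus_coeff js \<alpha> f z + torus_coeff js \<alpha> p z = 0"
      proof (cases "c \<alpha> = 0")
        case True
        then have "torus_coeff js \<alpha> p z = 0"
          unfolding tp[OF z] by (intro sum.neutral) (auto simp: C_def)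
        with True show ?thesis using c(1)[OF z] by simp
      next
        case False
        define \<beta> where "\<beta> j = nat (\<alpha> j)" for j
        have \<alpha>: "\<alpha> = (\<lambda>j. int (\<beta> j))" using c(2)[OF False] by (auto simp: \<beta>_def)
        have g: "torus_coeff js \<alpha> f z = c \<alpha> * monomial_on \<Omega> \<beta> z" if "z \<in> \<Omega>" for z
          using c(1)[OF that] that by (simp add: monomial_on_def \<beta>_def)
        have "ennreal ((cmod (c \<alpha>))\<^sup>2) * square_nn_integral \<Omega> (monomial_on \<Omega> \<beta>) = square_nn_integral \<Omega> (torus_coeff js \<alpha> f)"
          unfolding square_nn_integral_cmult[OF op contm, symmetric]
          unfolding square_nn_integral_def by (intro nn_integral_cong) (auto simp: g indicator_def)
        also have "\<dots> < \<infinity>"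
          using square_nn_integral_torus_coeff[OF op rot contf] sqf by (rule le_less_trans)
        finally have "square_nn_integral \<Omega> (monomial_on \<Omega> \<beta>) < \<infinity>"
          using False by (auto simp: ennreal_mult_less_top)
        then have \<beta>A: "\<beta> \<in> A" using A by simp
        have "(\<lambda>j. int (\<gamma> j)) = \<alpha> \<longleftrightarrow> \<gamma> = \<beta>" for \<gamma> unfolding \<alpha> by (auto simp: fun_eq_iff)
        then have "torus_coeff js \<alpha> p z = - C \<beta> * monomial_on \<Omega> \<beta> z"
          unfolding tp[OF z] using fin \<beta>A by (simp add: sum.delta)
        then show ?thesis using g[OF z] \<alpha> by (simp add: C_def)
      qed
      then show "torus_coeff js \<alpha> (\<lambda>z. f z + p z) z = 0"
        by (simp add: torus_coeff_add[OF rot contf contp z])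
    qed
    then have "f z = (\<Sum>\<beta>\<in>A. C \<beta> * monomial_on \<Omega> \<beta> z)" for z
    proof (cases "z \<in> \<Omega>")
      case True
      then have "f z = - p z" using \<open>\<And>z. z \<in> \<Omega> \<Longrightarrow> f z + p z = 0\<close>[OF True] by (simp add: eq_neg_iff_add_eq_0)
      then show ?thesis by (simp add: p_def sum_negf)
    qed (simp add: f0 monomial_on_def)
    then have "f = (\<Sum>\<beta>\<in>A. fun_scale (C \<beta>) (monomial_on \<Omega> \<beta>))"
      by (simp add: fun_eq_iff fun_scale_def sum_fun_apply)
    also have "\<dots> \<in> cspan (monomial_on \<Omega> ` A)"
      by (intro cfun.span_sum cfun.span_scale cfun.span_base) auto
    finally show "f \<in> cspan (monomial_on \<Omega> ` A)" .
  qed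
qed

section \<open>Bergman kernels with a finite basis\<close>

text \<open>
  The multinomial theorem with divided powers, in which form the induction on the set of variables is one
  application of the binomial theorem to \<open>(y + x a) ^ l / fact l\<close>.
\<close>

lemma multinomial_exp_form:
  fixes x :: "'n \<Rightarrow> complex"
  assumes "finite S"
  shows "(y + (\<Sum>j\<in>S. x j)) ^ m / fact m =
    (\<Sum>\<alpha> | (\<forall>j. j \<notin> S \<longrightarrow> \<alpha> j = 0) \<and> (\<Sum>j\<in>S. \<alpha> j) \<le> m.
      y ^ (m - (\<Sum>j\<in>S. \<alpha> j)) / fact (m - (\<Sum>j\<in>S. \<alpha> j)) * (\<Prod>j\<in>S. x j ^ \<alpha> j / fact (\<alpha> j)))"
  using assms
proof (induction S arbitrary: y rule: finite_induct)
  case empty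
  have "{\<alpha> :: 'n \<Rightarrow> nat. \<forall>j. \<alpha> j = 0} = {\<lambda>_. 0}" by auto
  then show ?case by simp
next
  case (insert a S)
  let ?I = "\<lambda>S. {\<alpha> :: 'n \<Rightarrow> nat. (\<forall>j. j \<notin> S \<longrightarrow> \<alpha> j = 0) \<and> (\<Sum>j\<in>S. \<alpha> j) \<le> m}"
  let ?P = "\<lambda>\<alpha>. \<Prod>j\<in>S. x j ^ \<alpha> j / fact (\<alpha> j)"
  have finI: "finite (?I S)" 
  proof -
    have "?I S \<subseteq> {\<alpha>. \<forall>j. (j \<in> S \<longrightarrow> \<alpha> j \<in> {..m}) \<and> (j \<notin> S \<longrightarrow> \<alpha> j = 0)}"
      using insert.hyps(1) by (auto intro: order_trans[OF member_le_sum])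
    moreover have "finite {\<alpha> :: 'n \<Rightarrow> nat. \<forall>j. (j \<in> S \<longrightarrow> \<alpha> j \<in> {..m}) \<and> (j \<notin> S \<longrightarrow> \<alpha> j = 0)}"
      by (rule finite_set_of_finite_funs) (use insert.hyps in auto)
    ultimately show ?thesis by (rule finite_subset)
  qed
  have binom: "(y + x a) ^ l / fact l = (\<Sum>k\<le>l. x a ^ k / fact k * (y ^ (l - k) / fact (l - k)))" for l
    unfolding add.commute[of y] binomial_ring
    by (simp add: sum_divide_distrib binomial_fact field_simps)
  have "(y + (\<Sum>j\<in>insert a S. x j)) ^ m / fact m = ((y + x a) + (\<Sum>j\<in>S. x j)) ^ m / fact m"
    using insert.hyps by (simp add: add.assoc)
  also have "\<dots> = (\<Sum>\<alpha>\<in>?I S. (y + x a) ^ (m - (\<Sum>j\<in>S. \<alpha> j)) / fact (m - (\<Sum>j\<in>S. \<alpha> j)) * ?P \<alpha>)"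
    by (rule insert.IH)
  also have "\<dots> = (\<Sum>\<alpha>\<in>?I S. \<Sum>k\<le>m - (\<Sum>j\<in>S. \<alpha> j).
      x a ^ k / fact k * (y ^ (m - (\<Sum>j\<in>S. \<alpha> j) - k) / fact (m - (\<Sum>j\<in>S. \<alpha> j) - k)) * ?P \<alpha>)"
    by (simp only: binom sum_distrib_right)
  also have "\<dots> = (\<Sum>(\<alpha>, k)\<in>(SIGMA \<alpha>:?I S. {..m - (\<Sum>j\<in>S. \<alpha> j)}).
      x a ^ k / fact k * (y ^ (m - (\<Sum>j\<in>S. \<alpha> j) - k) / fact (m - (\<Sum>j\<in>S. \<alpha> j) - k)) * ?P \<alpha>)"
    using finI by (intro sum.Sigma) auto
  also have "\<dots> = (\<Sum>\<alpha>\<in>?I (insert a S). y ^ (m - (\<Sum>j\<in>insert a S. \<alpha> j)) / fact (m - (\<Sum>j\<in>insert a S. \<alpha> j)) *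
       (\<Prod>j\<in>insert a S. x j ^ \<alpha> j / fact (\<alpha> j)))"
  proof (rule sum.reindex_bij_witness[where j = "\<lambda>(\<alpha>, k). \<alpha>(a := k)" and i = "\<lambda>\<alpha>. (\<alpha>(a := 0), \<alpha> a)"])
    have S: "(\<Sum>j\<in>S. (\<alpha>(a := k)) j) = (\<Sum>j\<in>S. \<alpha> j)" for \<alpha> :: "'n \<Rightarrow> nat" and k
      using insert.hyps by (intro sum.cong) auto
    have P: "?P (\<alpha>(a := k)) = ?P \<alpha>" for \<alpha> k
      using insert.hyps by (intro prod.cong) auto
    note fun_upd_apply [simp del]
    {
      fix p assume "p \<in> (SIGMA \<alpha>:?I S. {..m - (\<Sum>j\<in>S. \<alpha> j)})"
      then obtain \<alpha> k where p: "p = (\<alpha>, k)" "\<And>j. j \<notin> S \<Longrightarrow> \<alpha> j = 0" "(\<Sum>j\<in>S. \<alpha> j) \<le> m" "k \<le> m - (\<Sum>j\<in>S. \<alpha> j)"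
        by auto
      have "\<alpha> a = 0" using p(2) insert.hyps by auto
      then show "(case (case p of (\<alpha>, k) \<Rightarrow> \<alpha>(a := k)) of \<alpha> \<Rightarrow> (\<alpha>(a := 0), \<alpha> a)) = p"
        by (auto simp: p(1) fun_upd_same fun_upd_idem)
      show "(case p of (\<alpha>, k) \<Rightarrow> \<alpha>(a := k)) \<in> ?I (insert a S)"
        using p insert.hyps by (auto simp: S fun_upd_same fun_upd_other)
      show "(y ^ (m - (\<Sum>j\<in>insert a S. (case p of (\<alpha>, k) \<Rightarrow> \<alpha>(a := k)) j)) /
            fact (m - (\<Sum>j\<in>insert a S. (case p of (\<alpha>, k) \<Rightarrow> \<alpha>(a := k)) j)) *
           (\<Prod>j\<in>insert a S. x j ^ (case p of (\<alpha>, k) \<Rightarrow> \<alpha>(a := k)) j / fact ((case p of (\<alpha>, k) \<Rightarrow> \<alpha>(a := k)) j))) =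
          (case p of (\<alpha>, k) \<Rightarrow> x a ^ k / fact k * (y ^ (m - (\<Sum>j\<in>S. \<alpha> j) - k) / fact (m - (\<Sum>j\<in>S. \<alpha> j) - k)) * ?P \<alpha>)"
        using insert.hyps by (simp add: p(1) S P fun_upd_same add.commute[of k] diff_diff_left mult_ac)
    }
    {
      fix \<alpha> assume \<alpha>: "\<alpha> \<in> ?I (insert a S)"
      then show "(\<alpha>(a := 0), \<alpha> a) \<in> (SIGMA \<alpha>:?I S. {..m - (\<Sum>j\<in>S. \<alpha> j)})"
      proof -
        have "(\<alpha>(a := 0)) j = 0" if "j \<notin> S" for j
          using \<alpha> that by (cases "j = a") (auto simp: fun_upd_apply)
        then show ?thesis using \<alpha> insert.hyps by (auto simp: S)
      qed
      show "(case (\<alpha>(a := 0), \<alpha> a) of (\<alpha>, k) \<Rightarrow> \<alpha>(a := k)) = \<alpha>" by simp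
    }
  qed
  finally show ?case .
qed

lemma multinomial_multi_degree:
  fixes x :: "'n::finite \<Rightarrow> complex"
  shows "(1 + (\<Sum>j\<in>UNIV. x j)) ^ m =
    (\<Sum>\<alpha> | multi_degree \<alpha> \<le> m. fact m / (fact (m - multi_degree \<alpha>) * (\<Prod>j\<in>UNIV. fact (\<alpha> j))) * (\<Prod>j\<in>UNIV. x j ^ \<alpha> j))"
proof -
  have "(1 + (\<Sum>j\<in>UNIV. x j)) ^ m = fact m * ((1 + (\<Sum>j\<in>UNIV. x j)) ^ m / fact m)" by simp
  also have "\<dots> = fact m * (\<Sum>\<alpha> | multi_degree \<alpha> \<le> m. 1 / fact (m - multi_degree \<alpha>) * (\<Prod>j\<in>UNIV. x j ^ \<alpha> j / fact (\<alpha> j)))"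
    by (subst multinomial_exp_form) (auto simp: multi_degree_def)
  also have "\<dots> = (\<Sum>\<alpha> | multi_degree \<alpha> \<le> m. fact m / (fact (m - multi_degree \<alpha>) * (\<Prod>j\<in>UNIV. fact (\<alpha> j))) * (\<Prod>j\<in>UNIV. x j ^ \<alpha> j))"
    by (simp add: sum_distrib_left prod_dividef)
  finally show ?thesis .
qed

lemma bergman_space_integrable_mult:
  assumes op: "open \<Omega>" and f: "f \<in> bergman_space \<Omega>" and g: "g \<in> bergman_space \<Omega>"
  shows "set_integrable lborel \<Omega> (\<lambda>z. f z * cnj (g z))"
proof -
  have i: "set_integrable lborel \<Omega> (\<lambda>z. (cmod (f z))\<^sup>2 + (cmod (g z))\<^sup>2)"
    using f g by (intro set_integral_add) (auto simp: bergman_space_def)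
  have cont: "continuous_on \<Omega> (\<lambda>z. f z * cnj (g z))"
    using f g by (intro continuous_intros holomorphic_cn_continuous_on) (auto simp: bergman_space_def)
  show ?thesis
    unfolding set_integrable_def
  proof (rule Bochner_Integration.integrable_bound)
    show "integrable lborel (\<lambda>z. indicat_real \<Omega> z *\<^sub>R ((cmod (f z))\<^sup>2 + (cmod (g z))\<^sup>2))"
      using i by (simp add: set_integrable_def)
    show "(\<lambda>z. indicat_real \<Omega> z *\<^sub>R (f z * cnj (g z))) \<in> borel_measurable lborel"
      using borel_measurable_continuous_on_indicator[OF _ cont] op by simp
    have "cmod a * cmod b \<le> \<bar>(cmod a)\<^sup>2 + (cmod b)\<^sup>2\<bar>" for a b :: complex
    proof -
      have "2 * cmod a * cmod b \<le> (cmod a)\<^sup>2 + (cmod b)\<^sup>2" by (rule sum_squares_bound)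
      moreover have "0 \<le> cmod a * cmod b" by simp
      ultimately show ?thesis by linarith
    qed
    then show "AE z in lborel. norm (indicat_real \<Omega> z *\<^sub>R (f z * cnj (g z))) \<le>
        norm (indicat_real \<Omega> z *\<^sub>R ((cmod (f z))\<^sup>2 + (cmod (g z))\<^sup>2))"
      by (auto simp: norm_mult indicator_def)
  qed
qed

context
  fixes \<Omega> :: "(complex ^ 'n::finite) set"
  assumes op: "open \<Omega>"
begin

lemma bergman_inner_add:
  assumes "f \<in> bergman_space \<Omega>" "g \<in> bergman_space \<Omega>" "h \<in> bergman_space \<Omega>"
  shows "bergman_inner \<Omega> (f + g) h = bergman_inner \<Omega> f h + bergman_inner \<Omega> g h"
  unfolding bergman_inner_def plus_fun_def distrib_right
  by (rule set_integral_add) (intro bergman_space_integrable_mult op assms)+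

lemma bergman_inner_scale: "bergman_inner \<Omega> (fun_scale c f) h = c * bergman_inner \<Omega> f h"
  unfolding bergman_inner_def fun_scale_def mult.assoc by (rule set_integral_mult_right)

lemma bergman_inner_cnj: "bergman_inner \<Omega> g f = cnj (bergman_inner \<Omega> f g)"
  unfolding bergman_inner_def set_lebesgue_integral_def
  by (subst Bochner_Integration.integral_cnj[symmetric]) (simp add: mult.commute)

lemma bergman_inner_sum:
  assumes "finite B" "\<And>b. b \<in> B \<Longrightarrow> F b \<in> bergman_space \<Omega>" "h \<in> bergman_space \<Omega>"
  shows "bergman_inner \<Omega> (\<Sum>b\<in>B. fun_scale (c b) (F b)) h = (\<Sum>b\<in>B. c b * bergman_inner \<Omega> (F b) h)"
  using assms(1,2)
proof (induction B rule: finite_induct)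
  case empty
  show ?case by (simp add: bergman_inner_def zero_fun_def)
next
  case (insert b B)
  have "(\<Sum>b\<in>B. fun_scale (c b) (F b)) \<in> bergman_space \<Omega>"
    using insert by (intro cfun.subspace_sum subspace_bergman_space op cfun.subspace_scale) auto
  then have "bergman_inner \<Omega> (fun_scale (c b) (F b) + (\<Sum>b\<in>B. fun_scale (c b) (F b))) h =
      bergman_inner \<Omega> (fun_scale (c b) (F b)) h + bergman_inner \<Omega> (\<Sum>b\<in>B. fun_scale (c b) (F b)) h"
    using insert.prems assms(3) cfun.subspace_scale[OF subspace_bergman_space[OF op]]
    by (intro bergman_inner_add) auto
  then show ?case
    using insert.IH[OF insert.prems[OF insertI2]]
    unfolding sum.insert[OF insert.hyps] by (simp only: bergman_inner_scale)
qed

lemma bergman_inner_sum_right: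
  assumes "finite B" "\<And>b. b \<in> B \<Longrightarrow> F b \<in> bergman_space \<Omega>" "h \<in> bergman_space \<Omega>"
  shows "bergman_inner \<Omega> h (\<Sum>b\<in>B. fun_scale (c b) (F b)) = (\<Sum>b\<in>B. cnj (c b) * bergman_inner \<Omega> h (F b))"
  by (subst (1 2) bergman_inner_cnj) (simp add: bergman_inner_sum[OF assms] flip: bergman_inner_cnj)

text \<open>
  The kernel does not depend on the basis. Any orthonormal basis \<open>B\<close> is independent and contained in a space
  of finite dimension, so it is finite; then the density required in \<open>bergman_onb\<close> means that every
  function is equal to its expansion in \<open>B\<close>, since the expansion is the best approximation. Expanding the
  given basis in \<open>B\<close> and \<open>B\<close> in the given basis turns one kernel sum into the other.
\<close>

lemma is_bergman_kernel_finite_basis: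
  assumes finA: "finite A" and e: "\<And>a. a \<in> A \<Longrightarrow> e a \<in> bergman_space \<Omega>"
    and orth: "\<And>a b. a \<in> A \<Longrightarrow> b \<in> A \<Longrightarrow> bergman_inner \<Omega> (e a) (e b) = (if a = b then 1 else 0)"
    and span: "bergman_space \<Omega> = cspan (e ` A)"
    and K: "\<And>z w. z \<in> \<Omega> \<Longrightarrow> w \<in> \<Omega> \<Longrightarrow> K z w = (\<Sum>a\<in>A. e a z * cnj (e a w))"
  shows "is_bergman_kernel \<Omega> K"
proof -
  let ?V = "bergman_space \<Omega>" and ?i = "bergman_inner \<Omega>"
  have inj: "inj_on e A" using orth by (intro inj_onI) (metis zero_neq_one)
  have expand: "f = (\<Sum>a\<in>A. fun_scale (?i f (e a)) (e a))" if "f \<in> ?V" for f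
  proof -
    have "f \<in> range (\<lambda>u. \<Sum>v\<in>e ` A. fun_scale (u v) v)"
      using that cfun.span_finite[of "e ` A"] finA unfolding span by auto
    then obtain u where "f = (\<Sum>v\<in>e ` A. fun_scale (u v) v)" by blast
    then have f: "f = (\<Sum>a\<in>A. fun_scale (u (e a)) (e a))" by (simp add: sum.reindex[OF inj])
    have "?i f (e b) = u (e b)" if "b \<in> A" for b
      unfolding f using that finA e by (simp add: bergman_inner_sum orth if_distrib cong: if_cong)
    then have "(\<Sum>a\<in>A. fun_scale (?i f (e a)) (e a)) = (\<Sum>a\<in>A. fun_scale (u (e a)) (e a))"
      by (intro sum.cong) auto
    with f show ?thesis by simp
  qed
  have i0: "f = 0" if f: "f \<in> ?V" and 0: "Re (?i f f) \<le> 0" for f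
  proof -
    have "?i f f = ?i f (\<Sum>a\<in>A. fun_scale (?i f (e a)) (e a))" using expand[OF f] by simp
    also have "\<dots> = (\<Sum>a\<in>A. cnj (?i f (e a)) * ?i f (e a))"
      using finA e f by (rule bergman_inner_sum_right)
    also have "\<dots> = of_real (\<Sum>a\<in>A. (cmod (?i f (e a)))\<^sup>2)"
    proof -
      have "cnj x * x = of_real ((cmod x)\<^sup>2)" for x :: complex
        by (simp only: complex_norm_square mult.commute)
      then show ?thesis by (simp only: of_real_sum)
    qed
    finally have "(\<Sum>a\<in>A. (cmod (?i f (e a)))\<^sup>2) \<le> 0" using 0 by simp
    then have "(\<Sum>a\<in>A. (cmod (?i f (e a)))\<^sup>2) = 0" by (intro antisym sum_nonneg) auto
    then have "\<forall>a\<in>A. ?i f (e a) = 0" using finA by (simp add: sum_nonneg_eq_0_iff)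
    then have "(\<Sum>a\<in>A. fun_scale (?i f (e a)) (e a)) = 0"
      by (intro sum.neutral) (auto simp: fun_scale_def zero_fun_def)
    with expand[OF f] show ?thesis by simp
  qed
  have V: "cfun.subspace ?V" by (rule subspace_bergman_space[OF op])
  have "bergman_onb \<Omega> (e ` A)"
    unfolding bergman_onb_def
  proof (intro conjI ballI allI impI)
    show "e ` A \<subseteq> ?V" using e by auto
    fix f g assume "f \<in> e ` A" "g \<in> e ` A"
    then show "?i f g = (if f = g then 1 else 0)" using orth inj by (auto simp: inj_on_def)
  next
    fix f and \<epsilon> :: real assume "f \<in> ?V" "\<epsilon> > 0"
    then show "\<exists>g\<in>cspan (e ` A). bergman_norm \<Omega> (\<lambda>z. f z - g z) < \<epsilon>"
      unfolding span by (intro bexI[of _ f]) (auto simp: bergman_norm_def bergman_inner_def)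
  qed
  moreover have "((\<lambda>\<phi>. \<phi> z * cnj (\<phi> w)) has_sum K z w) B"
    if B: "bergman_onb \<Omega> B" and z: "z \<in> \<Omega>" and w: "w \<in> \<Omega>" for B z w
  proof -
    have BV: "b \<in> ?V" if "b \<in> B" for b using B that by (auto simp: bergman_onb_def)
    have Bo: "?i b c = (if b = c then 1 else 0)" if "b \<in> B" "c \<in> B" for b c
      using B that by (simp add: bergman_onb_def)
    have "cfun.independent B"
      unfolding cfun.independent_explicit_module
    proof (intro allI impI)
      fix t u v assume t: "finite t" "t \<subseteq> B" "(\<Sum>v\<in>t. fun_scale (u v) v) = 0" "v \<in> t"
      have "?i (\<Sum>v\<in>t. fun_scale (u v) v) v = (\<Sum>b\<in>t. u b * ?i b v)"
        using t BV by (intro bergman_inner_sum) auto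
      also have "\<dots> = (\<Sum>b\<in>t. if b = v then u b else 0)"
        using t(4) by (intro sum.cong) (auto simp: Bo subsetD[OF t(2)])
      also have "\<dots> = u v" using t by simp
      finally show "u v = 0" unfolding t(3) by (simp add: bergman_inner_def zero_fun_def)
    qed
    then have finB: "finite B"
      using cfun.independent_span_bound[of "e ` A" B] finA BV unfolding span by auto
    have expB: "f = (\<Sum>b\<in>B. fun_scale (?i f b) b)" if f: "f \<in> ?V" for f
    proof -
      define p where "p = (\<Sum>b\<in>B. fun_scale (?i f b) b)"
      define h where "h = f - p"
      have pV: "p \<in> ?V" unfolding p_def
        by (intro cfun.subspace_sum V cfun.subspace_scale BV)
      have hV: "h \<in> ?V" unfolding h_def using V f pV by (rule cfun.subspace_diff)
      have hf: "f = h + p" by (simp add: h_def)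
      have hb: "?i h b = 0" if "b \<in> B" for b
      proof -
        have "?i p b = ?i f b"
          unfolding p_def using that finB BV by (simp add: bergman_inner_sum Bo if_distrib cong: if_cong)
        moreover have "?i f b = ?i h b + ?i p b"
          using hf bergman_inner_add[OF hV pV BV[OF that]] by simp
        ultimately show ?thesis by simp
      qed
      have le: "Re (?i h h) \<le> \<epsilon>\<^sup>2" if \<epsilon>: "\<epsilon> > 0" for \<epsilon>
      proof -
        obtain g where g: "g \<in> cspan B" "bergman_norm \<Omega> (\<lambda>z. f z - g z) < \<epsilon>"
          using B f \<epsilon> unfolding bergman_onb_def by blast
        have "p - g \<in> cspan B"
        proof (rule cfun.span_diff[OF _ g(1)])
          show "p \<in> cspan B"
            unfolding p_def by (intro cfun.span_sum cfun.span_scale cfun.span_base)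
        qed
        then obtain u where u: "p - g = (\<Sum>b\<in>B. fun_scale (u b) b)"
          using cfun.span_finite[OF finB] by auto
        have qV: "p - g \<in> ?V" unfolding u by (intro cfun.subspace_sum V cfun.subspace_scale BV)
        have h0: "?i h (p - g) = 0"
          unfolding u using finB BV hV hb by (simp add: bergman_inner_sum_right)
        have "(\<lambda>z. f z - g z) = h + (p - g)" by (rule ext) (simp add: h_def)
        then have "?i (\<lambda>z. f z - g z) (\<lambda>z. f z - g z) = ?i (h + (p - g)) (h + (p - g))" by simp
        also have "\<dots> = ?i h (h + (p - g)) + ?i (p - g) (h + (p - g))"
          using hV qV V by (intro bergman_inner_add cfun.subspace_add)
        also have "?i h (h + (p - g)) = ?i h h"
          using bergman_inner_add[OF hV qV hV] h0 bergman_inner_cnj[of h "h + (p - g)"]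
            bergman_inner_cnj[of "p - g" h] bergman_inner_cnj[of h h] by simp
        also have "?i (p - g) (h + (p - g)) = ?i (p - g) (p - g)"
          using bergman_inner_add[OF hV qV qV] h0 bergman_inner_cnj[of "p - g" "h + (p - g)"]
             bergman_inner_cnj[of "p - g" "p - g"] by simp
        finally have "Re (?i h h) + Re (?i (p - g) (p - g)) = Re (?i (\<lambda>z. f z - g z) (\<lambda>z. f z - g z))" by simp
        moreover have pos: "Re (?i q q) \<ge> 0" for q
        proof -
          have "?i q q = (LINT z:\<Omega>|lborel. complex_of_real ((cmod (q z))\<^sup>2))"
            unfolding bergman_inner_def by (simp only: complex_norm_square)
          also have "\<dots> = of_real (LINT z:\<Omega>|lborel. (cmod (q z))\<^sup>2)"
            by (rule set_integral_complex_of_real)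
          finally have "Re (?i q q) = (LINT z:\<Omega>|lborel. (cmod (q z))\<^sup>2)" by simp
          also have "\<dots> \<ge> 0"
            unfolding set_lebesgue_integral_def by (rule integral_nonneg_AE) auto
          finally show ?thesis .
        qed
        moreover have "Re (?i (\<lambda>z. f z - g z) (\<lambda>z. f z - g z)) < \<epsilon>\<^sup>2"
          using power_strict_mono[OF g(2), of 2] pos[of "\<lambda>z. f z - g z"] unfolding bergman_norm_def by simp
        ultimately show ?thesis using pos[of "p - g"] by linarith
      qed
      have "Re (?i h h) \<le> 0"
      proof (rule field_le_epsilon)
        fix d :: real assume "d > 0"
        then show "Re (?i h h) \<le> 0 + d" using le[of "sqrt d"] by simp
      qed
      then have "h = 0" by (rule i0[OF hV])
      then show ?thesis using hf by (simp add: p_def)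
    qed
    have "K z w = (\<Sum>a\<in>A. e a z * cnj (e a w))" using K z w by simp
    also have "\<dots> = (\<Sum>a\<in>A. (\<Sum>b\<in>B. ?i (e a) b * b z) * cnj (e a w))"
    proof (intro sum.cong refl)
      fix a assume "a \<in> A"
      then have "e a z = (\<Sum>b\<in>B. fun_scale (?i (e a) b) b) z" using expB[OF e] by metis
      then show "e a z * cnj (e a w) = (\<Sum>b\<in>B. ?i (e a) b * b z) * cnj (e a w)"
        by (simp add: sum_fun_apply fun_scale_def)
    qed
    also have "\<dots> = (\<Sum>b\<in>B. \<Sum>a\<in>A. ?i (e a) b * b z * cnj (e a w))"
      unfolding sum_distrib_right by (rule sum.swap)
    also have "\<dots> = (\<Sum>b\<in>B. b z * cnj (b w))"
    proof (intro sum.cong refl)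
      fix b assume b: "b \<in> B"
      have "b w = (\<Sum>a\<in>A. fun_scale (?i b (e a)) (e a)) w" using expand[OF BV[OF b]] by metis
      then have "cnj (b w) = (\<Sum>a\<in>A. ?i (e a) b * cnj (e a w))"
        by (simp add: sum_fun_apply fun_scale_def flip: bergman_inner_cnj)
      then show "(\<Sum>a\<in>A. ?i (e a) b * b z * cnj (e a w)) = b z * cnj (b w)"
        by (simp add: sum_distrib_left mult_ac)
    qed
    finally show ?thesis using has_sum_finite[OF finB] by simp
  qed
  ultimately show ?thesis unfolding is_bergman_kernel_def by blast
qed

end

section \<open>The Fubini-Study form\<close>

lemma has_derivative_ln_norm:
  fixes z :: "complex ^ 'n::finite"
  shows "((\<lambda>w. complex_of_real (ln (1 + (norm w)\<^sup>2))) has_derivative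
     (\<lambda>h. complex_of_real (2 * (z \<bullet> h) / (1 + (norm z)\<^sup>2)))) (at z)"
proof -
  have "1 + (norm z)\<^sup>2 > 0" by (simp add: add_pos_nonneg)
  then have "((\<lambda>w. ln (1 + (norm w)\<^sup>2)) has_derivative (\<lambda>h. 2 * (z \<bullet> h) / (1 + (norm z)\<^sup>2))) (at z)"
    unfolding power2_norm_eq_inner
    by (auto intro!: derivative_eq_intros simp: inner_commute divide_inverse algebra_simps)
  then show ?thesis by (rule has_derivative_of_real)
qed

lemma inner_axis_complex: "(z :: complex ^ 'n::finite) \<bullet> axis j c = Re (z $ j * cnj c)"
  by (simp add: inner_axis inner_complex_def)

lemma dzbar_ln_norm:
  fixes z :: "complex ^ 'n::finite"
  shows "dzbar k (\<lambda>w. complex_of_real (ln (1 + (norm w)\<^sup>2))) z = z $ k / of_real (1 + (norm z)\<^sup>2)"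
proof -
  define r where "r = 1 + (norm z)\<^sup>2"
  have r: "r \<noteq> 0" unfolding r_def by (smt (verit) zero_le_power2)
  have fd: "frechet_derivative (\<lambda>w. complex_of_real (ln (1 + (norm w)\<^sup>2))) (at z) =
     (\<lambda>h. complex_of_real (2 * (z \<bullet> h) / (1 + (norm z)\<^sup>2)))"
    by (rule frechet_derivative_at[OF has_derivative_ln_norm, symmetric])
  have "dzbar k (\<lambda>w. complex_of_real (ln (1 + (norm w)\<^sup>2))) z =
      (of_real (Re (z $ k)) + \<i> * of_real (Im (z $ k))) / of_real (1 + (norm z)\<^sup>2)"
    unfolding dzbar_def fd inner_axis_complex r_def[symmetric] using r by (simp add: field_simps)
  then show ?thesis by (simp add: complex_eq[symmetric])
qed

lemma has_derivative_dzbar_ln_norm: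
  fixes z :: "complex ^ 'n::finite"
  shows "((\<lambda>w. w $ k / complex_of_real (1 + (norm w)\<^sup>2)) has_derivative
     (\<lambda>h. h $ k / of_real (1 + (norm z)\<^sup>2) - z $ k * of_real (2 * (z \<bullet> h)) / (of_real (1 + (norm z)\<^sup>2))\<^sup>2)) (at z)"
proof -
  have nz: "complex_of_real (1 + (norm z)\<^sup>2) \<noteq> 0"
    by (simp only: of_real_eq_0_iff) (smt (verit) zero_le_power2)
  have 1: "((\<lambda>w. w $ k) has_derivative (\<lambda>h. h $ k)) (at z)"
    by (intro bounded_linear_imp_has_derivative bounded_linear_vec_nth)
  have "((\<lambda>w. 1 + (norm w)\<^sup>2) has_derivative (\<lambda>h. 2 * (z \<bullet> h))) (at z)"
    unfolding power2_norm_eq_inner by (auto intro!: derivative_eq_intros simp: inner_commute)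
  then have 2: "((\<lambda>w. complex_of_real (1 + (norm w)\<^sup>2)) has_derivative (\<lambda>h. complex_of_real (2 * (z \<bullet> h)))) (at z)"
    by (rule has_derivative_of_real)
  show ?thesis
    by (rule has_derivative_eq_rhs[OF has_derivative_divide[OF 1 2 nz]])
       (use nz in \<open>auto simp: fun_eq_iff divide_simps power2_eq_square algebra_simps\<close>)
qed

lemma dz_dzbar_ln_norm:
  fixes z :: "complex ^ 'n::finite"
  shows "dz j (dzbar k (\<lambda>w. complex_of_real (ln (1 + (norm w)\<^sup>2)))) z =
    (if j = k then 1 else 0) / of_real (1 + (norm z)\<^sup>2) - cnj (z $ j) * z $ k / (of_real (1 + (norm z)\<^sup>2))\<^sup>2"
proof -
  let ?N = "complex_of_real (1 + (norm z)\<^sup>2)"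
  have nz: "?N \<noteq> 0"
    by (simp only: of_real_eq_0_iff) (smt (verit) zero_le_power2)
  have "dzbar k (\<lambda>w. complex_of_real (ln (1 + (norm w)\<^sup>2))) = (\<lambda>w :: complex ^ 'n. w $ k / of_real (1 + (norm w)\<^sup>2))"
    by (rule ext) (rule dzbar_ln_norm)
  then have fd: "frechet_derivative (dzbar k (\<lambda>w. complex_of_real (ln (1 + (norm w)\<^sup>2)))) (at z) =
     (\<lambda>h. h $ k / ?N - z $ k * of_real (2 * (z \<bullet> h)) / ?N\<^sup>2)"
    using frechet_derivative_at[OF has_derivative_dzbar_ln_norm[of k z]] by simp
  have c: "cnj (z $ j) = of_real (Re (z $ j)) - \<i> * of_real (Im (z $ j))" by (simp add: complex_eq_iff)
  have "dz j (dzbar k (\<lambda>w. complex_of_real (ln (1 + (norm w)\<^sup>2)))) z =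
      ((if j = k then 1 else 0) / ?N - z $ k * of_real (2 * Re (z $ j)) / ?N\<^sup>2
       - \<i> * ((if j = k then \<i> else 0) / ?N - z $ k * of_real (2 * Im (z $ j)) / ?N\<^sup>2)) / 2"
    unfolding dz_def fd inner_axis_complex by (auto simp: axis_def)
  also have "\<dots> = (if j = k then 1 else 0) / ?N - cnj (z $ j) * z $ k / ?N\<^sup>2"
  proof -
    have "((if j = k then 1 else 0) / N - z $ k * of_real (2 * a) / N\<^sup>2
        - \<i> * ((if j = k then \<i> else 0) / N - z $ k * of_real (2 * b) / N\<^sup>2)) / 2
      = (if j = k then 1 else 0) / N - (of_real a - \<i> * of_real b) * z $ k / N\<^sup>2"
      if "N \<noteq> 0" for N :: complex and a b
      using that by (auto simp: field_simps power2_eq_square)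
    from this[OF nz] show ?thesis unfolding c .
  qed
  finally show ?thesis .
qed

lemma i_ddbar_affine_ln_norm:
  fixes z :: "complex ^ 'n::finite"
  shows "i_ddbar (\<lambda>w. c + of_nat m * ln (1 + (norm w)\<^sup>2)) z X Y = of_nat m * fubini_study_form z X Y"
proof -
  have bar: "dzbar k (\<lambda>w :: complex ^ 'n. complex_of_real (c + of_nat m * ln (1 + (norm w)\<^sup>2))) =
     (\<lambda>w. of_nat m * dzbar k (\<lambda>w. complex_of_real (ln (1 + (norm w)\<^sup>2))) w)" for k
  proof
    fix w :: "complex ^ 'n"
    have "((\<lambda>w. complex_of_real c + of_nat m * complex_of_real (ln (1 + (norm w)\<^sup>2))) has_derivative
        (\<lambda>h. 0 + of_nat m * complex_of_real (2 * (w \<bullet> h) / (1 + (norm w)\<^sup>2)))) (at w)"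
      by (intro has_derivative_add has_derivative_const has_derivative_mult_right has_derivative_ln_norm)
    then have "frechet_derivative (\<lambda>w. complex_of_real (c + of_nat m * ln (1 + (norm w)\<^sup>2))) (at w) =
       (\<lambda>h. of_nat m * complex_of_real (2 * (w \<bullet> h) / (1 + (norm w)\<^sup>2)))"
      by (intro frechet_derivative_at[symmetric]) simp
    moreover have "frechet_derivative (\<lambda>w. complex_of_real (ln (1 + (norm w)\<^sup>2))) (at w) =
       (\<lambda>h. complex_of_real (2 * (w \<bullet> h) / (1 + (norm w)\<^sup>2)))"
      by (rule frechet_derivative_at[OF has_derivative_ln_norm, symmetric])
    ultimately show "dzbar k (\<lambda>w :: complex ^ 'n. complex_of_real (c + of_nat m * ln (1 + (norm w)\<^sup>2))) w =
       of_nat m * dzbar k (\<lambda>w. complex_of_real (ln (1 + (norm w)\<^sup>2))) w"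
      by (simp add: dzbar_def algebra_simps)
  qed
  have "dz j (\<lambda>w. of_nat m * dzbar k (\<lambda>w. complex_of_real (ln (1 + (norm w)\<^sup>2))) w) z =
     of_nat m * dz j (dzbar k (\<lambda>w. complex_of_real (ln (1 + (norm w)\<^sup>2)))) z" for j k
  proof -
    have e: "dzbar k (\<lambda>w. complex_of_real (ln (1 + (norm w)\<^sup>2))) = (\<lambda>w :: complex ^ 'n. w $ k / of_real (1 + (norm w)\<^sup>2))"
      by (rule ext) (rule dzbar_ln_norm)
    have "frechet_derivative (\<lambda>w. of_nat m * (w $ k / complex_of_real (1 + (norm w)\<^sup>2))) (at z) =
      (\<lambda>h. of_nat m * (h $ k / of_real (1 + (norm z)\<^sup>2) - z $ k * of_real (2 * (z \<bullet> h)) / (of_real (1 + (norm z)\<^sup>2))\<^sup>2))"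
      by (rule frechet_derivative_at[symmetric]) (intro has_derivative_mult_right has_derivative_dzbar_ln_norm)
    moreover have "frechet_derivative (\<lambda>w. w $ k / complex_of_real (1 + (norm w)\<^sup>2)) (at z) =
      (\<lambda>h. h $ k / of_real (1 + (norm z)\<^sup>2) - z $ k * of_real (2 * (z \<bullet> h)) / (of_real (1 + (norm z)\<^sup>2))\<^sup>2)"
      by (rule frechet_derivative_at[symmetric]) (rule has_derivative_dzbar_ln_norm)
    ultimately show ?thesis
      unfolding e dz_def by (simp only:) (simp add: algebra_simps)
  qed
  then show ?thesis
    unfolding fubini_study_form_def i_ddbar_def bar
    by (simp add: sum_distrib_left mult_ac)
qed

text \<open>
  The metric is \<open>2 (\<parallel>X\<parallel>\<^sup>2 / N - \<bar>s\<bar>\<^sup>2 / N\<^sup>2)\<close>, where \<open>N = 1 + \<parallel>z\<parallel>\<^sup>2\<close> and \<open>s\<close> is the Hermitian product of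
  \<open>X\<close> and \<open>z\<close>; Cauchy-Schwarz bounds \<open>\<bar>s\<bar>\<^sup>2\<close> by \<open>(N - 1) \<parallel>X\<parallel>\<^sup>2\<close>.
\<close>

lemma fubini_study_metric_pos:
  fixes z X :: "complex ^ 'n::finite"
  assumes "X \<noteq> 0"
  shows "kaehler_metric fubini_study_form z X X > 0"
proof -
  define N where "N = 1 + (norm z)\<^sup>2"
  have N: "N > 0" by (simp add: N_def add_pos_nonneg)
  define s where "s = (\<Sum>j\<in>UNIV. cnj (z $ j) * X $ j)"
  have nX: "(\<Sum>j\<in>UNIV. X $ j * cnj (X $ j)) = of_real ((norm X)\<^sup>2)"
    by (simp add: norm_vec_def L2_set_def sum_nonneg complex_norm_square[symmetric])
  have "fubini_study_form z X (\<i> *s X) = \<i> * (\<Sum>j\<in>UNIV. \<Sum>k\<in>UNIV.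
      ((if j = k then 1 else 0) / of_real N - cnj (z $ j) * z $ k / (of_real N)\<^sup>2) * (- 2 * \<i> * (X $ j * cnj (X $ k))))"
    unfolding fubini_study_form_def i_ddbar_def dz_dzbar_ln_norm N_def[symmetric]
    by (intro arg_cong[where f = "(*) \<i>"] sum.cong refl) (simp add: algebra_simps)
  also have "\<dots> = 2 * (\<Sum>j\<in>UNIV. \<Sum>k\<in>UNIV. (if j = k then X $ j * cnj (X $ k) else 0) / of_real N
      - (cnj (z $ j) * X $ j) * cnj (cnj (z $ k) * X $ k) / (of_real N)\<^sup>2)"
    unfolding sum_distrib_left by (intro sum.cong refl) (auto simp: field_simps)
  also have "\<dots> = 2 * (of_real ((norm X)\<^sup>2) / of_real N - s * cnj s / (of_real N)\<^sup>2)"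
  proof -
    have "s * cnj s = (\<Sum>j\<in>UNIV. \<Sum>k\<in>UNIV. (cnj (z $ j) * X $ j) * cnj (cnj (z $ k) * X $ k))"
      unfolding s_def cnj_sum by (rule sum_product)
    then show ?thesis
      unfolding sum_subtractf by (simp only: sum_divide_distrib[symmetric]) (simp add: nX)
  qed
  also have "\<dots> = of_real (2 * ((norm X)\<^sup>2 / N - (cmod s)\<^sup>2 / N\<^sup>2))"
  proof -
    have "s * cnj s = of_real ((cmod s)\<^sup>2)" by (simp only: complex_norm_square)
    then show ?thesis by simp
  qed
  finally have eq: "kaehler_metric fubini_study_form z X X = 2 * ((norm X)\<^sup>2 / N - (cmod s)\<^sup>2 / N\<^sup>2)"
    by (simp add: kaehler_metric_def)
  have "cmod s \<le> (\<Sum>j\<in>UNIV. \<bar>norm (z $ j)\<bar> * \<bar>norm (X $ j)\<bar>)"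
    unfolding s_def by (rule order_trans[OF norm_sum]) (simp add: norm_mult)
  also have "\<dots> \<le> norm z * norm X"
    unfolding norm_vec_def by (rule L2_set_mult_ineq)
  finally have "(cmod s)\<^sup>2 \<le> (norm z * norm X)\<^sup>2" by (intro power_mono) auto
  then have "(cmod s)\<^sup>2 \<le> (N - 1) * (norm X)\<^sup>2" by (simp add: N_def power_mult_distrib)
  moreover have "(norm X)\<^sup>2 > 0" using assms by simp
  ultimately have "(cmod s)\<^sup>2 < N * (norm X)\<^sup>2" unfolding left_diff_distrib by linarith
  then show ?thesis unfolding eq using N by (simp add: field_simps power2_eq_square)
qed

section \<open>A connected skeleton of small volume\<close>

lemma open_modulus_box:
  assumes "\<And>j. open (A j)"
  shows "open (modulus_box A :: (complex ^ 'n::finite) set)"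
proof -
  have "modulus_box A = (\<Inter>j. (\<lambda>z :: complex ^ 'n. (cmod (z $ j))\<^sup>2) -` A j)"
    by (auto simp: modulus_box_def)
  also have "open \<dots>"
    by (intro open_INT ballI open_vimage assms continuous_intros) auto
  finally show ?thesis .
qed

lemma rotate_coord_in_modulus_box [simp]: "rotate_coord j \<phi> z \<in> modulus_box A \<longleftrightarrow> z \<in> modulus_box A"
  by (auto simp: modulus_box_def rotate_coord_nth norm_mult)

lemma modulus_box_mono: "(\<And>j. A j \<subseteq> B j) \<Longrightarrow> modulus_box A \<subseteq> modulus_box B"
  by (auto simp: modulus_box_def)

text \<open>
  A point with prescribed squared moduli, used to show that two sets meet.
\<close>

definition modulus_point :: "('n::finite \<Rightarrow> real) \<Rightarrow> complex ^ 'n" where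
  "modulus_point t = (\<chi> j. of_real (sqrt (t j)))"

lemma modulus_point_in_modulus_box:
  assumes "\<And>j. t j \<in> A j" "\<And>j. t j \<ge> 0"
  shows "modulus_point t \<in> modulus_box A"
  using assms by (simp add: modulus_point_def modulus_box_def)

lemma path_connected_vec_box:
  fixes S :: "'n::finite \<Rightarrow> complex set"
  assumes "\<And>j. path_connected (S j)"
  shows "path_connected {z :: complex ^ 'n. \<forall>j. z $ j \<in> S j}"
  unfolding path_connected_def
proof (intro ballI)
  fix x y :: "complex ^ 'n" assume xy: "x \<in> {z. \<forall>j. z $ j \<in> S j}" "y \<in> {z. \<forall>j. z $ j \<in> S j}"
  have "\<exists>g. path g \<and> path_image g \<subseteq> S j \<and> pathstart g = x $ j \<and> pathfinish g = y $ j" for j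
    using assms[of j] xy unfolding path_connected_def by blast
  then obtain g where g: "\<And>j. path (g j) \<and> path_image (g j) \<subseteq> S j \<and> pathstart (g j) = x $ j \<and> pathfinish (g j) = y $ j"
    by metis
  define G where "G t = (\<chi> j. g j t)" for t
  have "path G" unfolding path_def G_def
    by (rule continuous_on_vec_lambda) (use g in \<open>auto simp: path_def\<close>)
  moreover have "path_image G \<subseteq> {z. \<forall>j. z $ j \<in> S j}"
    using g by (auto simp: path_image_def G_def image_subset_iff)
  moreover have "pathstart G = x" "pathfinish G = y"
    using g by (auto simp: pathstart_def pathfinish_def G_def vec_eq_iff)
  ultimately show "\<exists>g. path g \<and> path_image g \<subseteq> {z. \<forall>j. z $ j \<in> S j} \<and> pathstart g = x \<and> pathfinish g = y"
    by blast
qed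

lemma path_connected_complex_annulus:
  "path_connected {w :: complex. (cmod w)\<^sup>2 \<in> {a<..<b}}"
proof (cases "a < 0")
  case True
  have "{w :: complex. (cmod w)\<^sup>2 \<in> {a<..<b}} = ball 0 (sqrt b)"
  proof (intro set_eqI)
    fix w :: complex
    have "(cmod w)\<^sup>2 < b \<longleftrightarrow> cmod w < sqrt b" using real_sqrt_less_iff[of "(cmod w)\<^sup>2" b] by simp
    moreover have "a < (cmod w)\<^sup>2" using True by (rule less_le_trans) simp
    ultimately show "w \<in> {w. (cmod w)\<^sup>2 \<in> {a<..<b}} \<longleftrightarrow> w \<in> ball 0 (sqrt b)" by simp
  qed
  then show ?thesis by (simp add: convex_imp_path_connected)
next
  case False
  have "{w :: complex. (cmod w)\<^sup>2 \<in> {a<..<b}} = {w. sqrt a < norm (w - 0) \<and> norm (w - 0) < sqrt b}"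
  proof (intro set_eqI)
    fix w :: complex
    have "(cmod w)\<^sup>2 < b \<longleftrightarrow> cmod w < sqrt b" using real_sqrt_less_iff[of "(cmod w)\<^sup>2" b] by simp
    moreover have "a < (cmod w)\<^sup>2 \<longleftrightarrow> sqrt a < cmod w" using real_sqrt_less_iff[of a "(cmod w)\<^sup>2"] by simp
    ultimately show "w \<in> {w. (cmod w)\<^sup>2 \<in> {a<..<b}} \<longleftrightarrow> w \<in> {w. sqrt a < norm (w - 0) \<and> norm (w - 0) < sqrt b}" by simp
  qed
  also have "path_connected \<dots>" by (rule path_connected_annulus) simp
  finally show ?thesis .
qed

lemma connected_modulus_box:
  assumes "\<And>j. \<exists>a b. A j = {a<..<b}"
  shows "connected (modulus_box A :: (complex ^ 'n::finite) set)"
proof -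
  have "path_connected {w :: complex. (cmod w)\<^sup>2 \<in> A j}" for j
    using assms[of j] path_connected_complex_annulus by auto
  from path_connected_vec_box[OF this] show ?thesis
    by (intro path_connected_imp_connected) (simp add: modulus_box_def)
qed

lemma emeasure_moment_measure:
  assumes "S \<in> sets borel" "bounded S" "S \<subseteq> {0..}"
  shows "emeasure (moment_measure k) S = ennreal (pi * power_integral k S)"
proof -
  have "emeasure (moment_measure k) S = (\<integral>\<^sup>+t. ennreal (pi * t ^ k) * indicator {0..} t * indicator S t \<partial>lborel)"
    unfolding moment_measure_def using assms by (intro emeasure_density) auto
  also have "\<dots> = (\<integral>\<^sup>+t. ennreal (indicator S t *\<^sub>R (pi * t ^ k)) \<partial>lborel)"
    using assms(3) by (intro nn_integral_cong) (auto simp: indicator_def)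
  also have "\<dots> = ennreal (\<integral>t. indicator S t *\<^sub>R (pi * t ^ k) \<partial>lborel)"
  proof (rule nn_integral_eq_integral)
    have "set_integrable lborel S (\<lambda>t. pi * t ^ k)"
      by (intro set_integrable_mult_right set_integrable_power assms)
    then show "integrable lborel (\<lambda>t. indicat_real S t *\<^sub>R (pi * t ^ k))" by (simp add: set_integrable_def)
    show "AE t in lborel. 0 \<le> indicat_real S t *\<^sub>R (pi * t ^ k)"
      using assms(3) by (intro AE_I2) (auto simp: indicator_def)
  qed
  also have "(\<integral>t. indicator S t *\<^sub>R (pi * t ^ k) \<partial>lborel) = pi * power_integral k S"
    unfolding power_integral_def set_lebesgue_integral_def by (simp add: mult.left_commute)
  finally show ?thesis .
qed

text \<open>
  The alternative \<open>b \<le> l\<close> serves intervals with \<open>a < 0\<close>, of which only the part from \<open>0\<close> to \<open>b\<close> counts.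
\<close>

lemma emeasure_moment_measure_le:
  assumes "a < b" "0 \<le> b" "b \<le> Y" "b - a \<le> l \<or> b \<le> l"
  shows "emeasure (moment_measure k) {a<..<b} \<le> ennreal (pi * Y ^ k * l)"
proof -
  have "emeasure (moment_measure k) {a<..<b} =
      (\<integral>\<^sup>+t. ennreal (pi * t ^ k) * indicator {0..} t * indicator {a<..<b} t \<partial>lborel)"
    unfolding moment_measure_def by (intro emeasure_density) auto
  also have "\<dots> \<le> (\<integral>\<^sup>+t. ennreal (pi * Y ^ k) * indicator {max a 0..b} t \<partial>lborel)"
    using assms by (intro nn_integral_mono) (auto simp: indicator_def intro!: ennreal_leI mult_left_mono power_mono)
  also have "\<dots> = ennreal (pi * Y ^ k) * ennreal (b - max a 0)"
    using assms by (subst nn_integral_cmult) auto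
  also have "\<dots> \<le> ennreal (pi * Y ^ k) * ennreal l"
    using assms by (intro mult_left_mono ennreal_leI) auto
  also have "\<dots> = ennreal (pi * Y ^ k * l)"
    using assms by (intro ennreal_mult[symmetric]) (auto intro: order_trans[of 0 b])
  finally show ?thesis .
qed

lemma emeasure_moment_measure_ge:
  assumes "0 \<le> a" "a \<le> b"
  shows "ennreal (pi * a ^ k * (b - a)) \<le> emeasure (moment_measure k) {a<..<b}"
proof -
  have "ennreal (pi * a ^ k * (b - a)) = ennreal (pi * a ^ k) * ennreal (b - a)"
    using assms by (intro ennreal_mult) auto
  also have "\<dots> = (\<integral>\<^sup>+t. ennreal (pi * a ^ k) * indicator {a<..<b} t \<partial>lborel)"
    using assms by (subst nn_integral_cmult) auto
  also have "\<dots> \<le> (\<integral>\<^sup>+t. ennreal (pi * t ^ k) * indicator {0..} t * indicator {a<..<b} t \<partial>lborel)"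
    using assms by (intro nn_integral_mono) (auto simp: indicator_def intro!: ennreal_leI mult_left_mono power_mono)
  also have "\<dots> = emeasure (moment_measure k) {a<..<b}"
    unfolding moment_measure_def by (intro emeasure_density[symmetric]) auto
  finally show ?thesis .
qed

lemma prod_mono_ennreal:
  fixes f g :: "'a \<Rightarrow> ennreal"
  assumes "\<And>x. f x \<le> g x"
  shows "prod f S \<le> prod g S"
  by (induction S rule: infinite_finite_induct) (auto intro: mult_mono assms)

lemma emeasure_monomial_measure_le:
  fixes \<alpha> :: "'n::finite \<Rightarrow> nat"
  assumes A: "\<And>j. \<exists>a b. A j = {a<..<b} \<and> a < b \<and> 0 \<le> b \<and> b \<le> Y \<and> (b - a \<le> l j \<or> b \<le> l j)"
    and l: "\<And>j. 0 \<le> l j" and Y: "1 \<le> Y" and \<alpha>: "multi_degree \<alpha> \<le> m"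
  shows "emeasure (monomial_measure \<alpha>) (modulus_box A) \<le> ennreal (pi ^ CARD('n) * Y ^ m * (\<Prod>j\<in>UNIV. l j))"
proof -
  have "A j \<in> sets borel" for j using A[of j] by auto
  then have "emeasure (monomial_measure \<alpha>) (modulus_box A) = (\<Prod>j\<in>UNIV. emeasure (moment_measure (\<alpha> j)) (A j))"
    by (rule emeasure_monomial_measure_modulus_box)
  also have "\<dots> \<le> (\<Prod>j\<in>UNIV. ennreal (pi * Y ^ \<alpha> j * l j))"
  proof (rule prod_mono_ennreal)
    fix j
    show "emeasure (moment_measure (\<alpha> j)) (A j) \<le> ennreal (pi * Y ^ \<alpha> j * l j)"
      using A[of j] emeasure_moment_measure_le by auto
  qed
  also have "\<dots> = ennreal (\<Prod>j\<in>UNIV. pi * Y ^ \<alpha> j * l j)"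
    using l Y by (intro prod_ennreal) auto
  also have "(\<Prod>j\<in>UNIV. pi * Y ^ \<alpha> j * l j) = pi ^ CARD('n) * Y ^ multi_degree \<alpha> * (\<Prod>j\<in>UNIV. l j)"
    by (simp add: prod.distrib multi_degree_def power_sum)
  also have "\<dots> \<le> pi ^ CARD('n) * Y ^ m * (\<Prod>j\<in>UNIV. l j)"
    using Y \<alpha> l by (intro mult_right_mono mult_left_mono power_increasing prod_nonneg) auto
  finally show ?thesis by (simp add: ennreal_leI)
qed

lemma prod_if_one_coord:
  fixes i :: "'n::finite"
  shows "(\<Prod>j\<in>UNIV. if j = i then p else q) = p * q ^ (CARD('n) - 1)"
proof -
  have "(\<Prod>j\<in>UNIV. if j = i then p else q) = p * (\<Prod>j\<in>UNIV - {i}. if j = i then p else q)"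
    by (subst prod.remove[of _ i]) auto
  also have "(\<Prod>j\<in>UNIV - {i}. if j = i then p else q) = (\<Prod>j\<in>UNIV - {i}. q)"
    by (intro prod.cong) auto
  finally show ?thesis by (simp add: card_Diff_singleton)
qed

lemma connected_Union_common:
  assumes "\<And>S. S \<in> F \<Longrightarrow> connected S \<and> x \<in> S"
  shows "connected (\<Union>F)"
  using assms by (intro connected_Union) auto

lemma connected_Un_meet:
  assumes "connected S" "connected T" "x \<in> S" "x \<in> T"
  shows "connected (S \<union> T)"
  using assms by (intro connected_Un) auto

text \<open>
  Everything is described by the squared moduli \<open>t\<close>. The coordinate \<open>i0\<close> is the one in which the pieces have
  the prescribed density, so they fall apart in this direction. In the coordinate \<open>i1\<close> each piece is
  continued down to a thin shelf that extends over the whole range of \<open>i0\<close> and reconnects it. All thin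
  parts have thickness at most \<open>\<kappa>\<close>, and \<open>\<kappa>\<close> does not exceed the gaps between the intervals of the grid.
\<close>

locale reinhardt_skeleton =
  fixes i0 i1 :: "'n::finite" and R :: "real set" and \<rho> X \<kappa> :: real and m :: nat
  assumes i01: "i0 \<noteq> i1" and finR: "finite R" and \<rho>: "\<rho> > 0" and \<kappa>: "0 < \<kappa>" "\<kappa> \<le> 1" and X: "1 \<le> X"
    and R_ge: "\<And>r. r \<in> R \<Longrightarrow> \<kappa> < r" and R_le: "\<And>r. r \<in> R \<Longrightarrow> r * (1 + \<rho>) \<le> X"
    and gap: "\<And>r r'. r \<in> R \<Longrightarrow> r' \<in> R \<Longrightarrow> r < r' \<Longrightarrow> r * (1 + \<rho>) \<le> r' - \<kappa>"
begin

definition bar :: "real set \<Rightarrow> real set \<Rightarrow> (complex ^ 'n) set" where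
  "bar A B = modulus_box (\<lambda>j. if j = i0 then A else B)"

text \<open>
  The lower bound \<open>c\<close> is \<open>- 1\<close> for the domain itself, which makes the coordinates free to vanish, and \<open>0\<close> for
  its part without zero coordinates. One proof of connectedness covers both.
\<close>

definition wall :: "real \<Rightarrow> (complex ^ 'n) set" where
  "wall c = bar {c<..<\<kappa>} {c<..<2 * X}"

definition shelf :: "real \<Rightarrow> real \<Rightarrow> (complex ^ 'n) set" where
  "shelf c r = modulus_box (\<lambda>j. if j = i1 then {r - \<kappa><..<r} else {c<..<2 * X})"

definition radius :: "nat \<Rightarrow> real" where
  "radius k = X * 4 ^ k"

text \<open>
  The exponent of \<open>radius k\<close> makes the slab contribute about \<open>\<kappa> / 2^k\<close> to a moment of order \<open>m\<close>. A moment of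
  order \<open>m + 1\<close> receives another factor \<open>radius k \<ge> 4^k\<close>, so that the contributions grow.
\<close>

definition width :: "nat \<Rightarrow> real" where
  "width k = \<kappa> * (1 / 2) ^ k / radius k ^ (m + CARD('n) - 1)"

text \<open>
  Rods and slabs alternate along the diagonal. The rod \<open>k\<close> raises the coordinate \<open>i0\<close> while the others stay
  near \<open>radius k\<close>; the slab \<open>k\<close> raises the others beyond the level of the rod \<open>k + 1\<close>, while \<open>i0\<close> stays near
  \<open>radius k\<close>. All coordinates of a point of the slab are comparable to \<open>radius k\<close>.
\<close>

definition slab :: "nat \<Rightarrow> (complex ^ 'n) set" where
  "slab k = bar {radius k<..<radius k + width k} {radius k<..<8 * radius k}"

definition rod :: "nat \<Rightarrow> (complex ^ 'n) set" where
  "rod k = bar {0<..<2 * radius k} {radius k<..<radius k + width k}"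

definition skeleton :: "real \<Rightarrow> (complex ^ 'n) set" where
  "skeleton c = wall c \<union> (\<Union>r\<in>R. shelf c r) \<union> (\<Union>k. slab k \<union> rod k)"

text \<open>
  The interval in the direction \<open>i1\<close> begins at \<open>r j - \<kappa>\<close>, so that the piece overlaps the shelf below it.
\<close>

definition piece :: "(('n \<Rightarrow> real) \<Rightarrow> real set) \<Rightarrow> ('n \<Rightarrow> real) \<Rightarrow> (complex ^ 'n) set" where
  "piece A r = modulus_box (\<lambda>j. if j = i0 then A r
     else if j = i1 then {r j - \<kappa><..<r j * (1 + \<rho>)} else mult_interval \<rho> (r j))"

definition nodes :: "('n \<Rightarrow> real) set" where
  "nodes = {r. \<forall>j. r j \<in> R}"

definition region :: "(('n \<Rightarrow> real) \<Rightarrow> real set) \<Rightarrow> real \<Rightarrow> (complex ^ 'n) set" where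
  "region A c = skeleton c \<union> (\<Union>r\<in>nodes. piece A r)"

lemma card_ge_2: "CARD('n) \<ge> 2"
proof -
  have "card {i0, i1} \<le> CARD('n)" by (intro card_mono) auto
  then show ?thesis using i01 by simp
qed

lemma radius_ge: "X \<le> radius k" "1 \<le> radius k" "0 < radius k" "0 \<le> radius k"
proof -
  have "X * 1 \<le> X * 4 ^ k" using X by (intro mult_left_mono) auto
  then show "X \<le> radius k" by (simp add: radius_def)
  with X show "1 \<le> radius k" "0 < radius k" "0 \<le> radius k" by auto
qed

lemma width_pos: "0 < width k"
  using \<kappa> radius_ge by (simp add: width_def)

lemma width_le: "width k \<le> 1"
proof -
  have "\<kappa> * (1 / 2) ^ k \<le> 1 * 1" using \<kappa> by (intro mult_mono power_le_one) auto
  also have "1 * 1 \<le> radius k ^ (m + CARD('n) - 1)" using one_le_power[OF radius_ge(2)[of k]] by simp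
  finally show ?thesis unfolding width_def using zero_less_power[OF radius_ge(3)[of k]] by (simp only: divide_le_eq_1_pos)
qed

lemma width_eq: "radius k ^ (m + CARD('n) - 1) * width k = \<kappa> * (1 / 2) ^ k"
  using radius_ge(3)[of k] by (simp add: width_def)

lemma open_bar: "open A \<Longrightarrow> open B \<Longrightarrow> open (bar A B)"
  unfolding bar_def by (rule open_modulus_box) auto

lemma open_skeleton: "open (skeleton c)"
  unfolding skeleton_def wall_def slab_def rod_def shelf_def
  by (intro open_Un open_UN ballI open_bar open_modulus_box) auto

lemma open_region:
  assumes "\<And>r. open (A r)"
  shows "open (region A c)"
  unfolding region_def piece_def mult_interval_def
  by (intro open_Un open_UN ballI open_skeleton open_modulus_box) (use assms in auto)

lemma rotation_closed_region: "rotation_closed (region A c)"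
  unfolding rotation_closed_def region_def skeleton_def wall_def slab_def rod_def shelf_def bar_def piece_def
  by auto

lemma zero_in_region: "0 \<in> region A (- 1)"
  using \<kappa> X by (simp add: region_def skeleton_def wall_def bar_def modulus_box_def)

lemma region_nonzero_coords:
  assumes A: "\<And>r. A r \<subseteq> {0<..}"
  shows "region A (- 1) \<inter> nonzero_coords = region A 0"
proof -
  have nz: "modulus_box B \<inter> nonzero_coords = modulus_box (\<lambda>j. B j \<inter> {0<..})" for B :: "'n \<Rightarrow> real set"
    by (auto simp: modulus_box_def nonzero_coords_def)
  have iv: "{a<..<b} \<inter> {0<..} = {max a 0<..<b}" for a b :: real by auto
  have 1: "wall (- 1) \<inter> nonzero_coords = wall 0"
    unfolding wall_def bar_def nz by (intro arg_cong[of _ _ modulus_box] ext) (auto simp: iv)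
  have 2: "shelf (- 1) r \<inter> nonzero_coords = shelf 0 r" if "r \<in> R" for r
    unfolding shelf_def nz using R_ge[OF that]
    by (intro arg_cong[of _ _ modulus_box] ext) (auto simp: iv)
  have 3: "slab k \<inter> nonzero_coords = slab k" for k
    unfolding slab_def bar_def nz using radius_ge(4)[of k]
    by (intro arg_cong[of _ _ modulus_box] ext) (auto simp: iv)
  have 4: "rod k \<inter> nonzero_coords = rod k" for k
    unfolding rod_def bar_def nz using radius_ge(4)[of k]
    by (intro arg_cong[of _ _ modulus_box] ext) (auto simp: iv)
  have 5: "piece A r \<inter> nonzero_coords = piece A r" if r: "r \<in> nodes" for r
  proof -
    have "\<kappa> < r j" for j using R_ge r by (auto simp: nodes_def)
    then have "0 \<le> r j - \<kappa>" "0 \<le> r j" for j using \<kappa> by (auto simp: less_imp_le intro: order_trans[of 0 \<kappa>])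
    then show ?thesis
      unfolding piece_def nz mult_interval_def using A[of r]
      by (intro arg_cong[of _ _ modulus_box] ext) (auto simp: iv max_absorb1)
  qed
  show ?thesis
  proof -
    have UN: "(\<Union>x\<in>I. S x) \<inter> nonzero_coords = (\<Union>x\<in>I. T x)"
      if "\<And>x. x \<in> I \<Longrightarrow> S x \<inter> nonzero_coords = T x"
      for I :: "'i set" and S T :: "'i \<Rightarrow> (complex ^ 'n) set"
      using that by blast
    have u2: "(\<Union>r\<in>R. shelf (- 1) r) \<inter> nonzero_coords = (\<Union>r\<in>R. shelf 0 r)" by (rule UN) (rule 2)
    have u3: "(\<Union>k. slab k \<union> rod k) \<inter> nonzero_coords = (\<Union>k. slab k \<union> rod k)"
      by (rule UN) (simp add: Int_Un_distrib2 3 4)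
    have u5: "(\<Union>r\<in>nodes. piece A r) \<inter> nonzero_coords = (\<Union>r\<in>nodes. piece A r)" by (rule UN) (rule 5)
    show ?thesis
      unfolding region_def skeleton_def by (simp only: Int_Un_distrib2 1 u2 u3 u5)
  qed
qed

lemma connected_bar: "connected (bar {a<..<b} {c<..<d})"
  unfolding bar_def by (rule connected_modulus_box) auto

lemma modulus_point_in_bar:
  assumes "s \<in> A" "t \<in> B" "0 \<le> s" "0 \<le> t"
  shows "modulus_point (\<lambda>j. if j = i0 then s else t) \<in> bar A B"
  unfolding bar_def by (rule modulus_point_in_modulus_box) (use assms in auto)

text \<open>
  The wall meets every shelf and the first rod, and each member of the tail meets the next. A point of a
  piece has a neighbourhood in the direction \<open>i0\<close> within the open set \<open>A r\<close>; the product over this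
  neighbourhood is connected and meets the shelf.
\<close>

lemma connected_region:
  assumes A: "\<And>r. open (A r)" "\<And>r. A r \<subseteq> mult_interval \<rho> (r i0)" and c: "c = 0 \<or> c = - 1"
  shows "connected (region A c)"
proof -
  define w where "w = modulus_point (\<lambda>j. if j = i0 then \<kappa> / 2 else 1)"
  have w: "w \<in> wall c"
    unfolding w_def wall_def by (rule modulus_point_in_bar) (use \<kappa> X c in auto)
  have conn_wall: "connected (wall c)" unfolding wall_def by (rule connected_bar)
  have conn_shelf: "connected (shelf c r)" for r
    unfolding shelf_def by (rule connected_modulus_box) auto
  have ws: "connected (wall c \<union> shelf c r)" if r: "r \<in> R" for r
  proof (rule connected_Un_meet[OF conn_wall conn_shelf])
    have k: "\<kappa> < r" "r * (1 + \<rho>) \<le> X" using R_ge R_le r by auto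
    moreover have "r * 1 \<le> r * (1 + \<rho>)" using k \<kappa> \<rho> by (intro mult_left_mono) auto
    ultimately have rX: "r \<le> X" by simp
    define t where "t j = (if j = i1 then r - \<kappa> / 2 else \<kappa> / 2)" for j
    show "modulus_point t \<in> wall c" unfolding wall_def bar_def
      by (rule modulus_point_in_modulus_box) (use k rX \<kappa> X c i01 in \<open>auto simp: t_def\<close>)
    show "modulus_point t \<in> shelf c r" unfolding shelf_def
      by (rule modulus_point_in_modulus_box) (use k rX \<kappa> X c i01 in \<open>auto simp: t_def\<close>)
  qed
  define tail where "tail k = rod k \<union> slab k" for k
  have conn_tail: "connected (tail k)" for k
    unfolding tail_def
  proof (rule connected_Un_meet)
    let ?x = "modulus_point (\<lambda>j :: 'n. radius k + width k / 2)"
    have x: "?x = modulus_point (\<lambda>j. if j = i0 then radius k + width k / 2 else radius k + width k / 2)"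
      by (simp add: if_distrib)
    show "?x \<in> rod k" "?x \<in> slab k"
      unfolding x rod_def slab_def
      by (rule modulus_point_in_bar; use radius_ge[of k] width_pos[of k] width_le[of k] in auto)+
  qed (auto simp: rod_def slab_def connected_bar)
  have chain: "connected (wall c \<union> (\<Union>i\<le>k. tail i))" for k
  proof (induction k)
    case 0
    have "connected (wall c \<union> tail 0)"
    proof (rule connected_Un_meet[OF conn_wall conn_tail])
      let ?x = "modulus_point (\<lambda>j. if j = i0 then \<kappa> / 2 else radius 0 + width 0 / 2)"
      show "?x \<in> wall c" unfolding wall_def
        by (rule modulus_point_in_bar) (use \<kappa> X c width_pos[of 0] width_le[of 0] in \<open>auto simp: radius_def\<close>)
      show "?x \<in> tail 0" unfolding tail_def rod_def
        by (rule UnI1, rule modulus_point_in_bar) (use \<kappa> X c width_pos[of 0] width_le[of 0] in \<open>auto simp: radius_def\<close>)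
    qed
    then show ?case by simp
  next
    case (Suc k)
    have "connected ((wall c \<union> (\<Union>i\<le>k. tail i)) \<union> tail (Suc k))"
    proof (rule connected_Un_meet[OF Suc conn_tail])
      let ?x = "modulus_point (\<lambda>j. if j = i0 then radius k + width k / 2 else radius (Suc k) + width (Suc k) / 2)"
      have r: "radius (Suc k) = 4 * radius k" by (simp add: radius_def)
      have "?x \<in> slab k" unfolding slab_def
        by (rule modulus_point_in_bar)
           (use radius_ge[of k] r width_pos[of k] width_le[of k] width_pos[of "Suc k"] width_le[of "Suc k"] in auto)
      then show "?x \<in> wall c \<union> (\<Union>i\<le>k. tail i)" by (auto simp: tail_def)
      show "?x \<in> tail (Suc k)" unfolding tail_def rod_def
        by (rule UnI1, rule modulus_point_in_bar)
           (use radius_ge[of k] r width_pos[of k] width_le[of k] width_pos[of "Suc k"] width_le[of "Suc k"] in auto)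
    qed
    then show ?case by (simp add: atMost_Suc Un_ac)
  qed
  have piece_in: "\<exists>S. connected S \<and> w \<in> S \<and> z \<in> S \<and> S \<subseteq> region A c" if r: "r \<in> nodes" and z: "z \<in> piece A r" for r z
  proof -
    have rR: "r j \<in> R" for j using r by (simp add: nodes_def)
    have rj: "\<kappa> < r j" "r j * (1 + \<rho>) \<le> X" "r j < r j * (1 + \<rho>)" for j
    proof -
      show *: "\<kappa> < r j" "r j * (1 + \<rho>) \<le> X" using R_ge R_le rR by auto
      have "0 < r j * \<rho>" using * \<kappa> \<rho> by (intro mult_pos_pos) auto
      then show "r j < r j * (1 + \<rho>)" by (simp add: distrib_left)
    qed
    define s where "s = (cmod (z $ i0))\<^sup>2"
    have s: "s \<in> A r" using z by (auto simp: s_def piece_def modulus_box_def dest: spec[of _ i0])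
    obtain e where e: "e > 0" "ball s e \<subseteq> A r" using A(1)[of r] s openE by blast
    have ball: "ball s e = {s - e<..<s + e}" by (auto simp: dist_real_def)
    define P where "P = (modulus_box (\<lambda>j. if j = i0 then {s - e<..<s + e}
       else if j = i1 then {r j - \<kappa><..<r j * (1 + \<rho>)} else mult_interval \<rho> (r j)) :: (complex ^ 'n) set)"
    have "connected P" unfolding P_def mult_interval_def by (rule connected_modulus_box) auto
    have zP: "z \<in> P"
      unfolding P_def modulus_box_def
    proof (intro CollectI allI)
      fix j
      have "(cmod (z $ j))\<^sup>2 \<in> (if j = i0 then A r
        else if j = i1 then {r j - \<kappa><..<r j * (1 + \<rho>)} else mult_interval \<rho> (r j))"
        using z by (simp add: piece_def modulus_box_def)
      then show "(cmod (z $ j))\<^sup>2 \<in> (if j = i0 then {s - e<..<s + e}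
        else if j = i1 then {r j - \<kappa><..<r j * (1 + \<rho>)} else mult_interval \<rho> (r j))"
        using e by (auto simp: s_def)
    qed
    have PA: "P \<subseteq> piece A r" unfolding P_def piece_def using e ball by (intro modulus_box_mono) auto
    define t where "t j = (if j = i0 then s else if j = i1 then r j - \<kappa> / 2 else (r j + r j * (1 + \<rho>)) / 2)" for j
    have s2: "\<kappa> < s" "s < X"
      using s A(2)[of r] rj[of i0] by (auto simp: mult_interval_def)
    have t0: "0 \<le> t j" for j using rj[of j] s2 \<kappa> by (auto simp: t_def)
    have xP: "modulus_point t \<in> P"
      unfolding P_def
    proof (rule modulus_point_in_modulus_box[OF _ t0])
      fix j show "t j \<in> (if j = i0 then {s - e<..<s + e}
       else if j = i1 then {r j - \<kappa><..<r j * (1 + \<rho>)} else mult_interval \<rho> (r j))"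
        using e rj[of j] \<kappa> by (auto simp: t_def mult_interval_def field_simps)
    qed
    have xS: "modulus_point t \<in> shelf c (r i1)"
      unfolding shelf_def
    proof (rule modulus_point_in_modulus_box[OF _ t0])
      fix j show "t j \<in> (if j = i1 then {r i1 - \<kappa><..<r i1} else {c<..<2 * X})"
        using rj[of j] s2 \<kappa> X c i01 by (auto simp: t_def field_simps)
    qed
    have "connected ((wall c \<union> shelf c (r i1)) \<union> P)"
      by (rule connected_Un_meet[OF ws[OF rR] \<open>connected P\<close> _ xP]) (use xS in simp)
    moreover have "(wall c \<union> shelf c (r i1)) \<union> P \<subseteq> region A c"
      using PA r rR[of i1] by (auto simp: region_def skeleton_def)
    ultimately show ?thesis using w zP by blast
  qed
  have "region A c \<subseteq> \<Union>{S. connected S \<and> w \<in> S \<and> S \<subseteq> region A c}"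
  proof
    fix z assume "z \<in> region A c"
    then consider "z \<in> wall c" | r where "r \<in> R" "z \<in> shelf c r" | k where "z \<in> tail k" | r where "r \<in> nodes" "z \<in> piece A r"
      by (auto simp: region_def skeleton_def tail_def)
    then show "z \<in> \<Union>{S. connected S \<and> w \<in> S \<and> S \<subseteq> region A c}"
    proof cases
      case 1
      then show ?thesis using conn_wall w by (intro UnionI[of "wall c"]) (auto simp: region_def skeleton_def)
    next
      case 2
      then show ?thesis using ws[of r] w by (intro UnionI[of "wall c \<union> shelf c r"]) (auto simp: region_def skeleton_def)
    next
      case 3
      then show ?thesis using chain[of k] w
        by (intro UnionI[of "wall c \<union> (\<Union>i\<le>k. tail i)"]) (auto simp: region_def skeleton_def tail_def)
    next
      case 4
      then show ?thesis using piece_in[of r z] by blast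
    qed
  qed
  then have "region A c = \<Union>{S. connected S \<and> w \<in> S \<and> S \<subseteq> region A c}" by blast
  moreover have "connected (\<Union>{S. connected S \<and> w \<in> S \<and> S \<subseteq> region A c})"
    by (rule connected_Union_common[of _ w]) auto
  ultimately show ?thesis by simp
qed

lemma unbounded_region: "\<not> bounded (region A c)"
proof
  assume "bounded (region A c)"
  then obtain b where b: "\<And>z. z \<in> region A c \<Longrightarrow> norm z \<le> b" by (auto simp: bounded_iff)
  obtain k where k: "\<bar>b\<bar>\<^sup>2 < 4 ^ k" using real_arch_pow[of 4 "\<bar>b\<bar>\<^sup>2"] by auto
  let ?x = "modulus_point (\<lambda>j. if j = i0 then radius k + width k / 2 else 2 * radius k) :: complex ^ 'n"
  have "?x \<in> slab k" unfolding slab_def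
    by (rule modulus_point_in_bar) (use radius_ge[of k] width_pos[of k] in auto)
  then have "norm ?x \<le> b" by (intro b) (auto simp: region_def skeleton_def)
  then have "cmod (?x $ i0) \<le> b" using Finite_Cartesian_Product.norm_nth_le[of ?x i0] by (rule order_trans[rotated])
  then have "sqrt (radius k + width k / 2) \<le> b" using radius_ge[of k] width_pos[of k] by (simp add: modulus_point_def)
  moreover have "\<bar>b\<bar> < sqrt (radius k + width k / 2)"
  proof (rule real_less_rsqrt)
    have "4 ^ k \<le> radius k" using X by (simp add: radius_def)
    then show "\<bar>b\<bar>\<^sup>2 < radius k + width k / 2" using k width_pos[of k] by linarith
  qed
  ultimately show False by linarith
qed

text \<open>
  The bound does not involve \<open>\<kappa>\<close>, so the moments of the skeleton are small with \<open>\<kappa>\<close>.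
\<close>

definition skeleton_bound :: real where
  "skeleton_bound = pi ^ CARD('n) *
     ((1 + real (card R)) * (2 * X) ^ (m + CARD('n) - 1) + 2 * (8 ^ (m + CARD('n) - 1) + 2 ^ (m + 1)))"

lemma emeasure_bar_le:
  assumes A: "a < b" "0 \<le> b" "b \<le> Y" "b - a \<le> p \<or> b \<le> p"
    and B: "a' < b'" "0 \<le> b'" "b' \<le> Y" "b' - a' \<le> q \<or> b' \<le> q"
    and pq: "0 \<le> p" "0 \<le> q" and Y: "1 \<le> Y" and \<alpha>: "multi_degree \<alpha> \<le> m"
  shows "emeasure (monomial_measure \<alpha>) (modulus_box (\<lambda>j :: 'n. if j = i then {a<..<b} else {a'<..<b'}))
    \<le> ennreal (pi ^ CARD('n) * Y ^ m * (p * q ^ (CARD('n) - 1)))"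
proof -
  have ex: "\<exists>u v. (if j = i then {a<..<b} else {a'<..<b'}) = {u<..<v} \<and> u < v \<and> 0 \<le> v \<and> v \<le> Y \<and>
     (v - u \<le> (if j = i then p else q) \<or> v \<le> (if j = i then p else q))" for j
  proof (cases "j = i")
    case True
    with A show ?thesis by (intro exI[of _ a] exI[of _ b]) auto
  next
    case False
    with B show ?thesis by (intro exI[of _ a'] exI[of _ b']) auto
  qed
  have "emeasure (monomial_measure \<alpha>) (modulus_box (\<lambda>j :: 'n. if j = i then {a<..<b} else {a'<..<b'}))
    \<le> ennreal (pi ^ CARD('n) * Y ^ m * (\<Prod>j\<in>(UNIV :: 'n set). if j = i then p else q))"
    by (rule emeasure_monomial_measure_le[OF ex _ Y \<alpha>]) (use pq in auto)
  then show ?thesis by (simp only: prod_if_one_coord)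
qed

lemma power_card_split:
  fixes y :: real
  shows "y ^ m * y ^ (CARD('n) - 1) = y ^ (m + CARD('n) - 1)"
  using card_ge_2 by (simp flip: power_add)

lemma emeasure_wall_le:
  assumes "multi_degree \<alpha> \<le> m"
  shows "emeasure (monomial_measure \<alpha>) (wall (- 1)) \<le> ennreal (\<kappa> * (pi ^ CARD('n) * (2 * X) ^ (m + CARD('n) - 1)))"
proof -
  have "emeasure (monomial_measure \<alpha>) (wall (- 1)) \<le>
      ennreal (pi ^ CARD('n) * (2 * X) ^ m * (\<kappa> * (2 * X) ^ (CARD('n) - 1)))"
    unfolding wall_def bar_def
    by (rule emeasure_bar_le) (use \<kappa> X assms in auto)
  also have "pi ^ CARD('n) * (2 * X) ^ m * (\<kappa> * (2 * X) ^ (CARD('n) - 1)) =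
      \<kappa> * (pi ^ CARD('n) * (2 * X) ^ (m + CARD('n) - 1))"
    unfolding power_card_split[symmetric] by (simp add: mult_ac)
  finally show ?thesis .
qed

lemma emeasure_shelf_le:
  assumes "multi_degree \<alpha> \<le> m" and r: "r \<in> R"
  shows "emeasure (monomial_measure \<alpha>) (shelf (- 1) r) \<le> ennreal (\<kappa> * (pi ^ CARD('n) * (2 * X) ^ (m + CARD('n) - 1)))"
proof -
  have k: "\<kappa> < r" "r * (1 + \<rho>) \<le> X" using R_ge R_le r by auto
  moreover have "r * 1 \<le> r * (1 + \<rho>)" using k \<kappa> \<rho> by (intro mult_left_mono) auto
  ultimately have rX: "r \<le> X" by simp
  have "emeasure (monomial_measure \<alpha>) (shelf (- 1) r) \<le>
      ennreal (pi ^ CARD('n) * (2 * X) ^ m * (\<kappa> * (2 * X) ^ (CARD('n) - 1)))"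
    unfolding shelf_def
    by (rule emeasure_bar_le)
       (use k rX \<kappa> X assms in auto)
  also have "pi ^ CARD('n) * (2 * X) ^ m * (\<kappa> * (2 * X) ^ (CARD('n) - 1)) =
      \<kappa> * (pi ^ CARD('n) * (2 * X) ^ (m + CARD('n) - 1))"
    unfolding power_card_split[symmetric] by (simp add: mult_ac)
  finally show ?thesis .
qed

lemma emeasure_slab_le:
  assumes "multi_degree \<alpha> \<le> m"
  shows "emeasure (monomial_measure \<alpha>) (slab k) \<le> ennreal (\<kappa> * (pi ^ CARD('n) * 8 ^ (m + CARD('n) - 1)) * (1 / 2) ^ k)"
proof -
  have "emeasure (monomial_measure \<alpha>) (slab k) \<le>
      ennreal (pi ^ CARD('n) * (8 * radius k) ^ m * (width k * (8 * radius k) ^ (CARD('n) - 1)))"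
    unfolding slab_def bar_def
    by (rule emeasure_bar_le)
       (use radius_ge[of k] width_pos[of k] width_le[of k] assms in auto)
  also have "pi ^ CARD('n) * (8 * radius k) ^ m * (width k * (8 * radius k) ^ (CARD('n) - 1)) =
      pi ^ CARD('n) * ((8 * radius k) ^ m * (8 * radius k) ^ (CARD('n) - 1)) * width k"
    by (simp add: mult_ac)
  also have "\<dots> = pi ^ CARD('n) * 8 ^ (m + CARD('n) - 1) * (radius k ^ (m + CARD('n) - 1) * width k)"
    unfolding power_card_split by (simp add: power_mult_distrib)
  also have "\<dots> = \<kappa> * (pi ^ CARD('n) * 8 ^ (m + CARD('n) - 1)) * (1 / 2) ^ k"
    unfolding width_eq by (simp add: mult_ac)
  finally show ?thesis .
qed

lemma emeasure_rod_le:
  assumes "multi_degree \<alpha> \<le> m"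
  shows "emeasure (monomial_measure \<alpha>) (rod k) \<le> ennreal (\<kappa> * (pi ^ CARD('n) * 2 ^ (m + 1)) * (1 / 2) ^ k)"
proof -
  have "emeasure (monomial_measure \<alpha>) (rod k) \<le>
      ennreal (pi ^ CARD('n) * (2 * radius k) ^ m * (2 * radius k * width k ^ (CARD('n) - 1)))"
    unfolding rod_def bar_def
    by (rule emeasure_bar_le)
       (use radius_ge[of k] width_pos[of k] width_le[of k] assms in auto)
  also have "\<dots> \<le> ennreal (pi ^ CARD('n) * (2 * radius k) ^ m * (2 * radius k * width k))"
  proof (intro ennreal_leI mult_left_mono)
    have "width k ^ (CARD('n) - 1) \<le> width k ^ 1"
      using card_ge_2 width_pos[of k] width_le[of k] by (intro power_decreasing) auto
    then show "width k ^ (CARD('n) - 1) \<le> width k" by simp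
  qed (use radius_ge[of k] in auto)
  also have "pi ^ CARD('n) * (2 * radius k) ^ m * (2 * radius k * width k) =
      pi ^ CARD('n) * 2 ^ (m + 1) * (radius k ^ (m + 1) * width k)"
    by (simp add: power_mult_distrib mult_ac)
  also have "\<dots> \<le> pi ^ CARD('n) * 2 ^ (m + 1) * (radius k ^ (m + CARD('n) - 1) * width k)"
    using card_ge_2 radius_ge[of k] width_pos[of k]
    by (intro mult_left_mono mult_right_mono power_increasing) auto
  also have "\<dots> = \<kappa> * (pi ^ CARD('n) * 2 ^ (m + 1)) * (1 / 2) ^ k"
    unfolding width_eq by (simp add: mult_ac)
  finally show ?thesis by (simp add: ennreal_leI)
qed

lemma emeasure_skeleton_le:
  assumes \<alpha>: "multi_degree \<alpha> \<le> m"
  shows "emeasure (monomial_measure \<alpha>) (skeleton (- 1)) \<le> ennreal (\<kappa> * skeleton_bound)"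
proof -
  let ?M = "emeasure (monomial_measure \<alpha>)"
  let ?b = "\<kappa> * (pi ^ CARD('n) * (2 * X) ^ (m + CARD('n) - 1))"
  let ?s = "\<kappa> * (pi ^ CARD('n) * (8 ^ (m + CARD('n) - 1) + 2 ^ (m + 1)))"
  have sets: "S \<in> sets (monomial_measure \<alpha>)" if "open S" for S using that by simp
  have op: "open (wall (- 1))" "open (shelf (- 1) r)" "open (slab k)" "open (rod k)" for r k
    unfolding wall_def slab_def rod_def shelf_def by (intro open_bar open_modulus_box; auto)+
  have b0: "0 \<le> ?b" using \<kappa> X by simp
  have s0: "0 \<le> ?s" using \<kappa> by (simp add: add_nonneg_nonneg)
  have "?M (\<Union>r\<in>R. shelf (- 1) r) \<le> (\<Sum>r\<in>R. ?M (shelf (- 1) r))"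
    by (rule emeasure_subadditive_finite[OF finR]) (use op in auto)
  also have "\<dots> \<le> (\<Sum>r\<in>R. ennreal ?b)"
    by (intro sum_mono emeasure_shelf_le \<alpha>)
  also have "\<dots> = ennreal (real (card R) * ?b)"
    using b0 by (simp add: ennreal_mult ennreal_of_nat_eq_real_of_nat)
  finally have sh: "?M (\<Union>r\<in>R. shelf (- 1) r) \<le> ennreal (real (card R) * ?b)" .
  have "?M (\<Union>k. slab k \<union> rod k) \<le> (\<Sum>k. ?M (slab k \<union> rod k))"
    by (rule emeasure_subadditive_countably) (use op in auto)
  also have "\<dots> \<le> (\<Sum>k. ennreal (?s * (1 / 2) ^ k))"
  proof (intro suminf_le allI)
    fix k
    have "?M (slab k \<union> rod k) \<le> ?M (slab k) + ?M (rod k)"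
      by (rule emeasure_subadditive) (use op in auto)
    also have "\<dots> \<le> ennreal (\<kappa> * (pi ^ CARD('n) * 8 ^ (m + CARD('n) - 1)) * (1 / 2) ^ k) +
        ennreal (\<kappa> * (pi ^ CARD('n) * 2 ^ (m + 1)) * (1 / 2) ^ k)"
      by (intro add_mono emeasure_slab_le emeasure_rod_le \<alpha>)
    also have "\<dots> = ennreal (?s * (1 / 2) ^ k)"
      using \<kappa> by (subst ennreal_plus[symmetric]) (auto simp: algebra_simps)
    finally show "?M (slab k \<union> rod k) \<le> ennreal (?s * (1 / 2) ^ k)" .
  qed auto
  also have "\<dots> = ennreal (?s * 2)"
  proof (rule suminf_ennreal_eq)
    have "(\<lambda>k. (1 / 2 :: real) ^ k) sums (1 / (1 - 1 / 2))" by (rule geometric_sums) simp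
    from sums_mult[OF this, of ?s] show "(\<lambda>k. ?s * (1 / 2) ^ k) sums (?s * 2)" by simp
  qed (use s0 in simp)
  finally have tl: "?M (\<Union>k. slab k \<union> rod k) \<le> ennreal (?s * 2)" .
  have "?M (skeleton (- 1)) \<le> ?M (wall (- 1) \<union> (\<Union>r\<in>R. shelf (- 1) r)) + ?M (\<Union>k. slab k \<union> rod k)"
    unfolding skeleton_def by (rule emeasure_subadditive; intro sets open_Un open_UN ballI op)
  also have "?M (wall (- 1) \<union> (\<Union>r\<in>R. shelf (- 1) r)) \<le> ?M (wall (- 1)) + ?M (\<Union>r\<in>R. shelf (- 1) r)"
    by (rule emeasure_subadditive; intro sets open_Un open_UN ballI op)
  finally have "?M (skeleton (- 1)) \<le> ?M (wall (- 1)) + ?M (\<Union>r\<in>R. shelf (- 1) r) + ?M (\<Union>k. slab k \<union> rod k)"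
    by (simp add: add_right_mono)
  also have "\<dots> \<le> ennreal ?b + ennreal (real (card R) * ?b) + ennreal (?s * 2)"
    by (intro add_mono emeasure_wall_le[OF \<alpha>] sh tl)
  also have "\<dots> = ennreal (?b + real (card R) * ?b + ?s * 2)"
    using b0 s0 by (simp add: ennreal_plus)
  also have "?b + real (card R) * ?b + ?s * 2 = \<kappa> * skeleton_bound"
    by (simp add: skeleton_bound_def algebra_simps)
  finally show ?thesis .
qed

text \<open>
  The slabs alone suffice: the contribution of the \<open>k\<close>-th one is at least \<open>\<kappa> 2^k\<close>.
\<close>

lemma emeasure_region_infinite:
  assumes A: "\<And>r. open (A r)" and \<alpha>: "multi_degree \<alpha> > m"
  shows "emeasure (monomial_measure \<alpha>) (region A c) = \<infinity>"
proof -
  have low: "ennreal (\<kappa> * 2 ^ k) \<le> emeasure (monomial_measure \<alpha>) (region A c)" for k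
  proof -
    define L where "L j = (if j = i0 then width k else 7 * radius k)" for j :: 'n
    have "\<kappa> * 2 ^ k \<le> radius k * (radius k ^ (m + CARD('n) - 1) * width k)"
    proof -
      have "(4::real) ^ k * (1 / 2) ^ k = 2 ^ k" by (simp add: power_mult_distrib[symmetric])
      then have "\<kappa> * 2 ^ k = 4 ^ k * (\<kappa> * (1 / 2) ^ k)" by (simp add: mult.left_commute)
      also have "\<dots> \<le> radius k * (\<kappa> * (1 / 2) ^ k)"
        using X \<kappa> by (intro mult_right_mono) (auto simp: radius_def)
      finally show ?thesis unfolding width_eq .
    qed
    also have "\<dots> = radius k ^ (Suc m) * (width k * radius k ^ (CARD('n) - 1))"
      unfolding power_card_split[symmetric] by simp
    also have "\<dots> \<le> radius k ^ multi_degree \<alpha> * (width k * (7 * radius k) ^ (CARD('n) - 1))"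
      using \<alpha> radius_ge[of k] width_pos[of k]
      by (intro mult_mono power_increasing power_mono) auto
    also have "\<dots> \<le> pi ^ CARD('n) * (radius k ^ multi_degree \<alpha> * (width k * (7 * radius k) ^ (CARD('n) - 1)))"
    proof -
      have "1 \<le> pi ^ CARD('n)" using pi_gt3 by (intro one_le_power) simp
      moreover have "0 \<le> radius k ^ multi_degree \<alpha> * (width k * (7 * radius k) ^ (CARD('n) - 1))"
        using radius_ge[of k] width_pos[of k] by simp
      ultimately show ?thesis using mult_right_mono by fastforce
    qed
    also have "\<dots> = (\<Prod>j\<in>UNIV. pi * radius k ^ \<alpha> j * L j)"
      by (simp add: prod.distrib L_def prod_if_one_coord multi_degree_def power_sum)
    finally have "ennreal (\<kappa> * 2 ^ k) \<le> ennreal (\<Prod>j\<in>UNIV. pi * radius k ^ \<alpha> j * L j)" by (rule ennreal_leI)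
    also have "\<dots> = (\<Prod>j\<in>UNIV. ennreal (pi * radius k ^ \<alpha> j * L j))"
      using radius_ge[of k] width_pos[of k] by (intro prod_ennreal[symmetric]) (auto simp: L_def)
    also have "\<dots> \<le> (\<Prod>j\<in>UNIV. emeasure (moment_measure (\<alpha> j))
        (if j = i0 then {radius k<..<radius k + width k} else {radius k<..<8 * radius k}))"
    proof (rule prod_mono_ennreal)
      fix j
      show "ennreal (pi * radius k ^ \<alpha> j * L j) \<le> emeasure (moment_measure (\<alpha> j))
          (if j = i0 then {radius k<..<radius k + width k} else {radius k<..<8 * radius k})"
        using emeasure_moment_measure_ge[of "radius k" "radius k + width k" "\<alpha> j"]
          emeasure_moment_measure_ge[of "radius k" "8 * radius k" "\<alpha> j"] radius_ge[of k] width_pos[of k]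
        by (cases "j = i0") (auto simp: L_def)
    qed
    also have "\<dots> = emeasure (monomial_measure \<alpha>) (slab k)"
      unfolding slab_def bar_def by (rule emeasure_monomial_measure_modulus_box[symmetric]) auto
    also have "\<dots> \<le> emeasure (monomial_measure \<alpha>) (region A c)"
      by (rule emeasure_mono) (use open_region[of A c] A in \<open>auto simp: region_def skeleton_def\<close>)
    finally show ?thesis .
  qed
  show ?thesis
  proof (rule ccontr)
    assume "emeasure (monomial_measure \<alpha>) (region A c) \<noteq> \<infinity>"
    then obtain v where v: "emeasure (monomial_measure \<alpha>) (region A c) = ennreal v" "0 \<le> v"
      by (cases "emeasure (monomial_measure \<alpha>) (region A c)") auto
    obtain k where "v / \<kappa> < 2 ^ k" using real_arch_pow[of 2 "v / \<kappa>"] by auto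
    then have "v < \<kappa> * 2 ^ k" using \<kappa> by (simp add: field_simps)
    moreover have "\<kappa> * 2 ^ k \<le> v" using low[of k] v by simp
    ultimately show False by simp
  qed
qed

text \<open>
  The part of a piece outside the skeleton, where the half-open interval in the direction \<open>i1\<close> removes the
  overlap with the shelf. Its moments are exactly the density times those of a box, which makes the
  total moments of the domain linear in the densities.
\<close>

definition core :: "(('n \<Rightarrow> real) \<Rightarrow> real set) \<Rightarrow> ('n \<Rightarrow> real) \<Rightarrow> (complex ^ 'n) set" where
  "core A r = modulus_box (\<lambda>j. if j = i0 then A r
     else if j = i1 then {r j..<r j * (1 + \<rho>)} else mult_interval \<rho> (r j))"

lemma finite_nodes: "finite nodes"
proof -
  have "nodes = (\<Pi>\<^sub>E j\<in>UNIV. R)" by (auto simp: nodes_def PiE_def)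
  then show ?thesis using finR by (simp add: finite_PiE)
qed

lemma core_coord:
  assumes A: "\<And>r. A r \<subseteq> mult_interval \<rho> (r i0)" and z: "z \<in> core A r"
  shows "(cmod (z $ j))\<^sup>2 \<in> {r j..<r j * (1 + \<rho>)}"
proof -
  have "(cmod (z $ j))\<^sup>2 \<in> (if j = i0 then A r
     else if j = i1 then {r j..<r j * (1 + \<rho>)} else mult_interval \<rho> (r j))"
    using z by (simp add: core_def modulus_box_def)
  then show ?thesis using A[of r] by (auto simp: mult_interval_def split: if_splits)
qed

lemma R_disjoint:
  assumes "r \<in> R" "r' \<in> R" "t \<in> {r..<r * (1 + \<rho>)}" "t \<in> {r'..<r' * (1 + \<rho>)}"
  shows "r = r'"
proof (rule ccontr)
  assume "r \<noteq> r'"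
  then consider "r < r'" | "r' < r" by linarith
  then show False
  proof cases
    case 1 then show False using gap[OF assms(1,2)] assms(3,4) \<kappa> by auto
  next
    case 2 then show False using gap[OF assms(2,1)] assms(3,4) \<kappa> by auto
  qed
qed

lemma region_eq_core:
  assumes A: "\<And>r. A r \<subseteq> mult_interval \<rho> (r i0)"
  shows "region A (- 1) = skeleton (- 1) \<union> (\<Union>r\<in>nodes. core A r)"
proof -
  have "core A r \<subseteq> piece A r" for r
    unfolding core_def piece_def using \<kappa> by (intro modulus_box_mono) auto
  moreover have "z \<in> core A r \<union> shelf (- 1) (r i1)" if r: "r \<in> nodes" and z: "z \<in> piece A r" for r z
  proof -
    have zj: "(cmod (z $ j))\<^sup>2 \<in> (if j = i0 then A r
       else if j = i1 then {r j - \<kappa><..<r j * (1 + \<rho>)} else mult_interval \<rho> (r j))" for j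
      using z by (simp add: piece_def modulus_box_def)
    show ?thesis
    proof (cases "(cmod (z $ i1))\<^sup>2 < r i1")
      case True
      have "(cmod (z $ j))\<^sup>2 \<in> (if j = i1 then {r i1 - \<kappa><..<r i1} else {- 1<..<2 * X})" for j
      proof (cases "j = i1")
        case False
        have "(cmod (z $ j))\<^sup>2 < r j * (1 + \<rho>)"
          using zj[of j] A[of r] False by (auto simp: mult_interval_def split: if_splits)
        also have "r j * (1 + \<rho>) \<le> X" using R_le r by (auto simp: nodes_def)
        finally have "(cmod (z $ j))\<^sup>2 < 2 * X" using X by simp
        moreover have "- 1 < (cmod (z $ j))\<^sup>2" by (rule less_le_trans[of _ 0]) auto
        ultimately show ?thesis using False by simp
      qed (use zj[of i1] i01 True in auto)
      then show ?thesis by (auto simp: shelf_def modulus_box_def)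
    next
      case False
      have "(cmod (z $ j))\<^sup>2 \<in> (if j = i0 then A r
         else if j = i1 then {r j..<r j * (1 + \<rho>)} else mult_interval \<rho> (r j))" for j
        using zj[of j] False by (auto split: if_splits)
      then show ?thesis by (simp add: core_def modulus_box_def)
    qed
  qed
  ultimately show ?thesis
    unfolding region_def skeleton_def by (auto simp: nodes_def) blast+
qed

lemma core_disjoint_skeleton:
  assumes A: "\<And>r. A r \<subseteq> mult_interval \<rho> (r i0)" and r: "r \<in> nodes"
  shows "core A r \<inter> skeleton (- 1) = {}"
proof (rule ccontr)
  assume "core A r \<inter> skeleton (- 1) \<noteq> {}"
  then obtain z where z: "z \<in> core A r" "z \<in> skeleton (- 1)" by auto
  have rR: "r j \<in> R" for j using r by (simp add: nodes_def)
  have c: "r j \<le> (cmod (z $ j))\<^sup>2" "(cmod (z $ j))\<^sup>2 < r j * (1 + \<rho>)" "(cmod (z $ j))\<^sup>2 < X" for j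
    using core_coord[OF A z(1), of j] R_le[OF rR, of j] by auto
  from z(2) consider "z \<in> wall (- 1)" | r' where "r' \<in> R" "z \<in> shelf (- 1) r'" | k where "z \<in> slab k" | k where "z \<in> rod k"
    by (auto simp: skeleton_def)
  then show False
  proof cases
    case 1
    then have "(cmod (z $ i0))\<^sup>2 < \<kappa>" by (auto simp: wall_def bar_def modulus_box_def dest: spec[of _ i0])
    then show False using c(1)[of i0] R_ge[OF rR[of i0]] by simp
  next
    case 2
    then have s: "r' - \<kappa> < (cmod (z $ i1))\<^sup>2" "(cmod (z $ i1))\<^sup>2 < r'"
      by (auto simp: shelf_def modulus_box_def dest: spec[of _ i1])
    then have "r i1 < r'" using c(1)[of i1] by simp
    then have "r i1 * (1 + \<rho>) \<le> r' - \<kappa>" using gap[OF rR 2(1)] by simp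
    then show False using c(2)[of i1] s by simp
  next
    case 3
    then have "radius k < (cmod (z $ i1))\<^sup>2" using i01 by (auto simp: slab_def bar_def modulus_box_def dest: spec[of _ i1])
    then show False using c(3)[of i1] radius_ge(1)[of k] by simp
  next
    case 4
    then have "radius k < (cmod (z $ i1))\<^sup>2" using i01 by (auto simp: rod_def bar_def modulus_box_def dest: spec[of _ i1])
    then show False using c(3)[of i1] radius_ge(1)[of k] by simp
  qed
qed

lemma power_integral_node_nonneg:
  assumes "r \<in> nodes"
  shows "0 \<le> power_integral k (mult_interval \<rho> (r j))"
proof -
  have "0 < r j" using assms R_ge[of "r j"] \<kappa> by (auto simp: nodes_def intro: less_trans)
  then have le: "0 \<le> r j" "r j \<le> r j * (1 + \<rho>)" using \<rho> by auto
  then have "r j ^ Suc k \<le> (r j * (1 + \<rho>)) ^ Suc k" by (intro power_mono)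
  then show ?thesis unfolding mult_interval_def power_integral_interval[OF le(2)] by simp
qed

lemma emeasure_core:
  assumes A: "\<And>r. open (A r)" "\<And>r. A r \<subseteq> mult_interval \<rho> (r i0)" and r: "r \<in> nodes"
    and \<theta>: "0 \<le> \<theta>" "\<And>k. k \<le> m \<Longrightarrow> power_integral k (A r) = \<theta> * power_integral k (mult_interval \<rho> (r i0))"
    and \<alpha>: "multi_degree \<alpha> \<le> m"
  shows "emeasure (monomial_measure \<alpha>) (core A r) =
     ennreal (\<theta> * (\<Prod>j\<in>UNIV. pi * power_integral (\<alpha> j) (mult_interval \<rho> (r j))))"
proof -
  define J where "J j = pi * power_integral (\<alpha> j) (mult_interval \<rho> (r j))" for j
  have rpos: "0 < r j" for j using r R_ge[of "r j"] \<kappa> by (auto simp: nodes_def intro: less_trans)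
  have J0: "0 \<le> J j" for j
    unfolding J_def using power_integral_node_nonneg[OF r] by simp
  have mi: "emeasure (moment_measure (\<alpha> j)) (mult_interval \<rho> (r j)) = ennreal (J j)" for j
    unfolding J_def using rpos[of j] by (intro emeasure_moment_measure) (auto simp: mult_interval_def)
  have ho: "emeasure (moment_measure (\<alpha> j)) {r j..<r j * (1 + \<rho>)} = ennreal (J j)" for j
  proof -
    have "emeasure (moment_measure (\<alpha> j)) {r j..<r j * (1 + \<rho>)} = ennreal (pi * power_integral (\<alpha> j) {r j..<r j * (1 + \<rho>)})"
      using rpos[of j] by (intro emeasure_moment_measure) auto
    then show ?thesis by (simp add: J_def power_integral_half_open mult_interval_def)
  qed
  have "\<alpha> i0 \<le> multi_degree \<alpha>" unfolding multi_degree_def by (rule member_le_sum) auto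
  then have "power_integral (\<alpha> i0) (A r) = \<theta> * power_integral (\<alpha> i0) (mult_interval \<rho> (r i0))"
    using \<theta>(2) \<alpha> by simp
  moreover have "emeasure (moment_measure (\<alpha> i0)) (A r) = ennreal (pi * power_integral (\<alpha> i0) (A r))"
  proof (rule emeasure_moment_measure)
    show "bounded (A r)" using A(2)[of r] by (rule bounded_subset[rotated]) (simp add: mult_interval_def)
    show "A r \<subseteq> {0..}" using A(2)[of r] rpos[of i0] by (auto simp: mult_interval_def)
  qed (use A(1) in simp)
  ultimately have A0: "emeasure (moment_measure (\<alpha> i0)) (A r) = ennreal (\<theta> * J i0)"
    by (simp add: J_def mult.left_commute)
  have "emeasure (monomial_measure \<alpha>) (core A r) = (\<Prod>j\<in>UNIV. emeasure (moment_measure (\<alpha> j)) (if j = i0 then A r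
     else if j = i1 then {r j..<r j * (1 + \<rho>)} else mult_interval \<rho> (r j)))"
    unfolding core_def
    by (rule emeasure_monomial_measure_modulus_box) (use A(1) in \<open>auto simp: mult_interval_def\<close>)
  also have "\<dots> = (\<Prod>j\<in>UNIV. ennreal ((if j = i0 then \<theta> else 1) * J j))"
    by (intro prod.cong refl) (auto simp: A0 mi ho)
  also have "\<dots> = ennreal (\<Prod>j\<in>UNIV. (if j = i0 then \<theta> else 1) * J j)"
    using \<theta>(1) J0 by (intro prod_ennreal) auto
  also have "(\<Prod>j\<in>UNIV. (if j = i0 then \<theta> else 1) * J j) = \<theta> * (\<Prod>j\<in>UNIV. J j)"
    by (simp add: prod.distrib)
  finally show ?thesis by (simp add: J_def)
qed

lemma emeasure_region:
  assumes A: "\<And>r. open (A r)" "\<And>r. A r \<subseteq> mult_interval \<rho> (r i0)"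
    and \<theta>: "\<And>r. 0 \<le> \<theta> r"
      "\<And>r k. r \<in> nodes \<Longrightarrow> k \<le> m \<Longrightarrow> power_integral k (A r) = \<theta> r * power_integral k (mult_interval \<rho> (r i0))"
    and \<alpha>: "multi_degree \<alpha> \<le> m"
  shows "emeasure (monomial_measure \<alpha>) (region A (- 1)) = emeasure (monomial_measure \<alpha>) (skeleton (- 1)) +
     ennreal (\<Sum>r\<in>nodes. \<theta> r * (\<Prod>j\<in>UNIV. pi * power_integral (\<alpha> j) (mult_interval \<rho> (r j))))"
proof -
  have meas: "core A r \<in> sets (monomial_measure \<alpha>)" for r
    unfolding core_def using A(1) by (simp, intro sets_modulus_box) (auto simp: mult_interval_def)
  have "disjoint_family_on (core A) nodes"
    unfolding disjoint_family_on_def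
  proof (intro ballI impI, rule ccontr)
    fix r r' assume r: "r \<in> nodes" "r' \<in> nodes" "r \<noteq> r'" "core A r \<inter> core A r' \<noteq> {}"
    then obtain z where z: "z \<in> core A r" "z \<in> core A r'" by auto
    have "r j = r' j" for j
      by (rule R_disjoint[OF _ _ core_coord[OF A(2) z(1)] core_coord[OF A(2) z(2)]]) (use r in \<open>auto simp: nodes_def\<close>)
    then show False using r(3) by auto
  qed
  then have "emeasure (monomial_measure \<alpha>) (\<Union>r\<in>nodes. core A r) = (\<Sum>r\<in>nodes. emeasure (monomial_measure \<alpha>) (core A r))"
    using meas finite_nodes by (intro sum_emeasure[symmetric]) auto
  also have "\<dots> = (\<Sum>r\<in>nodes. ennreal (\<theta> r * (\<Prod>j\<in>UNIV. pi * power_integral (\<alpha> j) (mult_interval \<rho> (r j)))))"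
    by (intro sum.cong refl emeasure_core A \<theta> \<alpha>)
  also have "\<dots> = ennreal (\<Sum>r\<in>nodes. \<theta> r * (\<Prod>j\<in>UNIV. pi * power_integral (\<alpha> j) (mult_interval \<rho> (r j))))"
    using \<theta>(1) by (intro sum_ennreal mult_nonneg_nonneg prod_nonneg) (auto intro: power_integral_node_nonneg)
  finally have cores: "emeasure (monomial_measure \<alpha>) (\<Union>r\<in>nodes. core A r) = \<dots>" .
  have "emeasure (monomial_measure \<alpha>) (skeleton (- 1) \<union> (\<Union>r\<in>nodes. core A r)) =
      emeasure (monomial_measure \<alpha>) (skeleton (- 1)) + emeasure (monomial_measure \<alpha>) (\<Union>r\<in>nodes. core A r)"
  proof (rule plus_emeasure[symmetric])
    show "skeleton (- 1) \<in> sets (monomial_measure \<alpha>)" using open_skeleton by simp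
    show "(\<Union>r\<in>nodes. core A r) \<in> sets (monomial_measure \<alpha>)"
      using meas finite_nodes by (intro sets.finite_UN) auto
    show "skeleton (- 1) \<inter> (\<Union>r\<in>nodes. core A r) = {}"
      using core_disjoint_skeleton[of A] A(2) by blast
  qed
  then show ?thesis unfolding region_eq_core[of A, OF A(2)] cores .
qed

end

section \<open>The domain and its Bergman kernel\<close>

lemma rotation_closed_imp_reinhardt:
  fixes \<Omega> :: "(complex ^ 'n::finite) set"
  assumes rot: "rotation_closed \<Omega>" and z: "z \<in> \<Omega>"
  shows "(\<chi> j. exp (\<i> * complex_of_real (\<theta> j)) * z $ j) \<in> \<Omega>"
proof -
  define m where "m S = (\<chi> j. if j \<in> S then exp (\<i> * complex_of_real (\<theta> j)) * z $ j else z $ j)" for S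
  have "m S \<in> \<Omega>" if "finite S" for S
    using that
  proof (induction S rule: finite_induct)
    case empty
    then show ?case using z by (simp add: m_def)
  next
    case (insert j S)
    have "m (insert j S) = rotate_coord j (\<theta> j) (m S)"
      using insert.hyps by (auto simp: m_def vec_eq_iff rotate_coord_nth cis_conv_exp)
    then show ?case using insert.IH rot by (simp add: rotation_closed_def)
  qed
  from this[of UNIV] show ?thesis by (simp add: m_def)
qed

lemma square_nn_integral_monomial_on:
  fixes \<Omega> :: "(complex ^ 'n::finite) set"
  assumes "open \<Omega>"
  shows "square_nn_integral \<Omega> (monomial_on \<Omega> \<alpha>) = emeasure (monomial_measure \<alpha>) \<Omega>"
proof -
  have "emeasure (monomial_measure \<alpha>) \<Omega> = (\<integral>\<^sup>+z. ennreal (\<Prod>j\<in>UNIV. (cmod (z $ j))\<^sup>2 ^ \<alpha> j) * indicator \<Omega> z \<partial>lborel)"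
    unfolding monomial_measure_def by (rule emeasure_density) (use assms in auto)
  also have "\<dots> = square_nn_integral \<Omega> (monomial_on \<Omega> \<alpha>)"
    unfolding square_nn_integral_def
  proof (intro nn_integral_cong)
    fix z :: "complex ^ 'n"
    have "(cmod (\<Prod>j\<in>UNIV. (z $ j) ^ \<alpha> j))\<^sup>2 = (\<Prod>j\<in>UNIV. (cmod (z $ j))\<^sup>2 ^ \<alpha> j)"
      by (simp add: prod_norm[symmetric] norm_power prod_power_distrib mult.commute flip: power_mult)
    then show "ennreal (\<Prod>j\<in>UNIV. (cmod (z $ j))\<^sup>2 ^ \<alpha> j) * indicator \<Omega> z =
        ennreal ((cmod (monomial_on \<Omega> \<alpha> z))\<^sup>2) * indicator \<Omega> z"
      by (simp add: monomial_on_def indicator_def)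
  qed
  finally show ?thesis by simp
qed

lemma bergman_inner_self:
  fixes \<Omega> :: "(complex ^ 'n::finite) set"
  assumes "open \<Omega>" "continuous_on \<Omega> f" "square_nn_integral \<Omega> f = ennreal v" "0 \<le> v"
  shows "bergman_inner \<Omega> f f = of_real v"
proof -
  have "bergman_inner \<Omega> f f = (LINT z:\<Omega>|lborel. complex_of_real ((cmod (f z))\<^sup>2))"
    unfolding bergman_inner_def by (simp only: complex_norm_square)
  also have "\<dots> = of_real (LINT z:\<Omega>|lborel. (cmod (f z))\<^sup>2)"
    by (rule set_integral_complex_of_real)
  also have "(LINT z:\<Omega>|lborel. (cmod (f z))\<^sup>2) = enn2real (\<integral>\<^sup>+z. ennreal (indicator \<Omega> z *\<^sub>R (cmod (f z))\<^sup>2) \<partial>lborel)"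
    unfolding set_lebesgue_integral_def
    using borel_measurable_square_norm[OF assms(1,2)]
    by (intro integral_eq_nn_integral) auto
  also have "(\<integral>\<^sup>+z. ennreal (indicator \<Omega> z *\<^sub>R (cmod (f z))\<^sup>2) \<partial>lborel) = square_nn_integral \<Omega> f"
    unfolding square_nn_integral_def by (intro nn_integral_cong) (auto simp: indicator_def)
  finally show ?thesis using assms(3,4) by simp
qed

text \<open>
  Rotating a coordinate in which the exponents differ, by an angle for which the two monomials acquire
  opposite signs, preserves the integral and changes its sign.
\<close>

lemma monomial_orthogonal:
  fixes \<Omega> :: "(complex ^ 'n::finite) set"
  assumes op: "open \<Omega>" and rot: "rotation_closed \<Omega>" and ne: "\<alpha> \<noteq> \<beta>"
  shows "bergman_inner \<Omega> (monomial_on \<Omega> \<alpha>) (monomial_on \<Omega> \<beta>) = 0"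
proof -
  obtain j where j: "\<alpha> j \<noteq> \<beta> j" using ne by auto
  define d where "d = int (\<alpha> j) - int (\<beta> j)"
  have d: "d \<noteq> 0" using j by (simp add: d_def)
  define \<phi> where "\<phi> = pi / of_int d"
  define h where "h z = indicat_real \<Omega> z *\<^sub>R (monomial_on \<Omega> \<alpha> z * cnj (monomial_on \<Omega> \<beta> z))" for z
  have in_iff: "rotate_coord j \<phi> z \<in> \<Omega> \<longleftrightarrow> z \<in> \<Omega>" for z
  proof
    assume "rotate_coord j \<phi> z \<in> \<Omega>"
    then have "rotate_coord j (- \<phi>) (rotate_coord j \<phi> z) \<in> \<Omega>" using rot by (auto simp: rotation_closed_def)
    then show "z \<in> \<Omega>" by (simp add: rotate_coord_add)
  qed (use rot in \<open>auto simp: rotation_closed_def\<close>)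
  have hrot: "h (rotate_coord j \<phi> z) = - h z" for z
  proof (cases "z \<in> \<Omega>")
    case True
    have "cis (of_int (int (\<alpha> j)) * \<phi>) * cnj (cis (of_int (int (\<beta> j)) * \<phi>)) = cis (of_int d * \<phi>)"
      by (simp add: cis_cnj cis_mult d_def algebra_simps)
    also have "\<dots> = - 1" using d by (simp add: \<phi>_def)
    finally have c: "cis (of_int (int (\<alpha> j)) * \<phi>) * cnj (cis (of_int (int (\<beta> j)) * \<phi>)) = - 1" .
    have "monomial_on \<Omega> \<alpha> (rotate_coord j \<phi> z) * cnj (monomial_on \<Omega> \<beta> (rotate_coord j \<phi> z)) =
       (cis (of_int (int (\<alpha> j)) * \<phi>) * cnj (cis (of_int (int (\<beta> j)) * \<phi>))) *
       (monomial_on \<Omega> \<alpha> z * cnj (monomial_on \<Omega> \<beta> z))"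
      using weight_on_monomial_on[OF rot, of j \<alpha>] weight_on_monomial_on[OF rot, of j \<beta>] True
      unfolding weight_on_def by (simp add: mult_ac)
    then show ?thesis unfolding c using True by (simp add: h_def in_iff)
  qed (simp add: h_def in_iff)
  have cont: "continuous_on \<Omega> (\<lambda>z. monomial_on \<Omega> \<alpha> z * cnj (monomial_on \<Omega> \<beta> z))"
    by (intro continuous_intros holomorphic_cn_continuous_on holomorphic_cn_monomial_on op)
  have hm: "h \<in> borel_measurable borel"
    unfolding h_def by (intro borel_measurable_continuous_on_indicator cont) (use op in auto)
  have "(\<integral>z. h z \<partial>lborel) = (\<integral>z. h (rotate_coord j \<phi> z) \<partial>lborel)"
  proof -
    have "rotate_coord j \<phi> \<in> measurable lborel borel"
      by (simp add: borel_measurable_continuous_onI continuous_intros)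
    from integral_distr[OF this hm] show ?thesis by (simp add: distr_rotate_coord)
  qed
  also have "\<dots> = - (\<integral>z. h z \<partial>lborel)" by (simp add: hrot)
  finally have "(\<integral>z. h z \<partial>lborel) = 0" by simp
  then show ?thesis unfolding bergman_inner_def set_lebesgue_integral_def h_def .
qed

text \<open>
  First \<open>R\<close>, \<open>\<rho>\<close> and the bound for \<open>C\<close> are chosen; given \<open>C\<close>, the thickness \<open>\<kappa>\<close> is taken so small that the
  moments \<open>\<sigma>\<close> of the skeleton, which do not depend on the densities, can be subtracted from the target.
\<close>

lemma domain_with_moments:
  fixes m :: nat
  assumes "CARD('n::finite) \<ge> 2"
  obtains C0 :: real where "0 \<le> C0"
    "\<And>C. C > C0 \<Longrightarrow> \<exists>\<Omega> :: (complex ^ 'n) set. open \<Omega> \<and> connected \<Omega> \<and> rotation_closed \<Omega> \<and> \<not> bounded \<Omega> \<and>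
       0 \<in> \<Omega> \<and> connected (\<Omega> \<inter> nonzero_coords) \<and>
       (\<forall>\<alpha>. multi_degree \<alpha> \<le> m \<longrightarrow> emeasure (monomial_measure \<alpha>) \<Omega> =
          ennreal (fact (m - multi_degree \<alpha>) * (\<Prod>j\<in>UNIV. fact (\<alpha> j)) / (C * fact m))) \<and>
       (\<forall>\<alpha>. multi_degree \<alpha> > m \<longrightarrow> emeasure (monomial_measure \<alpha>) \<Omega> = \<infinity>)"
proof -
  obtain i0 i1 :: 'n where i01: "i0 \<noteq> i1"
  proof -
    have "\<not> is_singleton (UNIV :: 'n set)" using assms by (auto simp: is_singleton_altdef)
    then show ?thesis using that by (metis UNIV_I is_singletonI' UNIV_not_empty)
  qed
  obtain R \<rho> C0 where R: "finite R" "R \<noteq> {}" "\<And>r. r \<in> R \<Longrightarrow> r > 0" and \<rho>: "\<rho> > 0"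
    and gap: "\<And>r r'. r \<in> R \<Longrightarrow> r' \<in> R \<Longrightarrow> r < r' \<Longrightarrow> r * (1 + \<rho>) < r'" and C0: "C0 \<ge> 0"
    and dens: "\<And>C. C > C0 \<Longrightarrow> \<exists>\<eta>>0. \<forall>\<sigma> :: ('n \<Rightarrow> nat) \<Rightarrow> real. (\<forall>\<alpha>. multi_degree \<alpha> \<le> m \<longrightarrow> \<bar>\<sigma> \<alpha>\<bar> \<le> \<eta>) \<longrightarrow>
       (\<exists>\<theta>. (\<forall>r. 0 \<le> \<theta> r \<and> \<theta> r \<le> 1) \<and> (\<forall>\<alpha>. multi_degree \<alpha> \<le> m \<longrightarrow>
         (\<Sum>r\<in>{r. \<forall>j. r j \<in> R}. \<theta> r * (\<Prod>j\<in>UNIV. pi * power_integral (\<alpha> j) (mult_interval \<rho> (r j)))) =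
         fact (m - multi_degree \<alpha>) * (\<Prod>j\<in>UNIV. fact (\<alpha> j)) / (C * fact m) - \<sigma> \<alpha>))"
    by (rule box_densities[where m = m and 'n = 'n]) (rule that; assumption)
  define X where "X = max 1 (Max ((\<lambda>r. r * (1 + \<rho>)) ` R))"
  have X: "1 \<le> X" "\<And>r. r \<in> R \<Longrightarrow> r * (1 + \<rho>) \<le> X"
    using R(1) by (auto simp: X_def intro!: max.coboundedI2 Max_ge)
  have R_ev: "\<forall>\<^sub>F \<kappa> in at_right (0::real). (\<forall>r\<in>R. \<kappa> < r) \<and>
      (\<forall>r\<in>R. \<forall>r'\<in>R. r < r' \<longrightarrow> r * (1 + \<rho>) \<le> r' - \<kappa>) \<and> 0 < \<kappa> \<and> \<kappa> \<le> 1"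
  proof (intro eventually_conj eventually_ball_finite R(1) ballI)
    fix r r' assume r: "r \<in> R" "r' \<in> R"
    show "\<forall>\<^sub>F \<kappa> in at_right 0. r < r' \<longrightarrow> r * (1 + \<rho>) \<le> r' - \<kappa>"
    proof (cases "r < r'")
      case True
      then have "0 < r' - r * (1 + \<rho>)" using gap[OF r] by simp
      then have "\<forall>\<^sub>F \<kappa> in at_right 0. \<kappa> < r' - r * (1 + \<rho>)"
        by (rule eventually_at_rightI[of 0 "r' - r * (1 + \<rho>)", rotated]) simp
      then show ?thesis by eventually_elim simp
    qed simp
  next
    fix r assume "r \<in> R"
    then have "0 < r" by (rule R(3))
    then show "\<forall>\<^sub>F \<kappa> in at_right 0. \<kappa> < r" by (rule eventually_at_rightI[of 0 r, rotated]) simp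
  next
    show "\<forall>\<^sub>F \<kappa> in at_right (0::real). 0 < \<kappa>" by (simp add: eventually_at_right_less)
    show "\<forall>\<^sub>F \<kappa> in at_right (0::real). \<kappa> \<le> 1" by (rule eventually_at_rightI[of 0 1]) auto
  qed
  define B where "B = pi ^ CARD('n) *
     ((1 + real (card R)) * (2 * X) ^ (m + CARD('n) - 1) + 2 * (8 ^ (m + CARD('n) - 1) + 2 ^ (m + 1)))"
  have B: "B > 0" unfolding B_def using X(1) by (intro mult_pos_pos add_nonneg_pos) (auto intro!: add_pos_pos)
  show ?thesis
  proof (rule that[OF C0])
    fix C assume C: "C > C0"
    from dens[OF C] obtain \<eta> where \<eta>: "\<eta> > 0" and
      solve: "\<And>\<sigma> :: ('n \<Rightarrow> nat) \<Rightarrow> real. (\<forall>\<alpha>. multi_degree \<alpha> \<le> m \<longrightarrow> \<bar>\<sigma> \<alpha>\<bar> \<le> \<eta>) \<Longrightarrow>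
       \<exists>\<theta>. (\<forall>r. 0 \<le> \<theta> r \<and> \<theta> r \<le> 1) \<and> (\<forall>\<alpha>. multi_degree \<alpha> \<le> m \<longrightarrow>
         (\<Sum>r\<in>{r. \<forall>j. r j \<in> R}. \<theta> r * (\<Prod>j\<in>UNIV. pi * power_integral (\<alpha> j) (mult_interval \<rho> (r j)))) =
         fact (m - multi_degree \<alpha>) * (\<Prod>j\<in>UNIV. fact (\<alpha> j)) / (C * fact m) - \<sigma> \<alpha>)"
      by blast
    have "0 < \<eta> / B" using \<eta> B by simp
    then have "\<forall>\<^sub>F \<kappa> in at_right 0. \<kappa> < \<eta> / B" by (rule eventually_at_rightI[of 0 "\<eta> / B", rotated]) simp
    with R_ev have "\<forall>\<^sub>F \<kappa> in at_right (0::real). ((\<forall>r\<in>R. \<kappa> < r) \<and>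
      (\<forall>r\<in>R. \<forall>r'\<in>R. r < r' \<longrightarrow> r * (1 + \<rho>) \<le> r' - \<kappa>) \<and> 0 < \<kappa> \<and> \<kappa> \<le> 1) \<and> \<kappa> < \<eta> / B"
      by (rule eventually_conj)
    then obtain \<kappa> where \<kappa>: "\<forall>r\<in>R. \<kappa> < r" "\<forall>r\<in>R. \<forall>r'\<in>R. r < r' \<longrightarrow> r * (1 + \<rho>) \<le> r' - \<kappa>"
       "0 < \<kappa>" "\<kappa> \<le> 1" "\<kappa> < \<eta> / B"
      using eventually_happens'[OF trivial_limit_at_right_real] by blast
    interpret S: reinhardt_skeleton i0 i1 R \<rho> X \<kappa> m
      by standard (use i01 R \<rho> \<kappa> X in auto)
    have bound: "S.skeleton_bound = B" by (simp add: S.skeleton_bound_def B_def)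
    have nodes: "S.nodes = {r. \<forall>j. r j \<in> R}" by (simp add: S.nodes_def)
    define \<sigma> where "\<sigma> \<alpha> = enn2real (emeasure (monomial_measure \<alpha>) (S.skeleton (- 1)))" for \<alpha>
    have \<kappa>B: "\<kappa> * B \<le> \<eta>" using \<kappa>(5) B by (simp add: field_simps)
    have \<sigma>: "emeasure (monomial_measure \<alpha>) (S.skeleton (- 1)) = ennreal (\<sigma> \<alpha>)" "0 \<le> \<sigma> \<alpha>" "\<sigma> \<alpha> \<le> \<eta>"
      if \<alpha>: "multi_degree \<alpha> \<le> m" for \<alpha>
    proof -
      have le: "emeasure (monomial_measure \<alpha>) (S.skeleton (- 1)) \<le> ennreal (\<kappa> * B)"
        using S.emeasure_skeleton_le[OF \<alpha>] by (simp add: bound)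
      then have "emeasure (monomial_measure \<alpha>) (S.skeleton (- 1)) < \<infinity>"
        by (rule le_less_trans) simp
      then show eq: "emeasure (monomial_measure \<alpha>) (S.skeleton (- 1)) = ennreal (\<sigma> \<alpha>)"
        unfolding \<sigma>_def by (simp add: ennreal_enn2real)
      show "0 \<le> \<sigma> \<alpha>" by (simp add: \<sigma>_def)
      have "\<sigma> \<alpha> \<le> \<kappa> * B" using le B \<kappa>(3) unfolding eq by (simp add: ennreal_le_iff)
      then show "\<sigma> \<alpha> \<le> \<eta>" using \<kappa>B by simp
    qed
    obtain \<theta> where \<theta>: "\<And>r. 0 \<le> \<theta> r \<and> \<theta> r \<le> 1" and sum\<theta>: "\<And>\<alpha>. multi_degree \<alpha> \<le> m \<Longrightarrow>
         (\<Sum>r\<in>S.nodes. \<theta> r * (\<Prod>j\<in>UNIV. pi * power_integral (\<alpha> j) (mult_interval \<rho> (r j)))) =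
         fact (m - multi_degree \<alpha>) * (\<Prod>j\<in>UNIV. fact (\<alpha> j)) / (C * fact m) - \<sigma> \<alpha>"
      using solve[of \<sigma>] \<sigma> unfolding nodes by (auto simp: abs_le_iff) 
    have "\<exists>A. open A \<and> A \<subseteq> mult_interval \<rho> (r i0) \<and> A \<subseteq> {0<..} \<and>
       (r \<in> S.nodes \<longrightarrow> (\<forall>k\<le>m. power_integral k A = \<theta> r * power_integral k (mult_interval \<rho> (r i0))))" for r
    proof (cases "r \<in> S.nodes")
      case True
      then have r0: "0 < r i0" using R(3) by (auto simp: nodes)
      then have "r i0 < r i0 * (1 + \<rho>)" using \<rho> by simp
      from exact_density_subset[OF this, of "\<theta> r" m] \<theta>[of r] obtain A where
        "open A" "A \<subseteq> mult_interval \<rho> (r i0)"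
        "\<And>k. k \<le> m \<Longrightarrow> power_integral k A = \<theta> r * power_integral k (mult_interval \<rho> (r i0))"
        unfolding mult_interval_def by metis
      moreover have "mult_interval \<rho> (r i0) \<subseteq> {0<..}" using r0 by (auto simp: mult_interval_def)
      ultimately show ?thesis by blast
    qed (auto intro: exI[of _ "{}"])
    then obtain A where A: "\<And>r. open (A r)" "\<And>r. A r \<subseteq> mult_interval \<rho> (r i0)" "\<And>r. A r \<subseteq> {0<..}"
       "\<And>r k. r \<in> S.nodes \<Longrightarrow> k \<le> m \<Longrightarrow> power_integral k (A r) = \<theta> r * power_integral k (mult_interval \<rho> (r i0))"
      by metis
    show "\<exists>\<Omega> :: (complex ^ 'n) set. open \<Omega> \<and> connected \<Omega> \<and> rotation_closed \<Omega> \<and> \<not> bounded \<Omega> \<and>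
       0 \<in> \<Omega> \<and> connected (\<Omega> \<inter> nonzero_coords) \<and>
       (\<forall>\<alpha>. multi_degree \<alpha> \<le> m \<longrightarrow> emeasure (monomial_measure \<alpha>) \<Omega> =
          ennreal (fact (m - multi_degree \<alpha>) * (\<Prod>j\<in>UNIV. fact (\<alpha> j)) / (C * fact m))) \<and>
       (\<forall>\<alpha>. multi_degree \<alpha> > m \<longrightarrow> emeasure (monomial_measure \<alpha>) \<Omega> = \<infinity>)"
    proof (intro exI[of _ "S.region A (- 1)"] conjI allI impI)
      show "open (S.region A (- 1))" by (rule S.open_region[of A, OF A(1)])
      show "connected (S.region A (- 1))" by (rule S.connected_region[of A, OF A(1,2)]) simp
      show "rotation_closed (S.region A (- 1))" by (rule S.rotation_closed_region)
      show "\<not> bounded (S.region A (- 1))" by (rule S.unbounded_region)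
      show "0 \<in> S.region A (- 1)" by (rule S.zero_in_region)
      show "connected (S.region A (- 1) \<inter> nonzero_coords)"
        unfolding S.region_nonzero_coords[of A, OF A(3)] by (rule S.connected_region[of A, OF A(1,2)]) simp
    next
      fix \<alpha> :: "'n \<Rightarrow> nat" assume \<alpha>: "multi_degree \<alpha> \<le> m"
      let ?s = "\<Sum>r\<in>S.nodes. \<theta> r * (\<Prod>j\<in>UNIV. pi * power_integral (\<alpha> j) (mult_interval \<rho> (r j)))"
      have "0 \<le> ?s"
        using \<theta> S.power_integral_node_nonneg by (intro sum_nonneg mult_nonneg_nonneg prod_nonneg) auto
      moreover have "emeasure (monomial_measure \<alpha>) (S.region A (- 1)) = ennreal (\<sigma> \<alpha>) + ennreal ?s"
        unfolding \<sigma>(1)[OF \<alpha>, symmetric]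
        by (rule S.emeasure_region[of A \<theta>, OF A(1,2) _ A(4) \<alpha>]) (use \<theta> in auto)
      ultimately have "emeasure (monomial_measure \<alpha>) (S.region A (- 1)) = ennreal (\<sigma> \<alpha> + ?s)"
        using \<sigma>(2)[OF \<alpha>] by (simp add: ennreal_plus)
      then show "emeasure (monomial_measure \<alpha>) (S.region A (- 1)) =
          ennreal (fact (m - multi_degree \<alpha>) * (\<Prod>j\<in>UNIV. fact (\<alpha> j)) / (C * fact m))"
        by (simp add: sum\<theta>[OF \<alpha>])
    next
      fix \<alpha> :: "'n \<Rightarrow> nat" assume "multi_degree \<alpha> > m"
      then show "emeasure (monomial_measure \<alpha>) (S.region A (- 1)) = \<infinity>"
        by (rule S.emeasure_region_infinite[of A, OF A(1)])
    qed
  qed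
qed

theorem theorem1p1:
  fixes m :: nat
  assumes "m \<ge> 1" and "CARD('n::finite) \<ge> 2"
  shows "\<exists>C0 :: real. \<forall>C > C0. \<exists>\<Omega> :: (complex ^ 'n) set.
    reinhardt_domain \<Omega> \<and> \<not> bounded \<Omega> \<and>
    bergman_space \<Omega> = cspan (monomial_on \<Omega> ` {\<alpha>. multi_degree \<alpha> \<le> m}) \<and>
    bergman_separates_points \<Omega> \<and>
    (\<exists>K. is_bergman_kernel \<Omega> K \<and>
      (\<forall>z\<in>\<Omega>. K z z = complex_of_real (C * (1 + (norm z)\<^sup>2) ^ m)) \<and>
      positive_definite_on \<Omega> (kaehler_metric (bergman_form K)) \<and>
      (\<forall>z\<in>\<Omega>. \<forall>X Y. bergman_form K z X Y = of_nat m * fubini_study_form z X Y) \<and>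
      (\<forall>z\<in>\<Omega>. \<forall>X Y. kaehler_metric (bergman_form K) z X Y
                     = real m * kaehler_metric fubini_study_form z X Y))"
proof -
  obtain C0 :: real where C0: "0 \<le> C0" and dom:
    "\<And>C. C > C0 \<Longrightarrow> \<exists>\<Omega> :: (complex ^ 'n) set. open \<Omega> \<and> connected \<Omega> \<and> rotation_closed \<Omega> \<and> \<not> bounded \<Omega> \<and>
       0 \<in> \<Omega> \<and> connected (\<Omega> \<inter> nonzero_coords) \<and>
       (\<forall>\<alpha>. multi_degree \<alpha> \<le> m \<longrightarrow> emeasure (monomial_measure \<alpha>) \<Omega> =
          ennreal (fact (m - multi_degree \<alpha>) * (\<Prod>j\<in>UNIV. fact (\<alpha> j)) / (C * fact m))) \<and>
       (\<forall>\<alpha>. multi_degree \<alpha> > m \<longrightarrow> emeasure (monomial_measure \<alpha>) \<Omega> = \<infinity>)"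
    by (rule domain_with_moments[OF assms(2), where m = m]) (rule that; assumption)
  show ?thesis
  proof (intro exI[of _ C0] allI impI)
    fix C assume C: "C > C0"
    then have C_pos: "C > 0" using C0 by simp
    from dom[OF C] obtain \<Omega> :: "(complex ^ 'n) set" where op: "open \<Omega>" and conn: "connected \<Omega>"
      and rot: "rotation_closed \<Omega>" and unb: "\<not> bounded \<Omega>" and zero: "0 \<in> \<Omega>"
      and conn': "connected (\<Omega> \<inter> nonzero_coords)"
      and fin: "\<And>\<alpha>. multi_degree \<alpha> \<le> m \<Longrightarrow> emeasure (monomial_measure \<alpha>) \<Omega> =
          ennreal (fact (m - multi_degree \<alpha>) * (\<Prod>j\<in>UNIV. fact (\<alpha> j)) / (C * fact m))"
      and inf: "\<And>\<alpha>. multi_degree \<alpha> > m \<Longrightarrow> emeasure (monomial_measure \<alpha>) \<Omega> = \<infinity>"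
      by blast
    let ?D = "{\<alpha> :: 'n \<Rightarrow> nat. multi_degree \<alpha> \<le> m}"
    define N where "N \<alpha> = fact (m - multi_degree \<alpha>) * (\<Prod>j\<in>UNIV. fact (\<alpha> j)) / (C * fact m)" for \<alpha> :: "'n \<Rightarrow> nat"
    have N_pos: "N \<alpha> > 0" for \<alpha> using C_pos by (simp add: N_def prod_pos)
    have sq: "square_nn_integral \<Omega> (monomial_on \<Omega> \<alpha>) = (if \<alpha> \<in> ?D then ennreal (N \<alpha>) else \<infinity>)" for \<alpha>
      using fin[of \<alpha>] inf[of \<alpha>] by (simp add: square_nn_integral_monomial_on[OF op] N_def not_le)
    have span: "bergman_space \<Omega> = cspan (monomial_on \<Omega> ` ?D)"
      by (rule bergman_space_eq_span_monomials[OF op rot conn' zero finite_multi_degree_le]) (simp add: sq)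
    have mon_in: "monomial_on \<Omega> \<alpha> \<in> bergman_space \<Omega>" if "\<alpha> \<in> ?D" for \<alpha>
      unfolding span using that by (intro cfun.span_base) auto
    have subsp: "cfun.subspace (bergman_space \<Omega>)" by (rule subspace_bergman_space[OF op])

    \<comment> \<open>the normalised monomials; \<open>N \<alpha>\<close> is the squared norm of \<open>z\<^sup>\<alpha>\<close>\<close>
    define e where "e \<alpha> = fun_scale (of_real (1 / sqrt (N \<alpha>))) (monomial_on \<Omega> \<alpha>)" for \<alpha>
    define K where "K z w = of_real C * (1 + (\<Sum>j\<in>UNIV. z $ j * cnj (w $ j))) ^ m" for z w :: "complex ^ 'n"
    have e_in: "e \<alpha> \<in> bergman_space \<Omega>" if "\<alpha> \<in> ?D" for \<alpha>
      unfolding e_def by (rule cfun.subspace_scale[OF subsp mon_in[OF that]])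
    have orth: "bergman_inner \<Omega> (e \<alpha>) (e \<beta>) = (if \<alpha> = \<beta> then 1 else 0)" if "\<alpha> \<in> ?D" "\<beta> \<in> ?D" for \<alpha> \<beta>
    proof -
      have "bergman_inner \<Omega> (e \<alpha>) (e \<beta>) = of_real (1 / sqrt (N \<alpha>)) * cnj (of_real (1 / sqrt (N \<beta>))) *
          bergman_inner \<Omega> (monomial_on \<Omega> \<alpha>) (monomial_on \<Omega> \<beta>)"
        unfolding e_def bergman_inner_scale[OF op]
        by (subst (1 2) bergman_inner_cnj[OF op]) (simp add: bergman_inner_scale[OF op])
      also have "\<dots> = (if \<alpha> = \<beta> then 1 else 0)"
      proof (cases "\<alpha> = \<beta>")
        case True
        have "bergman_inner \<Omega> (monomial_on \<Omega> \<alpha>) (monomial_on \<Omega> \<alpha>) = of_real (N \<alpha>)"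
        proof (rule bergman_inner_self[OF op _ _ less_imp_le[OF N_pos]])
          show "continuous_on \<Omega> (monomial_on \<Omega> \<alpha>)"
            by (rule holomorphic_cn_continuous_on[OF holomorphic_cn_monomial_on[OF op]])
          show "square_nn_integral \<Omega> (monomial_on \<Omega> \<alpha>) = ennreal (N \<alpha>)" using that by (simp add: sq)
        qed
        moreover have "1 / sqrt (N \<alpha>) * (1 / sqrt (N \<alpha>)) * N \<alpha> = 1"
        proof -
          have "1 / sqrt (N \<alpha>) * (1 / sqrt (N \<alpha>)) = 1 / N \<alpha>"
            using N_pos[of \<alpha>] by simp
          then show ?thesis using N_pos[of \<alpha>] by simp
        qed
        moreover have "of_real a * cnj (of_real a) * of_real b = complex_of_real (a * a * b)" for a b
          by simp
        ultimately show ?thesis unfolding True[symmetric] by (simp only: of_real_1 if_True simp_thms)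
      qed (simp add: monomial_orthogonal[OF op rot])
      finally show ?thesis .
    qed
    have span_e: "bergman_space \<Omega> = cspan (e ` ?D)"
    proof
      show "cspan (e ` ?D) \<subseteq> bergman_space \<Omega>"
        by (rule cfun.span_minimal[OF _ subsp]) (use e_in in auto)
      have "monomial_on \<Omega> \<alpha> \<in> cspan (e ` ?D)" if "\<alpha> \<in> ?D" for \<alpha>
      proof -
        have "monomial_on \<Omega> \<alpha> = fun_scale (of_real (sqrt (N \<alpha>))) (e \<alpha>)"
          using N_pos[of \<alpha>] by (simp add: e_def fun_scale_def fun_eq_iff)
        then show ?thesis using that by (metis cfun.span_base cfun.span_scale imageI)
      qed
      then show "bergman_space \<Omega> \<subseteq> cspan (e ` ?D)"
        unfolding span by (intro cfun.span_minimal cfun.subspace_span) auto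
    qed
    have kernel: "is_bergman_kernel \<Omega> K"
    proof (rule is_bergman_kernel_finite_basis[OF op finite_multi_degree_le e_in orth span_e])
      fix z w assume zw: "z \<in> \<Omega>" "w \<in> \<Omega>"
      have "K z w = (\<Sum>\<alpha>\<in>?D. of_real C * (fact m / (fact (m - multi_degree \<alpha>) * (\<Prod>j\<in>UNIV. fact (\<alpha> j))) *
          (\<Prod>j\<in>UNIV. (z $ j * cnj (w $ j)) ^ \<alpha> j)))"
        unfolding K_def multinomial_multi_degree sum_distrib_left ..
      also have "\<dots> = (\<Sum>\<alpha>\<in>?D. e \<alpha> z * cnj (e \<alpha> w))"
      proof (intro sum.cong refl)
        fix \<alpha> assume "\<alpha> \<in> ?D"
        have "e \<alpha> z * cnj (e \<alpha> w) = of_real (1 / sqrt (N \<alpha>) * (1 / sqrt (N \<alpha>))) * (\<Prod>j\<in>UNIV. (z $ j * cnj (w $ j)) ^ \<alpha> j)"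
        proof -
          define s where "s = 1 / sqrt (N \<alpha>)"
          show ?thesis
            unfolding e_def s_def[symmetric]
            using zw by (simp add: fun_scale_def monomial_on_def power_mult_distrib prod.distrib mult_ac)
        qed
        also have "1 / sqrt (N \<alpha>) * (1 / sqrt (N \<alpha>)) = 1 / N \<alpha>"
          using N_pos[of \<alpha>] by simp
        also have "complex_of_real (1 / N \<alpha>) = of_real C * (fact m / (fact (m - multi_degree \<alpha>) * (\<Prod>j\<in>UNIV. fact (\<alpha> j))))"
          by (simp add: N_def)
        finally show "of_real C * (fact m / (fact (m - multi_degree \<alpha>) * (\<Prod>j\<in>UNIV. fact (\<alpha> j))) *
          (\<Prod>j\<in>UNIV. (z $ j * cnj (w $ j)) ^ \<alpha> j)) = e \<alpha> z * cnj (e \<alpha> w)"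
          by (simp add: mult.assoc)
      qed
      finally show "K z w = (\<Sum>\<alpha>\<in>?D. e \<alpha> z * cnj (e \<alpha> w))" .
    qed
    have K_diag: "K z z = complex_of_real (C * (1 + (norm z)\<^sup>2) ^ m)" for z
    proof -
      have "(\<Sum>j\<in>UNIV. z $ j * cnj (z $ j)) = of_real ((norm z)\<^sup>2)"
        by (simp add: norm_vec_def L2_set_def sum_nonneg complex_norm_square[symmetric])
      then show ?thesis by (simp add: K_def)
    qed
    have form: "bergman_form K = (\<lambda>z X Y. of_nat m * fubini_study_form z X Y)"
    proof -
      have "(\<lambda>z :: complex ^ 'n. ln (Re (K z z))) = (\<lambda>z. ln C + of_nat m * ln (1 + (norm z)\<^sup>2))"
      proof
        fix z :: "complex ^ 'n"
        have "0 < 1 + (norm z)\<^sup>2" by (simp add: add_pos_nonneg)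
        then show "ln (Re (K z z)) = ln C + of_nat m * ln (1 + (norm z)\<^sup>2)"
          unfolding K_diag Re_complex_of_real using C_pos by (simp add: ln_mult ln_realpow)
      qed
      then show ?thesis
        unfolding bergman_form_def by (simp add: i_ddbar_affine_ln_norm fun_eq_iff)
    qed
    have metric: "kaehler_metric (bergman_form K) z X Y = real m * kaehler_metric fubini_study_form z X Y" for z X Y
      by (simp add: form kaehler_metric_def)
    have sep: "bergman_separates_points \<Omega>"
      unfolding bergman_separates_points_def
    proof (intro ballI impI)
      fix a b assume ab: "a \<in> \<Omega>" "b \<in> \<Omega>" "a \<noteq> b"
      then obtain j where j: "a $ j \<noteq> b $ j" by (auto simp: vec_eq_iff)
      let ?x = "monomial_on \<Omega> (\<lambda>i. if i = j then 1 else 0)" and ?c = "monomial_on \<Omega> (\<lambda>i. 0)"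
      have "multi_degree (\<lambda>i. if i = j then 1 else 0) = 1" "multi_degree (\<lambda>i :: 'n. 0) = 0"
        by (simp_all add: multi_degree_def)
      then have "?x - fun_scale (a $ j) ?c \<in> bergman_space \<Omega>"
        using assms(1) by (intro cfun.subspace_diff cfun.subspace_scale subsp mon_in) auto
      moreover have "?x z = z $ j" "?c z = 1" if "z \<in> \<Omega>" for z
        using that by (simp_all add: monomial_on_def if_distrib[of "\<lambda>k. _ ^ k"] cong: if_cong)
      ultimately show "\<exists>f\<in>bergman_space \<Omega>. f a = 0 \<and> f b \<noteq> 0"
        using ab j by (intro bexI[of _ "?x - fun_scale (a $ j) ?c"]) (auto simp: fun_scale_def)
    qed
    have "positive_definite_on \<Omega> (kaehler_metric (bergman_form K))"
      unfolding positive_definite_on_def metric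
      using fubini_study_metric_pos assms(1) by (intro ballI allI impI mult_pos_pos) auto
    moreover have "reinhardt_domain \<Omega>"
      unfolding reinhardt_domain_def domain_def
      using op conn zero rotation_closed_imp_reinhardt[OF rot] by auto
    ultimately show "\<exists>\<Omega> :: (complex ^ 'n) set.
      reinhardt_domain \<Omega> \<and> \<not> bounded \<Omega> \<and>
      bergman_space \<Omega> = cspan (monomial_on \<Omega> ` {\<alpha>. multi_degree \<alpha> \<le> m}) \<and>
      bergman_separates_points \<Omega> \<and>
      (\<exists>K. is_bergman_kernel \<Omega> K \<and>
        (\<forall>z\<in>\<Omega>. K z z = complex_of_real (C * (1 + (norm z)\<^sup>2) ^ m)) \<and>
        positive_definite_on \<Omega> (kaehler_metric (bergman_form K)) \<and>
        (\<forall>z\<in>\<Omega>. \<forall>X Y. bergman_form K z X Y = of_nat m * fubini_study_form z X Y) \<and>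
        (\<forall>z\<in>\<Omega>. \<forall>X Y. kaehler_metric (bergman_form K) z X Y
                       = real m * kaehler_metric fubini_study_form z X Y))"
      using unb span sep kernel K_diag metric form by (intro exI[of _ \<Omega>] conjI exI[of _ K]) auto
  qed
qed

end
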